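(* Let $\nu>0$, $\alpha>0$. Suppose $u\in C^1\big([0,T_{max});\dot H^1_{\mathcal M}\big)$ is a solution of the Fourier-restricted hypodissipative Navier--Stokes equation. Then for all $0<t<T_{max}$ the evolution of enstrophy can be expressed equivalently by $$\frac{d}{dt}\frac12\|\nabla u(\cdot,t)\|_{L^2}^2=-\nu\|\nabla u\|_{\dot H^\alpha}^2-\langle(u\cdot\nabla)u,-\Delta u\rangle,$$ $$\frac{d}{dt}\frac12\|\omega(\cdot,t)\|_{L^2}^2=-\nu\|\omega\|_{\dot H^\alpha}^2+\langle S,\omega\otimes\omega\rangle,$$ $$\frac{d}{dt}\|S(\cdot,t)\|_{L^2}^2=-2\nu\|S\|_{\dot H^\alpha}^2-4\int_{\mathbb T^3}\det(S).$$ In particular, $$\frac{d}{dt}\|S(\cdot,t)\|_{L^2}^2\le-2\nu\|S\|_{\dot H^\alpha}^2+2\int_{\mathbb T^3}\lambda_2^+|S|^2.$$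
   Context: Function spaces: $\mathbb T^3=\mathbb R^3/\mathbb Z^3$, $\hat u(k)=\int_{\mathbb T^3}u(x)e^{-2\pi i k\cdot x}\,dx$ for $k\in\mathbb Z^3$. For $s\ge0$, $\dot H^s$ is the space of mean-zero $L^2$ functions (scalar, vector or matrix valued) with $\|u\|_{\dot H^s}^2=\sum_{k\ne0}(4\pi^2|k|^2)^s|\hat u(k)|^2<\infty$. $(-\Delta)^\alpha$ is the Fourier multiplier $(4\pi^2|k|^2)^\alpha$; $\langle\cdot,\cdot\rangle$ is the $L^2(\mathbb T^3)$ inner product. Frequencies: let $\sigma=(1,1,1)$. For integers $m\ge0$ let $k^m=2^{2m}\sigma+3^m(1,0,-1)$, $h^m=2^{2m+1}\sigma+3^m(1,1,-2)$, $j^m=2^{2m+1}\sigma+3^m(2,-1,-1)$. For $v\in\mathbb R^3$, $\mathcal P[v]$ is the set of all vectors obtained by permuting the entries of $v$. Let $\mathcal M^+_{2m}=\mathcal P[k^m]$, $\mathcal M^+_{2m+1}=\mathcal P[h^m]\cup\mathcal P[j^m]$, $\mathcal M^+=\bigcup_{n\ge0}\mathcal M_n^+$, $\mathcal M=\mathcal M^+\cup(-\mathcal M^+)$. For $k\in\mathcal M$ let $P_k^\perp(\sigma)=\sigma-\frac{k\cdot\sigma}{|k|^2}k$ and $v^k=P_k^\perp(\sigma)/|P_k^\perp(\sigma)|$. Constraint space: $\dot H^s_{\mathcal M}$ is the set of $u\in\dot H^s(\mathbb T^3;\mathbb R^3)$ with $\operatorname{supp}\hat u\subset\mathcal M$ and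 $\hat u(k)\in\operatorname{span}\{v^k\}$ (complex multiples of $v^k$) for all $k\in\mathcal M$; such fields are divergence free. The projection $\mathbb P_{\mathcal M}$ is given by $\widehat{\mathbb P_{\mathcal M}w}(k)=(v^k\cdot\hat w(k))v^k$ for $k\in\mathcal M$ and $0$ for $k\notin\mathcal M$. Equation: the Fourier-restricted hypodissipative Navier--Stokes equation is $\partial_tu+\nu(-\Delta)^\alpha u+\mathbb P_{\mathcal M}((u\cdot\nabla)u)=0$, with solutions understood in the mild sense: $u(\cdot,t)=e^{-\nu t(-\Delta)^\alpha}u^0-\int_0^te^{-\nu(t-\tau)(-\Delta)^\alpha}\mathbb P_{\mathcal M}((u\cdot\nabla)u)(\cdot,\tau)\,d\tau$. $\omega=\nabla\times u$ is the vorticity, $S_{ij}=\frac12(\partial_iu_j+\partial_ju_i)$ the strain matrix with eigenvalues $\lambda_1\le\lambda_2\le\lambda_3$, $|S|$ its Frobenius norm, and $f^+=\max(f,0)$. *)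

theory Defs
  imports "HOL-Analysis.Analysis"
begin

text \<open>
  A function on the torus is represented by a \<open>\<int>\<^sup>3\<close>-periodic function on \<open>\<real>\<^sup>3\<close>, and integrals over the
  torus are integrals over the unit cube. Functions are representatives of their \<open>L\<^sup>2\<close> classes;
  nothing below depends on the choice of representative except on a null set.
\<close>

definition T3 :: "(real^3) measure" where
  "T3 = restrict_space lborel (cbox 0 (\<chi> i. 1))"

definition rvec :: "int^3 \<Rightarrow> real^3" where
  "rvec k = (\<chi> i. real_of_int (k $ i))"

definition periodic :: "(real^3 \<Rightarrow> 'a) \<Rightarrow> bool" where
  "periodic f \<longleftrightarrow> (\<forall>x k. f (x + rvec k) = f x)"

definition L2 :: "(real^3 \<Rightarrow> 'a::euclidean_space) set" where
  "L2 = {f. periodic f \<and> f \<in> borel_measurable T3 \<and> integrable T3 (\<lambda>x. (norm (f x))\<^sup>2)}"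

definition l2_inner :: "(real^3 \<Rightarrow> 'a::euclidean_space) \<Rightarrow> (real^3 \<Rightarrow> 'a) \<Rightarrow> real" where
  "l2_inner f g = (LINT x|T3. f x \<bullet> g x)"

text \<open>On \<^typ>\<open>real^3^3\<close> the norm and inner product of the library are those of Frobenius.\<close>

definition l2_norm :: "(real^3 \<Rightarrow> 'a::euclidean_space) \<Rightarrow> real" where
  "l2_norm f = sqrt (LINT x|T3. (norm (f x))\<^sup>2)"

definition fcoef :: "(real^3 \<Rightarrow> real) \<Rightarrow> int^3 \<Rightarrow> complex" where
  "fcoef f k = (LINT x|T3. complex_of_real (f x) * exp (- (2 * pi * \<i> * complex_of_real (rvec k \<bullet> x))))"

definition vfcoef :: "(real^3 \<Rightarrow> real^3) \<Rightarrow> int^3 \<Rightarrow> complex^3" where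
  "vfcoef u k = (\<chi> i. fcoef (\<lambda>x. u x $ i) k)"

text \<open>The squared modulus of the \<open>k\<close>-th Fourier coefficient of a scalar, vector or matrix valued function.\<close>

definition fcoef_sq :: "(real^3 \<Rightarrow> 'a::euclidean_space) \<Rightarrow> int^3 \<Rightarrow> real" where
  "fcoef_sq f k = (\<Sum>b\<in>Basis. (cmod (fcoef (\<lambda>x. f x \<bullet> b) k))\<^sup>2)"

definition lap_symbol :: "int^3 \<Rightarrow> real" where
  "lap_symbol k = 4 * pi\<^sup>2 * (norm (rvec k))\<^sup>2"

definition Hdot :: "real \<Rightarrow> (real^3 \<Rightarrow> 'a::euclidean_space) set" where
  "Hdot s = {f \<in> L2. (LINT x|T3. f x) = 0 \<and>
     (\<lambda>k. lap_symbol k powr s * fcoef_sq f k) summable_on {k. k \<noteq> 0}}"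

definition Hdot_norm :: "real \<Rightarrow> (real^3 \<Rightarrow> 'a::euclidean_space) \<Rightarrow> real" where
  "Hdot_norm s f = sqrt (\<Sum>\<^sub>\<infinity>k\<in>{k. k \<noteq> 0}. lap_symbol k powr s * fcoef_sq f k)"

text \<open>
  The \<open>L\<^sup>2\<close> function with Fourier coefficients \<open>m k * fcoef f k\<close>; when it exists it is unique almost
  everywhere, and which representative is chosen depends only on the coefficients of \<open>f\<close>. The symbol \<open>2\<pi>ik\<^sub>j\<close> gives the weak derivative.
\<close>

definition fourier_mult :: "(int^3 \<Rightarrow> complex) \<Rightarrow> (real^3 \<Rightarrow> real) \<Rightarrow> real^3 \<Rightarrow> real" where
  "fourier_mult m f = (SOME g. g \<in> L2 \<and> (\<forall>k. fcoef g k = m k * fcoef f k))"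

definition pd :: "3 \<Rightarrow> (real^3 \<Rightarrow> real) \<Rightarrow> real^3 \<Rightarrow> real" where
  "pd j = fourier_mult (\<lambda>k. 2 * pi * \<i> * of_int (k $ j))"

definition neg_lap_pow :: "real \<Rightarrow> (real^3 \<Rightarrow> real^3) \<Rightarrow> real^3 \<Rightarrow> real^3" where
  "neg_lap_pow a u x =
     (\<chi> i. fourier_mult (\<lambda>k. complex_of_real (lap_symbol k powr a)) (\<lambda>y. u y $ i) x)"

definition neg_lap :: "(real^3 \<Rightarrow> real^3) \<Rightarrow> real^3 \<Rightarrow> real^3" where
  "neg_lap = neg_lap_pow 1"

definition grad :: "(real^3 \<Rightarrow> real^3) \<Rightarrow> real^3 \<Rightarrow> real^3^3" where
  "grad u x = (\<chi> i j. pd i (\<lambda>y. u y $ j) x)"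

definition convect :: "(real^3 \<Rightarrow> real^3) \<Rightarrow> (real^3 \<Rightarrow> real^3) \<Rightarrow> real^3 \<Rightarrow> real^3" where
  "convect u w x = (\<chi> i. \<Sum>j\<in>UNIV. u x $ j * pd j (\<lambda>y. w y $ i) x)"

definition vorticity :: "(real^3 \<Rightarrow> real^3) \<Rightarrow> real^3 \<Rightarrow> real^3" where
  "vorticity u x = vector
     [pd 2 (\<lambda>y. u y $ 3) x - pd 3 (\<lambda>y. u y $ 2) x,
      pd 3 (\<lambda>y. u y $ 1) x - pd 1 (\<lambda>y. u y $ 3) x,
      pd 1 (\<lambda>y. u y $ 2) x - pd 2 (\<lambda>y. u y $ 1) x]"

definition strain :: "(real^3 \<Rightarrow> real^3) \<Rightarrow> real^3 \<Rightarrow> real^3^3" where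
  "strain u x = (\<chi> i j. (pd i (\<lambda>y. u y $ j) x + pd j (\<lambda>y. u y $ i) x) / 2)"

definition outer :: "real^3 \<Rightarrow> real^3 \<Rightarrow> real^3^3" where
  "outer v w = (\<chi> i j. v $ i * w $ j)"

text \<open>
  The eigenvalues of a symmetric matrix in increasing order, with multiplicity: the roots of the
  characteristic polynomial.
\<close>

definition ordered_eigenvalues :: "real^3^3 \<Rightarrow> real \<Rightarrow> real \<Rightarrow> real \<Rightarrow> bool" where
  "ordered_eigenvalues A l1 l2 l3 \<longleftrightarrow> l1 \<le> l2 \<and> l2 \<le> l3 \<and>
     (\<forall>z::real. det (mat z - A) = (z - l1) * (z - l2) * (z - l3))"

definition lambda2 :: "real^3^3 \<Rightarrow> real" where
  "lambda2 A = (THE l2. \<exists>l1 l3. ordered_eigenvalues A l1 l2 l3)"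

definition sigma :: "int^3" where
  "sigma = vector [1, 1, 1]"

definition freq_k :: "nat \<Rightarrow> int^3" where
  "freq_k m = 2^(2*m) *s sigma + 3^m *s vector [1, 0, -1]"

definition freq_h :: "nat \<Rightarrow> int^3" where
  "freq_h m = 2^(2*m+1) *s sigma + 3^m *s vector [1, 1, -2]"

definition freq_j :: "nat \<Rightarrow> int^3" where
  "freq_j m = 2^(2*m+1) *s sigma + 3^m *s vector [2, -1, -1]"

definition perms :: "int^3 \<Rightarrow> (int^3) set" where
  "perms v = {(\<chi> i. v $ p i) | p. p permutes UNIV}"

definition shell :: "nat \<Rightarrow> (int^3) set" where
  "shell n = (if even n then perms (freq_k (n div 2))
              else perms (freq_h (n div 2)) \<union> perms (freq_j (n div 2)))"

definition Mplus :: "(int^3) set" where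
  "Mplus = (\<Union>n. shell n)"

definition Mfreq :: "(int^3) set" where
  "Mfreq = Mplus \<union> uminus ` Mplus"

definition perp_proj :: "int^3 \<Rightarrow> real^3 \<Rightarrow> real^3" where
  "perp_proj k x = x - ((rvec k \<bullet> x) / (norm (rvec k))\<^sup>2) *\<^sub>R rvec k"

definition vdir :: "int^3 \<Rightarrow> real^3" where
  "vdir k = perp_proj k (rvec sigma) /\<^sub>R norm (perp_proj k (rvec sigma))"

definition cvec :: "real^3 \<Rightarrow> complex^3" where
  "cvec v = (\<chi> i. complex_of_real (v $ i))"

definition HdotM :: "real \<Rightarrow> (real^3 \<Rightarrow> real^3) set" where
  "HdotM s = {u \<in> Hdot s. (\<forall>k. k \<notin> Mfreq \<longrightarrow> vfcoef u k = 0) \<and>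
     (\<forall>k\<in>Mfreq. \<exists>c::complex. vfcoef u k = c *s cvec (vdir k))}"

text \<open>The Fourier coefficients of the projection of \<open>w\<close> to the constraint space.\<close>

definition PM_coef :: "(real^3 \<Rightarrow> real^3) \<Rightarrow> int^3 \<Rightarrow> complex^3" where
  "PM_coef w k =
     (if k \<in> Mfreq
      then (\<Sum>i\<in>UNIV. complex_of_real (vdir k $ i) * vfcoef w k $ i) *s cvec (vdir k)
      else 0)"

text \<open>The interval \<open>[0, T)\<close>, where \<open>T\<close> may be infinite.\<close>

definition time_dom :: "ereal \<Rightarrow> real set" where
  "time_dom T = {t. 0 \<le> t \<and> ereal t < T}"

text \<open>\<open>C\<^sup>1([0,T); H\<^sup>1\<^sub>M)\<close>, with derivative and continuity in the norm of \<open>H\<^sup>1\<close> (one-sided at \<open>0\<close>).\<close>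

definition C1_HdotM1 :: "ereal \<Rightarrow> (real \<Rightarrow> real^3 \<Rightarrow> real^3) set" where
  "C1_HdotM1 T = {u. \<exists>u'. \<forall>t\<in>time_dom T.
      u t \<in> HdotM 1 \<and> u' t \<in> HdotM 1 \<and>
      ((\<lambda>s. Hdot_norm 1 (\<lambda>x. (u s x - u t x) /\<^sub>R (s - t) - u' t x)) \<longlongrightarrow> 0) (at t within time_dom T) \<and>
      ((\<lambda>s. Hdot_norm 1 (\<lambda>x. u' s x - u' t x)) \<longlongrightarrow> 0) (at t within time_dom T)}"

text \<open>
  The mild form of the equation. An integral with values in a space of functions on the torus
  commutes with each of the functionals \<open>vfcoef \<cdot> k\<close>, and these separate points, so the identity is
  written for the Fourier coefficients, on which the semigroup and the projection are defined.
\<close>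

definition mild_solution :: "real \<Rightarrow> real \<Rightarrow> ereal \<Rightarrow> (real \<Rightarrow> real^3 \<Rightarrow> real^3) \<Rightarrow> bool" where
  "mild_solution \<nu> \<alpha> T u \<longleftrightarrow> (\<forall>t\<in>time_dom T. \<forall>k.
     (let duhamel = (\<lambda>\<tau>. exp (- \<nu> * (t - \<tau>) * lap_symbol k powr \<alpha>) *\<^sub>R PM_coef (convect (u \<tau>) (u \<tau>)) k)
      in duhamel integrable_on {0..t} \<and>
         vfcoef (u t) k =
           exp (- \<nu> * t * lap_symbol k powr \<alpha>) *\<^sub>R vfcoef (u 0) k - integral {0..t} duhamel))"

end

theory Submission
  imports Defs
begin

text \<open>
  Every frequency \<open>k \<in> \<M>\<close> satisfies \<open>|k \<cdot> \<sigma>| = 3 \<cdot> 2\<^sup>n\<close> for its shell \<open>n\<close>, and \<open>|k|\<close> is comparable to \<open>2\<^sup>n\<close>.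
  A relation \<open>k = l + l'\<close> inside \<open>\<M>\<close> therefore forces the three shells to be adjacent, so the convolution
  defining the nonlinearity has boundedly many terms, all at comparable scales: a bound \<open>|k|\<^sup>-\<^sup>s\<close> on the
  coefficients of \<open>u\<close> gives \<open>|k|\<^sup>1\<^sup>-\<^sup>2\<^sup>s\<close> for those of the nonlinearity. Starting from \<open>s = 1\<close>, which is
  the \<open>H\<^sup>1\<close> hypothesis, the mild formula gains \<open>2\<alpha>\<close> powers at each step, so the solution is smooth for
  positive times. The enstrophy is then differentiated mode by mode, and the three forms of its balance
  agree because \<open>\<integral> tr ((\<nabla>u)\<^sup>3) = 0\<close> for divergence free fields while \<open>tr (\<nabla>u (\<nabla>u) (\<nabla>u)\<^sup>T)\<close> and
  \<open>tr ((\<nabla>u)\<^sup>3)\<close> are both combinations of \<open>det S\<close> and \<open>S : \<omega> \<otimes> \<omega>\<close>. On sums of exponentials,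
  integration by parts is the statement that \<open>k\<^sub>1 + k\<^sub>2 + k\<^sub>3\<close> vanishes whenever the product has a mean.
\<close>

section \<open>Trigonometric exponentials on the torus\<close>

text \<open>The derivatives in the statement are values of \<open>SOME\<close>, so nothing is known
  about them before existence and uniqueness are settled. Riesz--Fischer gives existence,
  completeness of the exponentials gives uniqueness almost everywhere; together they replace every
  field by an explicit absolutely convergent series, whose products are bounded and can be
  integrated term by term. Sparseness makes this cheap: at most 24 frequencies share a dyadic scale,
  so the sum of |k|^-s over them converges for every s > 0, and the H^1 bound alone already makes
  the series of u converge absolutely. The bootstrap starts exactly at its threshold: 1 - 2s \<le>
  -s holds precisely for s \<ge> 1, so at the exponent of H^1 the nonlinearity decays no worse than
  u. Smoothness comes from the exponential kernel, never from the initial value; hence the decay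
  bounds live on intervals \<open>{a..b}\<close> with \<open>0 < a\<close>. The C^1 hypothesis
  enters mainly through a Lipschitz estimate uniform over all frequencies, which gives continuity in
  time and an H^1-type bound up to time 0.\<close>

lemma space_T3 [simp]: "space T3 = cbox 0 (\<chi> i. 1)"
  by (simp add: T3_def space_restrict_space)

lemma emeasure_T3_space: "emeasure T3 (cbox 0 (\<chi> i. 1)) = 1"
proof -
  have "prod (\<lambda>b. ((\<chi> i. 1)::real^3) \<bullet> b) Basis = 1"
    by (rule prod.neutral) (auto simp: Basis_vec_def inner_axis)
  moreover have "emeasure T3 (cbox 0 (\<chi> i. 1)) = emeasure lborel (cbox (0::real^3) (\<chi> i. 1))"
    unfolding T3_def by (rule emeasure_restrict_space) auto
  ultimately show ?thesis
    by (subst (asm) emeasure_lborel_cbox) (auto simp: Basis_vec_def inner_axis)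
qed

interpretation T3: finite_measure T3
  by (rule finite_measureI) (simp add: emeasure_T3_space)

lemma measure_T3_space [simp]: "measure T3 (cbox 0 (\<chi> i. 1)) = 1"
  by (simp add: measure_def emeasure_T3_space)

definition fexp :: "int^3 \<Rightarrow> real^3 \<Rightarrow> complex" where
  "fexp k x = exp (2 * pi * \<i> * complex_of_real (rvec k \<bullet> x))"

lemma rvec_add: "rvec (k + l) = rvec k + rvec l"
  and rvec_minus: "rvec (- k) = - rvec k"
  and rvec_0 [simp]: "rvec 0 = 0"
  by (simp_all add: rvec_def vec_eq_iff)

lemma fexp_add: "fexp (k + l) x = fexp k x * fexp l x"
  by (simp add: fexp_def rvec_add inner_add_left exp_add[symmetric] algebra_simps)

lemma fexp_0 [simp]: "fexp 0 x = 1"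
  by (simp add: fexp_def)

lemma fexp_eq_cis: "fexp k x = cis (2 * pi * (rvec k \<bullet> x))"
  by (simp add: fexp_def cis_conv_exp mult_ac)

lemma fexp_minus: "fexp (- k) x = cnj (fexp k x)"
  by (simp add: fexp_eq_cis rvec_minus cis_cnj)

lemma norm_fexp [simp]: "norm (fexp k x) = 1"
  by (simp add: fexp_eq_cis)

lemma continuous_fexp: "continuous_on S (fexp k)"
  unfolding fexp_def by (intro continuous_intros)

lemma measurable_T3I: "f \<in> borel_measurable borel \<Longrightarrow> f \<in> borel_measurable T3"
  unfolding T3_def by (rule measurable_restrict_space1) simp

lemma fexp_measurable [measurable]: "fexp k \<in> borel_measurable T3"
  by (intro measurable_T3I borel_measurable_continuous_onI continuous_fexp)

lemma rvec_inner_rvec: "rvec k \<bullet> rvec l = real_of_int (\<Sum>i\<in>UNIV. k $ i * l $ i)"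
  by (simp add: rvec_def inner_vec_def)

lemma fexp_periodic: "fexp k (x + rvec l) = fexp k x"
proof -
  have "cis (2 * pi * (rvec k \<bullet> rvec l)) = 1"
    unfolding rvec_inner_rvec by (metis Ints_of_int cis_multiple_2pi)
  then show ?thesis
    by (simp add: fexp_eq_cis inner_add_right distrib_left cis_mult[symmetric])
qed

lemma fcoef_fexp: "fcoef f k = (LINT x|T3. complex_of_real (f x) * fexp (- k) x)"
  by (simp add: fcoef_def fexp_def rvec_minus)

lemma integral_exp_unit_interval:
  fixes m :: int
  shows "(LBINT y. indicator {0..1} y *\<^sub>R exp (2 * pi * \<i> * complex_of_real (m * y))) = (if m = 0 then 1 else 0)"
proof (cases "m = 0")
  case False
  let ?F = "\<lambda>y::real. exp (2 * pi * \<i> * complex_of_real (m * y)) / (2 * pi * \<i> * m)"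
  have "(?F has_vector_derivative exp (2 * pi * \<i> * complex_of_real (m * x))) (at x within {0..1})" for x :: real
  proof -
    have "((\<lambda>z. exp (2 * pi * \<i> * (m * z)) / (2 * pi * \<i> * m)) has_field_derivative
        exp (2 * pi * \<i> * (m * complex_of_real x))) (at (complex_of_real x))"
      using False by (auto intro!: derivative_eq_intros)
    from has_vector_derivative_real_field[OF this]
    show ?thesis
      by (simp add: has_vector_derivative_at_within)
  qed
  then have "(LBINT y. indicator {0..1} y *\<^sub>R exp (2 * pi * \<i> * complex_of_real (m * y))) = ?F 1 - ?F 0"
    by (intro integral_FTC_atLeastAtMost) (auto intro!: continuous_intros)
  also have "exp (2 * pi * \<i> * complex_of_real (real_of_int m * 1)) = 1"
    using exp_integer_2pi[of "of_int m"] by (simp add: mult_ac)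
  finally show ?thesis using False by simp
qed simp

text \<open>Fubini: the indicator of the cube and the exponential are both products over the
  coordinates, so the integral factors, and any nonzero coordinate of \<open>k\<close> contributes a
  vanishing factor.\<close>

lemma integral_fexp: "(LINT x|T3. fexp k x) = (if k = 0 then 1 else 0)"
proof -
  define g where "g b y = indicator {0..1::real} y *\<^sub>R exp (2 * pi * \<i> * complex_of_real ((rvec k \<bullet> b) * y))" for b y
  interpret product_sigma_finite "\<lambda>_::real^3. lborel :: real measure" ..
  have int: "integrable lborel (g b)" for b
    unfolding g_def by (rule borel_integrable_compact) (auto intro!: continuous_intros)
  have meas: "(\<lambda>x. indicator (cbox 0 (\<chi> i. 1)) x *\<^sub>R fexp k x) \<in> borel_measurable borel"
    by (intro borel_measurable_scaleR borel_measurable_continuous_onI[OF continuous_fexp]) auto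
  have B: "\<exists>m::int. rvec k \<bullet> b = m" if "b \<in> Basis" for b
    using that by (auto simp: Basis_vec_def inner_axis rvec_def)
  have "(LINT x|T3. fexp k x) = (LINT x|lborel. indicator (cbox 0 (\<chi> i. 1)) x *\<^sub>R fexp k x)"
    unfolding T3_def by (subst integral_restrict_space) auto
  also have "\<dots> = integral\<^sup>L (Pi\<^sub>M Basis (\<lambda>_. lborel)) (\<lambda>f. indicator (cbox 0 (\<chi> i. 1)) (\<Sum>b\<in>Basis. f b *\<^sub>R b)
       *\<^sub>R fexp k (\<Sum>b\<in>Basis. f b *\<^sub>R b))"
    by (subst lborel_eq, subst integral_distr) (auto simp: meas)
  also have "\<dots> = integral\<^sup>L (Pi\<^sub>M Basis (\<lambda>_. lborel)) (\<lambda>f. \<Prod>b\<in>Basis. g b (f b))"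
  proof (rule Bochner_Integration.integral_cong[OF refl])
    fix f :: "real^3 \<Rightarrow> real"
    let ?x = "\<Sum>b\<in>Basis. f b *\<^sub>R b"
    have in1: "?x \<bullet> b = f b" if "b \<in> Basis" for b
      using that by simp
    have one: "((\<chi> i. 1)::real^3) \<bullet> b = 1" if "b \<in> Basis" for b
      using that by (auto simp: Basis_vec_def inner_axis)
    have "indicator (cbox 0 (\<chi> i. 1)) ?x = (\<Prod>b\<in>Basis. indicator {0..1::real} (f b) :: real)"
    proof (cases "\<forall>b\<in>Basis. f b \<in> {0..1}")
      case True
      then have "?x \<in> cbox 0 (\<chi> i. 1)" by (auto simp: mem_box in1 one)
      then show ?thesis using True by (simp add: indicator_def)
    next
      case False
      then have "?x \<notin> cbox 0 (\<chi> i. 1)" by (auto simp: mem_box in1 one)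
      moreover have "(\<Prod>b\<in>Basis. indicator {0..1::real} (f b) :: real) = 0"
        using False by (intro prod_zero) (auto simp: indicator_def)
      ultimately show ?thesis by simp
    qed
    moreover have "fexp k ?x = (\<Prod>b\<in>Basis. exp (2 * pi * \<i> * complex_of_real ((rvec k \<bullet> b) * f b)))"
      unfolding fexp_def
      by (subst exp_sum[symmetric]) (auto simp: inner_sum_right sum_distrib_left mult_ac intro!: arg_cong[where f=exp] sum.cong)
    ultimately show "indicator (cbox 0 (\<chi> i. 1)) ?x *\<^sub>R fexp k ?x = (\<Prod>b\<in>Basis. g b (f b))"
      by (simp add: g_def scaleR_conv_of_real prod.distrib)
  qed
  also have "\<dots> = (\<Prod>b\<in>Basis. LBINT y. g b y)"
    by (rule product_integral_prod) (auto simp: int)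
  also have "\<dots> = (\<Prod>b\<in>Basis. if rvec k \<bullet> b = 0 then 1 else 0)"
  proof (rule prod.cong[OF refl])
    fix b :: "real^3" assume "b \<in> Basis"
    then obtain m :: int where m: "rvec k \<bullet> b = m" using B by blast
    show "(LBINT y. g b y) = (if rvec k \<bullet> b = 0 then 1 else 0)"
      unfolding g_def m using integral_exp_unit_interval[of m] by simp
  qed
  also have "\<dots> = (if k = 0 then 1 else 0)"
  proof (cases "k = 0")
    case False
    then obtain i where "k $ i \<noteq> 0" by (auto simp: vec_eq_iff)
    then have "rvec k \<bullet> axis i 1 \<noteq> 0" "axis i 1 \<in> (Basis :: (real^3) set)"
      by (auto simp: rvec_def inner_axis)
    then show ?thesis using False by (auto intro!: prod_zero)
  qed simp
  finally show ?thesis .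
qed

section \<open>Absolutely convergent Fourier series\<close>

lemma infinite_UNIV_int3: "infinite (UNIV :: (int^3) set)"
proof -
  have "inj (\<lambda>m::int. axis 1 m :: int^3)"
    by (auto simp: inj_on_def axis_eq_axis)
  then show ?thesis
    by (metis finite_imageD finite_subset infinite_UNIV_int top_greatest)
qed

lemma ex_enumeration_int3: "\<exists>e :: nat \<Rightarrow> int^3. bij e"
  using bij_betw_from_nat_into[OF _ infinite_UNIV_int3] by auto

text \<open>Termwise integration is a statement about sequences, so the lattice is enumerated by a
  bijection; absolute convergence makes the unordered sum independent of the enumeration.\<close>

lemma integral_infsum:
  fixes g :: "int^3 \<Rightarrow> 'x \<Rightarrow> complex"
  assumes int: "\<And>k. integrable M (g k)"
    and sum: "(\<lambda>k. LINT x|M. norm (g k x)) summable_on UNIV"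
    and pw: "\<And>x. x \<in> space M \<Longrightarrow> (\<lambda>k. norm (g k x)) summable_on UNIV"
  shows "integrable M (\<lambda>x. \<Sum>\<^sub>\<infinity>k. g k x)"
    and "((\<lambda>k. LINT x|M. g k x) has_sum (LINT x|M. (\<Sum>\<^sub>\<infinity>k. g k x))) UNIV"
proof -
  obtain e :: "nat \<Rightarrow> int^3" where e: "bij e" using ex_enumeration_int3 by blast
  have pw': "summable (\<lambda>n. norm (g (e n) x))" if "x \<in> space M" for x
    using pw[OF that] summable_on_reindex_bij_betw[OF e, of "\<lambda>k. norm (g k x)"] summable_on_imp_summable by metis
  have eq: "(\<Sum>n. g (e n) x) = (\<Sum>\<^sub>\<infinity>k. g k x)" if "x \<in> space M" for x
  proof -
    have "(\<lambda>k. g k x) summable_on UNIV"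
      using pw[OF that] by (rule abs_summable_summable)
    then have "((\<lambda>n. g (e n) x) has_sum (\<Sum>\<^sub>\<infinity>k. g k x)) UNIV"
      by (subst has_sum_reindex_bij_betw[OF e]) (rule has_sum_infsum)
    then show ?thesis
      using sums_unique[OF has_sum_imp_sums] by metis
  qed
  have sum': "summable (\<lambda>n. LINT x|M. norm (g (e n) x))"
    using sum summable_on_reindex_bij_betw[OF e, of "\<lambda>k. LINT x|M. norm (g k x)"] summable_on_imp_summable by metis
  have ae: "AE x in M. summable (\<lambda>n. norm (g (e n) x))"
    using pw' by auto
  have 1: "integrable M (\<lambda>x. \<Sum>n. g (e n) x)"
    by (rule integrable_suminf[OF int ae sum'])
  have 2: "(\<lambda>n. LINT x|M. g (e n) x) sums (LINT x|M. (\<Sum>n. g (e n) x))"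
    by (rule sums_integral[OF int ae sum'])
  show "integrable M (\<lambda>x. \<Sum>\<^sub>\<infinity>k. g k x)"
    using 1 by (rule Bochner_Integration.integrable_cong[THEN iffD1, rotated -1]) (auto simp: eq)
  have "(LINT x|M. (\<Sum>n. g (e n) x)) = (LINT x|M. (\<Sum>\<^sub>\<infinity>k. g k x))"
    by (rule Bochner_Integration.integral_cong) (auto simp: eq)
  moreover have "summable (\<lambda>n. norm (LINT x|M. g (e n) x))"
    by (rule summable_comparison_test'[OF sum']) (auto intro: integral_norm_bound)
  ultimately have "((\<lambda>n. LINT x|M. g (e n) x) has_sum (LINT x|M. (\<Sum>\<^sub>\<infinity>k. g k x))) UNIV"
    using 2 by (metis norm_summable_imp_has_sum)
  then show "((\<lambda>k. LINT x|M. g k x) has_sum (LINT x|M. (\<Sum>\<^sub>\<infinity>k. g k x))) UNIV"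
    by (subst (asm) has_sum_reindex_bij_betw[OF e])
qed

definition abs_coef :: "(int^3 \<Rightarrow> complex) \<Rightarrow> bool" where
  "abs_coef c \<longleftrightarrow> (\<lambda>k. cmod (c k)) summable_on UNIV"

definition fser :: "(int^3 \<Rightarrow> complex) \<Rightarrow> real^3 \<Rightarrow> complex" where
  "fser c x = (\<Sum>\<^sub>\<infinity>k. c k * fexp k x)"

lemma integrable_fexp_mult:
  "integrable T3 G \<Longrightarrow> integrable T3 (\<lambda>x. fexp k x * G x)" for G :: "_ \<Rightarrow> complex"
  by (rule Bochner_Integration.integrable_bound[where f = G]) (auto simp: norm_mult)

text \<open>The cofactor \<open>G\<close> is only integrable, not bounded: this covers products of
  the velocity with a gradient of which no more than square integrability is known yet.\<close>

lemma fser_mult_integrable: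
  fixes G :: "_ \<Rightarrow> complex"
  assumes c: "abs_coef c" and G: "integrable T3 G"
  shows "integrable T3 (\<lambda>x. fser c x * G x)"
    and has_sum_integral_fser: "((\<lambda>k. c k * (LINT x|T3. fexp k x * G x)) has_sum (LINT x|T3. fser c x * G x)) UNIV"
proof -
  let ?g = "\<lambda>k x. c k * (fexp k x * G x)"
  have int: "integrable T3 (?g k)" for k
    using integrable_fexp_mult[OF G] by simp
  have "(LINT x|T3. norm (?g k x)) = cmod (c k) * (LINT x|T3. norm (G x))" for k
    by (simp add: norm_mult)
  then have 1: "(\<lambda>k. LINT x|T3. norm (?g k x)) summable_on UNIV"
    using c by (auto simp: abs_coef_def intro: summable_on_cmult_left)
  have 2: "(\<lambda>k. norm (?g k x)) summable_on UNIV" for x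
    using c by (auto simp: abs_coef_def norm_mult intro: summable_on_cmult_left)
  have eq: "(\<Sum>\<^sub>\<infinity>k. ?g k x) = fser c x * G x" for x
    unfolding fser_def by (subst infsum_cmult_left'[symmetric]) (simp add: mult_ac)
  show "integrable T3 (\<lambda>x. fser c x * G x)"
    using integral_infsum(1)[OF int 1 2] by (simp add: eq)
  show "((\<lambda>k. c k * (LINT x|T3. fexp k x * G x)) has_sum (LINT x|T3. fser c x * G x)) UNIV"
    using integral_infsum(2)[OF int 1 2] by (simp add: eq)
qed

text \<open>The bound is required everywhere rather than almost everywhere, so that sums and
  products carry no exceptional sets; absolutely convergent series satisfy it.\<close>

definition bounded_T3 :: "(real^3 \<Rightarrow> 'a::euclidean_space) \<Rightarrow> bool" where
  "bounded_T3 f \<longleftrightarrow> f \<in> borel_measurable T3 \<and> (\<exists>B. \<forall>x. norm (f x) \<le> B)"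

lemma bounded_T3_integrable: "bounded_T3 f \<Longrightarrow> integrable T3 f"
  unfolding bounded_T3_def by (auto intro: T3.integrable_const_bound)

lemma bounded_T3_mult: "bounded_T3 f \<Longrightarrow> bounded_T3 g \<Longrightarrow> bounded_T3 (\<lambda>x. f x * g x)"
  for f g :: "_ \<Rightarrow> 'a::{euclidean_space, real_normed_algebra}"
proof -
  assume "bounded_T3 f" "bounded_T3 g"
  then obtain B C where B: "\<forall>x. norm (f x) \<le> B" "\<forall>x. norm (g x) \<le> C"
    and [measurable]: "f \<in> borel_measurable T3" "g \<in> borel_measurable T3"
    by (auto simp: bounded_T3_def)
  have "norm (f x * g x) \<le> B * C" for x
    by (rule order_trans[OF norm_mult_ineq]) (use B norm_ge_zero order_trans in \<open>blast intro: mult_mono\<close>)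
  then show ?thesis
    by (auto simp: bounded_T3_def)
qed

lemma bounded_T3_add: "bounded_T3 f \<Longrightarrow> bounded_T3 g \<Longrightarrow> bounded_T3 (\<lambda>x. f x + g x)"
proof -
  assume "bounded_T3 f" "bounded_T3 g"
  then obtain B C where B: "\<forall>x. norm (f x) \<le> B" "\<forall>x. norm (g x) \<le> C"
    and [measurable]: "f \<in> borel_measurable T3" "g \<in> borel_measurable T3"
    by (auto simp: bounded_T3_def)
  have "norm (f x + g x) \<le> B + C" for x
    by (rule norm_triangle_le) (use B add_mono in blast)
  then show ?thesis
    by (auto simp: bounded_T3_def)
qed

lemma bounded_T3_const: "bounded_T3 (\<lambda>x. c)"
  by (auto simp: bounded_T3_def)

lemma bounded_T3_fexp: "bounded_T3 (fexp k)"
  by (auto simp: bounded_T3_def intro: exI[of _ 1])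

lemma bounded_T3_fser: "abs_coef c \<Longrightarrow> bounded_T3 (fser c)"
proof -
  assume c: "abs_coef c"
  have "fser c \<in> borel_measurable T3"
    using fser_mult_integrable(1)[OF c, of "\<lambda>_. 1"] by (auto dest: borel_measurable_integrable)
  moreover have "norm (fser c x) \<le> (\<Sum>\<^sub>\<infinity>k. cmod (c k))" for x
    using norm_infsum_bound[of "\<lambda>k. c k * fexp k x" UNIV] c by (simp add: fser_def norm_mult abs_coef_def)
  ultimately show ?thesis by (auto simp: bounded_T3_def)
qed

lemmas bounded_T3_intros = bounded_T3_mult bounded_T3_add bounded_T3_const bounded_T3_fexp bounded_T3_fser

lemma integral_fser_fexp: "abs_coef c \<Longrightarrow> (LINT x|T3. fser c x * fexp (- k) x) = c k"
proof -
  assume c: "abs_coef c"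
  have "((\<lambda>l. c l * (LINT x|T3. fexp l x * fexp (- k) x)) has_sum (LINT x|T3. fser c x * fexp (- k) x)) UNIV"
    by (rule has_sum_integral_fser[OF c bounded_T3_integrable[OF bounded_T3_fexp]])
  moreover have "(LINT x|T3. fexp l x * fexp (- k) x) = (if l = k then 1 else 0)" for l
    by (subst fexp_add[symmetric], subst integral_fexp) simp
  moreover have "((\<lambda>l. c l * (if l = k then 1 else 0)) has_sum c k) UNIV"
    by (rule has_sum_finite_neutralI[of "{k}"]) auto
  ultimately show ?thesis
    using has_sum_unique by fastforce
qed

section \<open>Leibniz rule and integration by parts for products of three series\<close>

definition dsym :: "3 \<Rightarrow> int^3 \<Rightarrow> complex" where
  "dsym j k = 2 * pi * \<i> * of_int (k $ j)"

lemma dsym_add: "dsym j (k + l) = dsym j k + dsym j l"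
  by (simp add: dsym_def algebra_simps)

text \<open>Both integrals are absolutely convergent sums over \<open>k\<close> with the same
  weights \<open>c k\<close>, so an identity valid for each single exponential passes to the series.
  \<open>A\<close> stands for the product of the other factors and \<open>B\<close> for its
  derivative.\<close>

lemma integral_fser_derivation_step:
  assumes c: "abs_coef c" and dc: "abs_coef (\<lambda>k. dsym j k * c k)"
    and A: "bounded_T3 A" and B: "bounded_T3 B"
    and zero: "\<And>k. (LINT x|T3. dsym j k * fexp k x * A x + fexp k x * B x) = 0"
  shows "(LINT x|T3. fser (\<lambda>k. dsym j k * c k) x * A x + fser c x * B x) = 0"
proof -
  note iA = bounded_T3_integrable[OF A] and iB = bounded_T3_integrable[OF B]
  have "dsym j k * c k * (LINT x|T3. fexp k x * A x) + c k * (LINT x|T3. fexp k x * B x)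
     = c k * (LINT x|T3. dsym j k * fexp k x * A x + fexp k x * B x)" for k
    using integrable_fexp_mult[OF iA, of k] integrable_fexp_mult[OF iB, of k]
    by (simp add: mult.assoc distrib_left)
  then have "((\<lambda>k::int^3. 0) has_sum (LINT x|T3. fser (\<lambda>k. dsym j k * c k) x * A x) + (LINT x|T3. fser c x * B x)) UNIV"
    using has_sum_add[OF has_sum_integral_fser[OF dc iA] has_sum_integral_fser[OF c iB]] zero by simp
  then have "(LINT x|T3. fser (\<lambda>k. dsym j k * c k) x * A x) + (LINT x|T3. fser c x * B x) = 0"
    by (rule has_sum_unique[OF _ has_sum_0_simp])
  then show ?thesis
    using fser_mult_integrable(1)[OF dc iA] fser_mult_integrable(1)[OF c iB] by simp
qed

text \<open>The factors are exchanged for exponentials one at a time, the others staying bounded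
  functions, so only a single series is ever expanded and no multiple sum has to be
  rearranged.\<close>

lemma integral_derivation_fser3:
  fixes j :: 3 and c1 c2 c3 :: "int^3 \<Rightarrow> complex"
  defines "F1 \<equiv> fser c1" and "F2 \<equiv> fser c2" and "F3 \<equiv> fser c3"
    and "D1 \<equiv> fser (\<lambda>k. dsym j k * c1 k)" and "D2 \<equiv> fser (\<lambda>k. dsym j k * c2 k)"
    and "D3 \<equiv> fser (\<lambda>k. dsym j k * c3 k)"
  assumes c: "abs_coef c1" "abs_coef c2" "abs_coef c3"
    and d: "abs_coef (\<lambda>k. dsym j k * c1 k)" "abs_coef (\<lambda>k. dsym j k * c2 k)" "abs_coef (\<lambda>k. dsym j k * c3 k)"
  shows "(LINT x|T3. D1 x * F2 x * F3 x + F1 x * D2 x * F3 x + F1 x * F2 x * D3 x) = 0"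
proof -
  note [intro!] = bounded_T3_intros
  have zero: "(LINT x|T3. dsym j k * fexp k x) = 0" for k
    by (simp add: integral_fexp dsym_def)
  have b: "bounded_T3 F1" "bounded_T3 F2" "bounded_T3 F3" "bounded_T3 D1" "bounded_T3 D2" "bounded_T3 D3"
    using c d by (auto simp: F1_def F2_def F3_def D1_def D2_def D3_def)
  have "(LINT x|T3. D1 x * (F2 x * F3 x) + F1 x * (D2 x * F3 x + F2 x * D3 x)) = 0"
    unfolding F1_def D1_def
  proof (rule integral_fser_derivation_step[OF c(1) d(1)])
    fix k1
    have "(LINT x|T3. D2 x * (fexp k1 x * F3 x) + F2 x * (dsym j k1 * (fexp k1 x * F3 x) + fexp k1 x * D3 x)) = 0"
      unfolding F2_def D2_def
    proof (rule integral_fser_derivation_step[OF c(2) d(2)])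
      fix k2
      have "(LINT x|T3. D3 x * (fexp k1 x * fexp k2 x) + F3 x * ((dsym j k1 + dsym j k2) * (fexp k1 x * fexp k2 x))) = 0"
        unfolding F3_def D3_def
      proof (rule integral_fser_derivation_step[OF c(3) d(3)])
        fix k3
        have "(LINT x|T3. dsym j k3 * fexp k3 x * (fexp k1 x * fexp k2 x) +
                fexp k3 x * ((dsym j k1 + dsym j k2) * (fexp k1 x * fexp k2 x)))
            = (LINT x|T3. dsym j (k1 + k2 + k3) * fexp (k1 + k2 + k3) x)"
          by (rule Bochner_Integration.integral_cong[OF refl]) (simp add: dsym_add fexp_add algebra_simps)
        also have "\<dots> = 0"
          by (rule zero)
        finally show "(LINT x|T3. dsym j k3 * fexp k3 x * (fexp k1 x * fexp k2 x) +
                fexp k3 x * ((dsym j k1 + dsym j k2) * (fexp k1 x * fexp k2 x))) = 0" .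
      qed (use b in auto)
      then show "(LINT x|T3. dsym j k2 * fexp k2 x * (fexp k1 x * F3 x) +
          fexp k2 x * (dsym j k1 * (fexp k1 x * F3 x) + fexp k1 x * D3 x)) = 0"
        by (simp add: algebra_simps)
    qed (use b in auto)
    then show "(LINT x|T3. dsym j k1 * fexp k1 x * (F2 x * F3 x) + fexp k1 x * (D2 x * F3 x + F2 x * D3 x)) = 0"
      by (simp add: algebra_simps)
  qed (use b in auto)
  then show ?thesis
    by (simp add: algebra_simps)
qed

section \<open>Uniqueness of Fourier coefficients\<close>

text \<open>The embedding of the torus as a product of unit circles; it turns periodic functions
  into functions on a compact set, where Stone--Weierstrass applies.\<close>

definition circ :: "real^3 \<Rightarrow> complex^3" where
  "circ x = (\<chi> i. cis (2 * pi * x $ i))"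

lemma continuous_circ: "continuous_on S circ"
  unfolding circ_def by (intro continuous_intros)

text \<open>The hypotheses are deliberately asymmetric: opposite faces of the closed cube have the
  same image, but an interior point shares its image with no other point of the cube.\<close>

lemma circ_inj:
  assumes x: "x \<in> box 0 (\<chi> i. 1)" and y: "y \<in> cbox 0 (\<chi> i. 1)" and eq: "circ x = circ y"
  shows "x = y"
proof -
  have "x $ i = y $ i" for i
  proof -
    have b: "0 < x $ i" "x $ i < 1" "0 \<le> y $ i" "y $ i \<le> 1"
      using x y by (auto simp: mem_box_cart)
    have "cis (2 * pi * x $ i) = cis (2 * pi * y $ i)"
      using eq by (simp add: circ_def vec_eq_iff)
    then obtain n :: int where "2 * pi * x $ i = 2 * pi * y $ i + 2 * pi * n"
      using sin_cos_eq_iff[of "2 * pi * x $ i" "2 * pi * y $ i"] by (auto simp: complex_eq_iff)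
    then have n: "x $ i = y $ i + n"
      by (metis distrib_left mult_cancel_left pi_neq_zero mult_eq_0_iff zero_neq_numeral)
    then have "-1 < real_of_int n" "real_of_int n < 1" using b by linarith+
    then have "n = 0" by linarith
    then show ?thesis using n by simp
  qed
  then show ?thesis by (simp add: vec_eq_iff)
qed

context
  fixes f :: "real^3 \<Rightarrow> real"
  assumes int: "integrable T3 f" and zero: "\<And>k. fcoef f k = 0"
begin

lemma borel_f [measurable]: "f \<in> borel_measurable T3"
  using int by auto

text \<open>
  The multipliers preserving the functions \<open>G\<close> with \<open>f G\<close> orthogonal to all exponentials form an algebra
  containing the exponentials, hence all polynomials in \<open>circ\<close>; Stone--Weierstrass does the rest.
\<close>

definition ann :: "(real^3 \<Rightarrow> complex) \<Rightarrow> bool" where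
  "ann G \<longleftrightarrow> bounded_T3 G \<and> (\<forall>k. (LINT x|T3. complex_of_real (f x) * G x * fexp k x) = 0)"

lemma ann_integrable:
  assumes "bounded_T3 G"
  shows "integrable T3 (\<lambda>x. complex_of_real (f x) * G x)"
proof -
  from assms obtain B where B: "\<And>x. norm (G x) \<le> B" and [measurable]: "G \<in> borel_measurable T3"
    by (auto simp: bounded_T3_def)
  show ?thesis
  proof (rule Bochner_Integration.integrable_bound)
    show "integrable T3 (\<lambda>x. B * f x)" using int by simp
    have "0 \<le> B" using B[of 0] norm_ge_zero order_trans by blast
    then show "AE x in T3. norm (complex_of_real (f x) * G x) \<le> norm (B * f x)"
      using mult_left_mono[OF B abs_ge_zero] by (intro AE_I2) (simp add: norm_mult abs_mult mult.commute[of B])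
  qed simp
qed

definition ann_mult :: "(real^3 \<Rightarrow> complex) \<Rightarrow> bool" where
  "ann_mult h \<longleftrightarrow> bounded_T3 h \<and> (\<forall>G. ann G \<longrightarrow> ann (\<lambda>x. G x * h x))"

lemma ann_mult_fexp: "ann_mult (fexp l)"
proof -
  have "(\<lambda>x. complex_of_real (f x) * (G x * fexp l x) * fexp k x) = (\<lambda>x. complex_of_real (f x) * G x * fexp (l + k) x)" for G k
    by (simp add: fexp_add mult_ac)
  then show ?thesis
    by (auto simp: ann_mult_def ann_def bounded_T3_fexp bounded_T3_mult)
qed

lemma ann_mult_const: "ann_mult (\<lambda>x. c)"
proof -
  have "(\<lambda>x. complex_of_real (f x) * (G x * c) * fexp k x) = (\<lambda>x. c * (complex_of_real (f x) * G x * fexp k x))" for G k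
    by (simp add: mult_ac)
  then show ?thesis
    by (auto simp: ann_mult_def ann_def bounded_T3_const bounded_T3_mult)
qed

lemma ann_mult_mult: "ann_mult g \<Longrightarrow> ann_mult h \<Longrightarrow> ann_mult (\<lambda>x. g x * h x)"
  unfolding ann_mult_def by (auto simp: bounded_T3_mult mult.assoc[symmetric])

lemma ann_mult_add:
  assumes "ann_mult g" "ann_mult h"
  shows "ann_mult (\<lambda>x. g x + h x)"
  unfolding ann_mult_def
proof (intro conjI allI impI)
  show "bounded_T3 (\<lambda>x. g x + h x)"
    using assms by (auto simp: ann_mult_def bounded_T3_add)
  fix G assume G: "ann G"
  then have 1: "ann (\<lambda>x. G x * g x)" "ann (\<lambda>x. G x * h x)"
    using assms by (auto simp: ann_mult_def)
  have "integrable T3 (\<lambda>x. complex_of_real (f x) * ((G x * g x) * fexp k x))"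
    "integrable T3 (\<lambda>x. complex_of_real (f x) * ((G x * h x) * fexp k x))" for k
    using 1 by (auto intro!: ann_integrable bounded_T3_mult bounded_T3_fexp simp: ann_def)
  then have "(LINT x|T3. complex_of_real (f x) * (G x * g x + G x * h x) * fexp k x) = 0" for k
    using 1 by (simp add: ann_def algebra_simps)
  then show "ann (\<lambda>x. G x * (g x + h x))"
    using 1 bounded_T3_add[of "\<lambda>x. G x * g x" "\<lambda>x. G x * h x"] by (simp add: ann_def distrib_left)
qed

lemma ann_mult_sum: "finite S \<Longrightarrow> (\<And>i. i \<in> S \<Longrightarrow> ann_mult (g i)) \<Longrightarrow> ann_mult (\<lambda>x. \<Sum>i\<in>S. g i x)"
proof (induction S rule: finite_induct)
  case empty then show ?case using ann_mult_const[of 0] by simp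
next
  case (insert i S) then show ?case using ann_mult_add[of "g i" "\<lambda>x. \<Sum>i\<in>S. g i x"] by simp
qed

text \<open>Polynomials are generated by real-linear functionals, hence by the real coordinates of
  \<open>circ\<close>; these are cosines and sines, combinations of the exponentials at plus and
  minus a unit vector.\<close>

lemma ann_mult_real_polynomial:
  "real_polynomial_function p \<Longrightarrow> ann_mult (\<lambda>x. complex_of_real (p (circ x)))"
proof (induction rule: real_polynomial_function.induct)
  case (linear L)
  have ax: "fexp (axis i 1) x = cis (2 * pi * x $ i)" for i x
  proof -
    have "rvec (axis i 1) = axis i 1" by (simp add: rvec_def axis_def vec_eq_iff)
    then show ?thesis by (simp add: fexp_eq_cis inner_axis')
  qed
  have "ann_mult (\<lambda>x. complex_of_real (cos (2 * pi * x $ i)))" for i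
  proof -
    have "ann_mult (\<lambda>x. 1/2 * (fexp (axis i 1) x + fexp (- axis i 1) x))"
      by (intro ann_mult_mult ann_mult_const ann_mult_add ann_mult_fexp)
    moreover have "1/2 * (fexp (axis i 1) x + fexp (- axis i 1) x) = complex_of_real (cos (2 * pi * x $ i))" for x
      by (simp add: fexp_minus ax complex_eq_iff)
    ultimately show ?thesis by simp
  qed
  moreover have "ann_mult (\<lambda>x. complex_of_real (sin (2 * pi * x $ i)))" for i
  proof -
    have "ann_mult (\<lambda>x. (- \<i>/2) * (fexp (axis i 1) x + (-1) * fexp (- axis i 1) x))"
      by (intro ann_mult_mult ann_mult_const ann_mult_add ann_mult_fexp)
    moreover have "(- \<i>/2) * (fexp (axis i 1) x + (-1) * fexp (- axis i 1) x) = complex_of_real (sin (2 * pi * x $ i))" for x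
      by (simp add: fexp_minus ax complex_eq_iff)
    ultimately show ?thesis by simp
  qed
  ultimately have b: "ann_mult (\<lambda>x. complex_of_real (circ x \<bullet> b))" if "b \<in> Basis" for b
    using that by (auto simp: Basis_vec_def inner_axis circ_def Basis_complex_def)
  interpret L: bounded_linear L by fact
  have "complex_of_real (L (circ x)) = (\<Sum>b\<in>Basis. complex_of_real (circ x \<bullet> b) * complex_of_real (L b))" for x
  proof -
    have "L (circ x) = L (\<Sum>b\<in>Basis. (circ x \<bullet> b) *\<^sub>R b)" by (simp add: euclidean_representation)
    then show ?thesis by (simp add: L.sum L.scaleR)
  qed
  moreover have "ann_mult (\<lambda>x. \<Sum>b\<in>Basis. complex_of_real (circ x \<bullet> b) * complex_of_real (L b))"
    by (intro ann_mult_sum ann_mult_mult ann_mult_const b) auto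
  ultimately show ?case by simp
next
  case (add g h)
  then show ?case using ann_mult_add by simp
next
  case (mult g h)
  then show ?case using ann_mult_mult by simp
qed (rule ann_mult_const)

lemma integral_polynomial_circ:
  assumes "real_polynomial_function p"
  shows "integrable T3 (\<lambda>x. f x * p (circ x))" "(LINT x|T3. f x * p (circ x)) = 0"
proof -
  have "ann (\<lambda>x. 1)"
    using zero[unfolded fcoef_fexp, of "- k" for k] by (simp add: ann_def bounded_T3_const)
  then have a: "ann (\<lambda>x. complex_of_real (p (circ x)))"
    using ann_mult_real_polynomial[OF assms] by (force simp: ann_mult_def)
  then have "(LINT x|T3. complex_of_real (f x * p (circ x))) = 0"
    using spec[of _ 0] by (auto simp: ann_def dest: spec[of _ 0])
  then show "(LINT x|T3. f x * p (circ x)) = 0"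
    by (simp only: integral_complex_of_real of_real_eq_0_iff)
  have "integrable T3 (\<lambda>x. complex_of_real (f x * p (circ x)))"
    using ann_integrable[of "\<lambda>x. complex_of_real (p (circ x))"] a by (simp add: ann_def)
  then show "integrable T3 (\<lambda>x. f x * p (circ x))"
    by (simp only: complex_of_real_integrable_eq)
qed

text \<open>Polynomial approximation is uniform on the compact image of the cube, so the error in
  the integral is at most \<open>e\<close> times the L^1 norm of \<open>f\<close>.\<close>

lemma integral_continuous_circ:
  assumes phi: "continuous_on UNIV \<phi>"
  shows "(LINT x|T3. f x * \<phi> (circ x)) = 0"
proof -
  let ?K = "circ ` cbox 0 (\<chi> i. 1)"
  have K: "compact ?K" by (intro compact_continuous_image continuous_circ compact_cbox)
  have [measurable]: "(\<lambda>x. \<phi> (circ x)) \<in> borel_measurable T3"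
    by (intro measurable_T3I borel_measurable_continuous_onI continuous_on_compose2[OF phi continuous_circ]) auto
  have bd: "\<bar>LINT x|T3. f x * \<phi> (circ x)\<bar> \<le> e * (LINT x|T3. \<bar>f x\<bar>)" if e: "e > 0" for e
  proof -
    obtain p where p: "real_polynomial_function p" "\<And>z. z \<in> ?K \<Longrightarrow> \<bar>\<phi> z - p z\<bar> < e"
      using Stone_Weierstrass_real_polynomial_function[OF K continuous_on_subset[OF phi subset_UNIV] e] by auto
    note ip = integral_polynomial_circ[OF p(1)]
    have "bounded (\<phi> ` ?K)"
      by (intro compact_imp_bounded compact_continuous_image continuous_on_subset[OF phi] K) auto
    then obtain B where B: "\<And>x. x \<in> cbox 0 (\<chi> i. 1) \<Longrightarrow> \<bar>\<phi> (circ x)\<bar> \<le> B"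
      unfolding bounded_iff by auto
    have iphi: "integrable T3 (\<lambda>x. f x * \<phi> (circ x))"
    proof (rule Bochner_Integration.integrable_bound)
      show "integrable T3 (\<lambda>x. B * f x)" using int by simp
      show "AE x in T3. norm (f x * \<phi> (circ x)) \<le> norm (B * f x)"
      proof (rule AE_I2)
        fix x assume "x \<in> space T3"
        then have "\<bar>\<phi> (circ x)\<bar> \<le> \<bar>B\<bar>" using B[of x] by auto
        then show "norm (f x * \<phi> (circ x)) \<le> norm (B * f x)"
          using mult_left_mono[OF _ abs_ge_zero[of "f x"]] by (simp add: abs_mult mult.commute[of B] mult.commute[of "\<bar>B\<bar>"])
      qed
    qed simp
    have "\<bar>LINT x|T3. f x * \<phi> (circ x)\<bar> = \<bar>LINT x|T3. f x * \<phi> (circ x) - f x * p (circ x)\<bar>"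
      using ip iphi by simp
    also have "\<dots> \<le> (LINT x|T3. e * \<bar>f x\<bar>)"
    proof (rule integral_abs_bound_integral)
      fix x assume "x \<in> space T3"
      then have "\<bar>\<phi> (circ x) - p (circ x)\<bar> \<le> e" using p(2)[of "circ x"] by auto
      then have "\<bar>f x\<bar> * \<bar>\<phi> (circ x) - p (circ x)\<bar> \<le> \<bar>f x\<bar> * e" by (simp add: mult_left_mono)
      then show "\<bar>f x * \<phi> (circ x) - f x * p (circ x)\<bar> \<le> e * \<bar>f x\<bar>"
        by (simp add: abs_mult right_diff_distrib[symmetric] mult.commute)
    qed (use ip iphi int in auto)
    finally show ?thesis by simp
  qed
  show ?thesis
  proof (rule ccontr)
    assume n: "(LINT x|T3. f x * \<phi> (circ x)) \<noteq> 0"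
    let ?I = "LINT x|T3. \<bar>f x\<bar>"
    have I: "?I \<ge> 0" by simp
    \<comment> \<open>Any accuracy below the modulus of the integral divided by the L^1 norm
      contradicts \<open>bd\<close>; the added 1 keeps the denominator positive.\<close>
    let ?e = "\<bar>LINT x|T3. f x * \<phi> (circ x)\<bar> / (2 * (?I + 1))"
    have "0 < 2 * (y + 1)" if "0 \<le> y" for y :: real using that by simp
    from this[OF I] have "?e > 0" using n by (intro divide_pos_pos) auto
    from bd[OF this] have "\<bar>LINT x|T3. f x * \<phi> (circ x)\<bar> \<le> \<bar>LINT x|T3. f x * \<phi> (circ x)\<bar> * (?I / (2 * (?I + 1)))"
      by simp
    also have "\<dots> < \<bar>LINT x|T3. f x * \<phi> (circ x)\<bar> * 1"
    proof (rule mult_strict_left_mono)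
      have "y / (2 * (y + 1)) < 1" if "0 \<le> y" for y :: real using that by (simp add: divide_simps)
      from this[OF I] show "?I / (2 * (?I + 1)) < 1" .
    qed (use n in simp)
    finally show False by simp
  qed
qed

text \<open>
  An open subset \<open>V\<close> of the open unit cube is cut out by \<open>circ x \<notin> circ ` (cbox 0 1 - V)\<close>, because \<open>circ\<close>
  identifies boundary points only; its indicator is thus a limit of continuous functions of \<open>circ\<close>.
\<close>

lemma integral_open_subset_zero:
  assumes V: "open V" "V \<subseteq> box 0 (\<chi> i. 1)"
  shows "(LINT x|T3. f x * indicator V x) = 0"
proof -
  let ?C = "circ ` (cbox 0 (\<chi> i. 1) - V)"
  have "compact ?C"
    using V by (intro compact_continuous_image continuous_circ compact_diff) auto
  then have C: "closed ?C" by (rule compact_imp_closed)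
  \<comment> \<open>The corner 0 lies outside the open cube. Nonemptiness matters because
    \<open>infdist\<close> to the empty set is 0 by convention.\<close>
  have "0 \<in> cbox 0 (\<chi> i. 1) - V" using V by (auto simp: mem_box_cart subset_iff)
  then have ne: "?C \<noteq> {}" by blast
  have mem: "circ x \<in> ?C \<longleftrightarrow> x \<notin> V" if "x \<in> cbox 0 (\<chi> i. 1)" for x
    using that circ_inj V by blast
  let ?\<phi> = "\<lambda>n z. min 1 (real n * infdist z ?C)"
  have [measurable]: "V \<in> sets borel" using V by auto
  have cont: "continuous_on UNIV (?\<phi> n)" for n
    by (intro continuous_intros)
  have lim: "(\<lambda>n. LINT x|T3. f x * ?\<phi> n (circ x)) \<longlonglongrightarrow> (LINT x|T3. f x * indicator V x)"
  proof (rule integral_dominated_convergence[where w = "\<lambda>x. \<bar>f x\<bar>"])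
    show "(\<lambda>x. f x * indicator V x) \<in> borel_measurable T3"
      by (intro borel_measurable_times borel_f measurable_T3I) simp
    show "(\<lambda>x. f x * ?\<phi> n (circ x)) \<in> borel_measurable T3" for n
      by (intro borel_measurable_times borel_f measurable_T3I borel_measurable_continuous_onI
          continuous_on_compose2[OF cont continuous_circ]) auto
    show "integrable T3 (\<lambda>x. \<bar>f x\<bar>)" using int by simp
    show "AE x in T3. norm (f x * ?\<phi> n (circ x)) \<le> \<bar>f x\<bar>" for n
      by (intro AE_I2) (simp add: abs_mult mult_left_le infdist_nonneg)
    show "AE x in T3. (\<lambda>n. f x * ?\<phi> n (circ x)) \<longlonglongrightarrow> f x * indicator V x"
    proof (intro AE_I2 tendsto_mult tendsto_const)
      fix x assume x: "x \<in> space T3"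
      show "(\<lambda>n. ?\<phi> n (circ x)) \<longlonglongrightarrow> indicator V x"
      proof (cases "x \<in> V")
        case True
        then have "infdist (circ x) ?C > 0"
          using mem[of x] x in_closed_iff_infdist_zero[OF C ne, of "circ x"] infdist_nonneg[of "circ x" ?C] by auto
        then obtain N where N: "1 < real N * infdist (circ x) ?C"
          using reals_Archimedean3 by blast
        have "?\<phi> n (circ x) = 1" if "n \<ge> N" for n
        proof -
          have "real N * infdist (circ x) ?C \<le> real n * infdist (circ x) ?C"
            using that by (intro mult_right_mono infdist_nonneg) auto
          then show ?thesis using N by simp
        qed
        then show ?thesis using True by (auto intro!: tendsto_eventually eventually_sequentiallyI)
      next
        case False
        then have "infdist (circ x) ?C = 0" using mem[of x] x by simp
        then show ?thesis using False by simp
      qed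
    qed
  qed
  have "(\<lambda>n. LINT x|T3. f x * ?\<phi> n (circ x)) = (\<lambda>n. 0)"
    using integral_continuous_circ[OF cont] by simp
  with lim show ?thesis
    using LIMSEQ_unique tendsto_const by metis
qed

text \<open>Open sets form an intersection-stable generator of the Borel sets, so vanishing
  integrals over them force vanishing integrals over all Borel sets, and such a density is zero. The
  faces of the cube are a null set.\<close>

lemma AE_zero_if_fcoef_zero: "AE x in T3. f x = 0"
proof -
  let ?b = "box 0 (\<chi> i. 1) :: (real^3) set"
  \<comment> \<open>Cutting off to the open cube moves the question to Lebesgue measure on the whole
    space, where all open sets are available as test sets.\<close>
  define g where "g x = indicator ?b x * f x" for x
  have sub: "?b \<subseteq> cbox 0 (\<chi> i. 1)" by (rule box_subset_cbox)
  have eqg: "g = (\<lambda>x. indicator (cbox 0 (\<chi> i. 1)) x *\<^sub>R (indicator ?b x * f x))"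
    using sub by (auto simp: g_def indicator_def fun_eq_iff)
  have "?b \<in> sets T3"
    using sub by (auto simp: T3_def sets_restrict_space intro!: image_eqI[of _ _ ?b])
  then have "integrable T3 (\<lambda>x. indicator ?b x * f x)"
    using integrable_mult_indicator[OF _ int] by simp
  then have ig: "integrable lborel g"
    unfolding T3_def by (subst (asm) integrable_restrict_space) (auto simp: eqg)
  have open0: "(LINT x:V|lborel. g x) = 0" if "open V" for V
  proof -
    have "(LINT x:V|lborel. g x) = (LINT x|lborel. indicator (cbox 0 (\<chi> i. 1)) x *\<^sub>R (f x * indicator (V \<inter> ?b) x))"
      unfolding set_lebesgue_integral_def
      by (rule Bochner_Integration.integral_cong) (use sub in \<open>auto simp: g_def indicator_def\<close>)
    also have "\<dots> = (LINT x|T3. f x * indicator (V \<inter> ?b) x)"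
      unfolding T3_def by (subst integral_restrict_space) auto
    also have "\<dots> = 0" using that by (intro integral_open_subset_zero) auto
    finally show ?thesis .
  qed
  have sint: "set_integrable lborel A g" if "A \<in> sets borel" for A
    unfolding set_integrable_def using ig that by (intro integrable_mult_indicator) auto
  have all0: "(LINT x:A|lborel. g x) = 0" if "A \<in> sets borel" for A
  proof -
    have "A \<in> sigma_sets UNIV (Collect open)" using that by (simp add: borel_def)
    have IS: "Int_stable (Collect open :: (real^3) set set)" and sub: "Collect open \<subseteq> Pow (UNIV :: (real^3) set)"
      by (auto simp: Int_stable_def)
    from IS sub \<open>A \<in> sigma_sets UNIV (Collect open)\<close> show ?thesis
    proof (induction rule: sigma_sets_induct_disjoint)
      case (compl A)
      then have A: "A \<in> sets borel" by (simp add: borel_def)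
      have "(LINT x:UNIV|lborel. g x) = (LINT x:A \<union> (UNIV - A)|lborel. g x)" by simp
      also have "\<dots> = (LINT x:A|lborel. g x) + (LINT x:UNIV - A|lborel. g x)"
        using A by (intro set_integral_Un sint) auto
      finally show ?case using compl open0[of UNIV] by simp
    next
      case (union A)
      then have A: "\<And>i. A i \<in> sets borel" by (auto simp: borel_def)
      have "(LINT x:(\<Union>i. A i)|lborel. g x) = (\<Sum>i. LINT x:A i|lborel. g x)"
        using union A by (intro lebesgue_integral_countable_add sint) (auto simp: disjoint_family_on_def)
      then show ?case using union by simp
    qed (auto simp: open0)
  qed
  have "AE x in lborel. g x = 0"
    using density_unique_real[OF ig, of "\<lambda>_. 0"] all0 by simp
  moreover have "AE x in lborel. x \<notin> cbox (0::real^3) (\<chi> i. 1) - ?b"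
  proof (rule AE_not_in)
    have "negligible (cbox (0::real^3) (\<chi> i. 1) - ?b)"
      by (rule negligible_frontier_interval)
    then show "cbox (0::real^3) (\<chi> i. 1) - ?b \<in> null_sets lborel"
      by (simp add: negligible_iff_null_sets null_sets_completion_iff)
  qed
  ultimately have "AE x in lborel. x \<in> cbox 0 (\<chi> i. 1) \<longrightarrow> f x = 0"
    by eventually_elim (auto simp: g_def indicator_def split: if_splits)
  then show ?thesis
    unfolding T3_def by (subst AE_restrict_space_iff) auto
qed

end

section \<open>The Riesz--Fischer theorem\<close>

text \<open>Monotone convergence makes the integral of the extended-valued sum finite, so the sum
  itself is finite almost everywhere.\<close>

lemma AE_summable_if_summable_integral:
  fixes f :: "nat \<Rightarrow> 'x \<Rightarrow> real"
  assumes int: "\<And>i. integrable M (f i)" and nn: "\<And>i x. 0 \<le> f i x"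
    and sum: "summable (\<lambda>i. LINT x|M. f i x)"
  shows "AE x in M. summable (\<lambda>i. f i x)"
proof -
  have [measurable]: "f i \<in> borel_measurable M" for i using int by auto
  have "(\<integral>\<^sup>+x. (\<Sum>i. ennreal (f i x)) \<partial>M) = (\<Sum>i. \<integral>\<^sup>+x. ennreal (f i x) \<partial>M)"
    by (rule nn_integral_suminf) simp
  also have "\<dots> = (\<Sum>i. ennreal (LINT x|M. f i x))"
    using int nn by (subst nn_integral_eq_integral) auto
  also have "\<dots> \<noteq> \<infinity>"
    using sum nn by (subst suminf_ennreal2) auto
  finally have "AE x in M. (\<Sum>i. ennreal (f i x)) \<noteq> \<infinity>"
    by (intro nn_integral_PInf_AE) auto
  then show ?thesis
    by eventually_elim (auto intro!: summable_suminf_not_top nn)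
qed

text \<open>The symmetry that characterises the coefficients of real-valued functions.\<close>

definition herm :: "(int^3 \<Rightarrow> complex) \<Rightarrow> bool" where
  "herm c \<longleftrightarrow> (\<forall>k. c (- k) = cnj (c k))"

lemma herm_fcoef: "herm (fcoef f)"
proof -
  have "fcoef f (- k) = cnj (fcoef f k)" for k
  proof -
    have "fcoef f (- k) = (LINT x|T3. cnj (complex_of_real (f x) * fexp (- k) x))"
      unfolding fcoef_fexp by (rule Bochner_Integration.integral_cong) (auto simp: fexp_minus)
    also have "\<dots> = cnj (fcoef f k)"
      unfolding fcoef_fexp by (rule Bochner_Integration.integral_cnj)
    finally show ?thesis .
  qed
  then show ?thesis by (simp add: herm_def)
qed

lemma integral_norm_sq_fexp_sum:
  assumes "finite S"
  shows "(LINT x|T3. (cmod (\<Sum>k\<in>S. c k * fexp k x))\<^sup>2) = (\<Sum>k\<in>S. (cmod (c k))\<^sup>2)"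
proof -
  have b: "bounded_T3 (\<lambda>x. \<Sum>k\<in>S. c k * fexp k x)" if "finite S" for S
    using that by (induction S rule: finite_induct) (auto intro!: bounded_T3_intros)
  have "complex_of_real (LINT x|T3. (cmod (\<Sum>k\<in>S. c k * fexp k x))\<^sup>2)
     = (LINT x|T3. complex_of_real ((cmod (\<Sum>k\<in>S. c k * fexp k x))\<^sup>2))"
    by (rule integral_complex_of_real[symmetric])
  also have "\<dots> = (LINT x|T3. (\<Sum>k\<in>S. \<Sum>l\<in>S. c k * cnj (c l) * fexp (k - l) x))"
  proof (rule Bochner_Integration.integral_cong[OF refl])
    fix x
    have "complex_of_real ((cmod (\<Sum>k\<in>S. c k * fexp k x))\<^sup>2) = (\<Sum>k\<in>S. c k * fexp k x) * cnj (\<Sum>k\<in>S. c k * fexp k x)"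
      by (rule complex_norm_square)
    also have "\<dots> = (\<Sum>k\<in>S. \<Sum>l\<in>S. c k * cnj (c l) * fexp (k - l) x)"
      unfolding cnj_sum sum_product
      using fexp_add[of _ "- _" x] by (intro sum.cong refl) (simp add: fexp_minus mult_ac)
    finally show "complex_of_real ((cmod (\<Sum>k\<in>S. c k * fexp k x))\<^sup>2) = (\<Sum>k\<in>S. \<Sum>l\<in>S. c k * cnj (c l) * fexp (k - l) x)" .
  qed
  also have "\<dots> = (\<Sum>k\<in>S. \<Sum>l\<in>S. c k * cnj (c l) * (if k = l then 1 else 0))"
    by (simp add: integral_fexp bounded_T3_integrable[OF bounded_T3_fexp])
  also have "\<dots> = (\<Sum>k\<in>S. c k * cnj (c k))"
    using assms by (simp add: sum.delta if_distrib cong: if_cong)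
  also have "\<dots> = complex_of_real (\<Sum>k\<in>S. (cmod (c k))\<^sup>2)"
    unfolding of_real_sum by (intro sum.cong refl complex_norm_square[symmetric])
  finally show ?thesis
    by (simp only: of_real_eq_iff)
qed

text \<open>The variance of \<open>norm (f x)\<close> is nonnegative, the torus being a probability
  space.\<close>

lemma integral_norm_le_L2:
  fixes f :: "real^3 \<Rightarrow> complex"
  assumes "bounded_T3 f"
  shows "(LINT x|T3. norm (f x)) \<le> sqrt (LINT x|T3. (norm (f x))\<^sup>2)"
proof (rule real_le_rsqrt)
  let ?a = "LINT x|T3. norm (f x)"
  have b: "bounded_T3 (\<lambda>x. norm (f x))" using assms by (auto simp: bounded_T3_def)
  then have i: "integrable T3 (\<lambda>x. norm (f x))" "integrable T3 (\<lambda>x. (norm (f x))\<^sup>2)"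
    using bounded_T3_mult[OF b b] by (auto intro: bounded_T3_integrable simp: power2_eq_square)
  have "0 \<le> (LINT x|T3. (norm (f x) - ?a)\<^sup>2)" by simp
  also have "\<dots> = (LINT x|T3. (norm (f x))\<^sup>2 - 2 * ?a * norm (f x) + ?a\<^sup>2)"
    by (rule Bochner_Integration.integral_cong) (auto simp: power2_diff)
  also have "\<dots> = (LINT x|T3. (norm (f x))\<^sup>2) - ?a\<^sup>2"
    using i by (simp add: power2_eq_square)
  finally show "?a\<^sup>2 \<le> (LINT x|T3. (norm (f x))\<^sup>2)" by simp
qed

text \<open>
  The partial sums along the subsequence \<open>r\<close> have increments of \<open>L\<^sup>1\<close> norm at most \<open>2\<^sup>-\<^sup>j\<close>, so they
  converge almost everywhere; setting the limit to \<open>0\<close> where they do not keeps it periodic.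
\<close>

theorem Riesz_Fischer:
  assumes herm: "herm c" and sq: "(\<lambda>k. (cmod (c k))\<^sup>2) summable_on UNIV"
  shows "\<exists>g. g \<in> L2 \<and> (\<forall>k. fcoef g k = c k)"
proof -
  obtain e :: "nat \<Rightarrow> int^3" where e: "bij e" using ex_enumeration_int3 by blast
  have inj: "inj_on e S" for S using e by (meson bij_is_inj inj_on_subset subset_UNIV)
  define a where "a n = (cmod (c (e n)))\<^sup>2" for n
  have sa: "summable a"
    using sq summable_on_reindex_bij_betw[OF e, of "\<lambda>k. (cmod (c k))\<^sup>2"] summable_on_imp_summable unfolding a_def by metis
  have a0: "a n \<ge> 0" for n by (simp add: a_def)
  \<comment> \<open>The terms of \<open>a\<close> are squared moduli: the rate 1/4 becomes 1/2 after
    the square root that passes to the L^2 norm.\<close>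
  have "\<exists>N. \<forall>m\<ge>N. \<forall>n. norm (sum a {m..<n}) < (1/4)^j" for j :: nat
    using sa by (simp add: summable_Cauchy)
  then obtain N where N: "\<And>j m n. m \<ge> N j \<Longrightarrow> norm (sum a {m..<n}) < (1/4)^j"
    by metis
  \<comment> \<open>Summing all earlier thresholds makes \<open>r\<close> monotone while it stays
    above \<open>N j\<close>; the summand \<open>j\<close> makes it unbounded.\<close>
  define r where "r j = (\<Sum>i\<le>j. N i) + j" for j
  have rN: "r j \<ge> N j" and rj: "r j \<ge> j" and rS: "r j \<le> r (Suc j)" for j
    by (auto simp: r_def intro: member_le_sum trans_le_add1)
  define F where "F n x = (\<Sum>i<n. c (e i) * fexp (e i) x)" for n x
  define d where "d j x = F (r (Suc j)) x - F (r j) x" for j x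
  have F_sum: "F n x = (\<Sum>k\<in>e ` {..<n}. c k * fexp k x)" for n x
    unfolding F_def by (subst sum.reindex[OF inj]) simp
  have bF: "bounded_T3 (F n)" for n
    unfolding F_def by (induction n) (auto intro!: bounded_T3_intros)
  have d_sum: "d j x = (\<Sum>k\<in>e ` {r j..<r (Suc j)}. c k * fexp k x)" for j x
    unfolding d_def F_def sum.reindex[OF inj] o_def
    using rS by (subst lessThan_atLeast0, subst lessThan_atLeast0, subst sum_diff_nat_ivl) auto
  have bd: "bounded_T3 (d j)" for j
    using bounded_T3_add[OF bF[of "r (Suc j)"] bounded_T3_mult[OF bounded_T3_const[of "-1"] bF[of "r j"]]]
    by (simp add: d_def[abs_def])
  have F_L2: "(LINT x|T3. (cmod (F n x))\<^sup>2) \<le> suminf a" for n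
  proof -
    have "(LINT x|T3. (cmod (F n x))\<^sup>2) = (\<Sum>k\<in>e ` {..<n}. (cmod (c k))\<^sup>2)"
      unfolding F_sum by (rule integral_norm_sq_fexp_sum) simp
    also have "\<dots> = sum a {..<n}"
      by (subst sum.reindex[OF inj]) (simp add: a_def)
    also have "\<dots> \<le> suminf a"
      using sum_le_suminf[OF sa, of "{..<n}"] a0 by simp
    finally show ?thesis .
  qed
  have d_L1: "(LINT x|T3. cmod (d j x)) \<le> (1/2)^j" for j
  proof -
    have "(LINT x|T3. (cmod (d j x))\<^sup>2) = (\<Sum>k\<in>e ` {r j..<r (Suc j)}. (cmod (c k))\<^sup>2)"
      unfolding d_sum by (rule integral_norm_sq_fexp_sum) simp
    also have "\<dots> = sum a {r j..<r (Suc j)}"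
      by (subst sum.reindex[OF inj]) (simp add: a_def)
    also have "\<dots> \<le> (1/4)^j"
      using N[of j "r j" "r (Suc j)"] rN[of j] by (simp add: abs_less_iff)
    finally have "sqrt (LINT x|T3. (cmod (d j x))\<^sup>2) \<le> sqrt ((1/4)^j)" by simp
    also have "sqrt ((1/4)^j) = (1/2::real)^j"
      by (simp add: real_sqrt_power real_sqrt_divide)
    finally show ?thesis using integral_norm_le_L2[OF bd[of j]] by linarith
  qed
  have id: "integrable T3 (\<lambda>x. cmod (d j x))" for j
    using bounded_T3_integrable[OF bd] by auto
  have sd: "summable (\<lambda>j. LINT x|T3. cmod (d j x))"
    by (rule summable_comparison_test'[OF summable_geometric[of "1/2::real"]]) (use d_L1 in auto)
  have aes: "AE x in T3. summable (\<lambda>j. cmod (d j x))"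
    by (rule AE_summable_if_summable_integral[OF id _ sd]) simp
  define G where "G x = (if summable (\<lambda>j. cmod (d j x)) then F (r 0) x + (\<Sum>j. d j x) else 0)" for x
  have [measurable]: "F n \<in> borel_measurable T3" "d n \<in> borel_measurable T3" for n
    using bF bd by (auto simp: bounded_T3_def)
  \<comment> \<open>Summability is rewritten as finiteness of an extended sum, which is a measurable
    function of \<open>x\<close>; this makes the case distinction in \<open>G\<close>
    measurable.\<close>
  have "summable (\<lambda>j. cmod (d j x)) \<longleftrightarrow> (\<Sum>j. ennreal (cmod (d j x))) \<noteq> top" for x
  proof
    assume "summable (\<lambda>j. cmod (d j x))"
    then show "(\<Sum>j. ennreal (cmod (d j x))) \<noteq> top"
      by (subst suminf_ennreal2) auto
  qed (rule summable_suminf_not_top, auto)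
  then have [measurable]: "Measurable.pred T3 (\<lambda>x. summable (\<lambda>j. cmod (d j x)))"
    by simp
  have [measurable]: "G \<in> borel_measurable T3"
    unfolding G_def by measurable
  have tele: "F (r n) x = F (r 0) x + (\<Sum>j<n. d j x)" for n x
    by (induction n) (auto simp: d_def)
  have limG: "AE x in T3. (\<lambda>n. F (r n) x) \<longlonglongrightarrow> G x"
    using aes
  proof eventually_elim
    case (elim x)
    then have "(\<lambda>n. \<Sum>j<n. d j x) \<longlonglongrightarrow> (\<Sum>j. d j x)"
      by (intro summable_LIMSEQ summable_norm_cancel[of "\<lambda>j. d j x"])
    then have "(\<lambda>n. F (r 0) x + (\<Sum>j<n. d j x)) \<longlonglongrightarrow> F (r 0) x + (\<Sum>j. d j x)"
      by (intro tendsto_intros)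
    then show ?case
      unfolding tele[symmetric] using elim by (simp add: G_def)
  qed
  \<comment> \<open>Fatou's lemma: the partial sums have squared L^2 norm at most
    \<open>suminf a\<close> and converge almost everywhere.\<close>
  have "(\<integral>\<^sup>+x. ennreal ((cmod (G x))\<^sup>2) \<partial>T3) \<le> (\<integral>\<^sup>+x. liminf (\<lambda>n. ennreal ((cmod (F (r n) x))\<^sup>2)) \<partial>T3)"
  proof (rule nn_integral_mono_AE)
    show "AE x in T3. ennreal ((cmod (G x))\<^sup>2) \<le> liminf (\<lambda>n. ennreal ((cmod (F (r n) x))\<^sup>2))"
      using limG
    proof eventually_elim
      case (elim x)
      have "(\<lambda>n. ennreal ((cmod (F (r n) x))\<^sup>2)) \<longlonglongrightarrow> ennreal ((cmod (G x))\<^sup>2)"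
        by (intro tendsto_ennrealI tendsto_power tendsto_norm elim)
      from lim_imp_Liminf[OF _ this] show ?case by simp
    qed
  qed
  also have "\<dots> \<le> liminf (\<lambda>n. \<integral>\<^sup>+x. ennreal ((cmod (F (r n) x))\<^sup>2) \<partial>T3)"
    by (rule nn_integral_liminf) simp
  also have "\<dots> \<le> liminf (\<lambda>n::nat. ennreal (suminf a))"
  proof (intro Liminf_mono always_eventually allI)
    fix n
    have "integrable T3 (\<lambda>x. (cmod (F (r n) x))\<^sup>2)"
    proof -
      have b: "bounded_T3 (\<lambda>x. norm (F (r n) x))" using bF[of "r n"] by (auto simp: bounded_T3_def)
      show ?thesis using bounded_T3_mult[OF b b] by (auto intro: bounded_T3_integrable simp: power2_eq_square)
    qed
    then have "(\<integral>\<^sup>+x. ennreal ((cmod (F (r n) x))\<^sup>2) \<partial>T3) = ennreal (LINT x|T3. (cmod (F (r n) x))\<^sup>2)"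
      by (intro nn_integral_eq_integral) auto
    then show "(\<integral>\<^sup>+x. ennreal ((cmod (F (r n) x))\<^sup>2) \<partial>T3) \<le> ennreal (suminf a)"
      using F_L2 by (simp add: ennreal_leI)
  qed
  also have "\<dots> = ennreal (suminf a)"
    by (simp add: Liminf_const)
  finally have G2: "integrable T3 (\<lambda>x. (cmod (G x))\<^sup>2)"
    by (intro integrableI_bounded) (auto simp: less_top[symmetric] top_unique)
  have perF: "F n (x + rvec k) = F n x" for n x k
    by (simp add: F_def fexp_periodic)
  have perG: "G (x + rvec k) = G x" for x k
    by (simp add: G_def d_def perF)
  have iG: "integrable T3 G" and coef: "(LINT x|T3. G x * fexp (- k) x) = c k" for k
  proof -
    \<comment> \<open>A common majorant of all partial sums along \<open>r\<close>, integrable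
      because the increments have summable L^1 norms; it allows the limit to be taken inside each
      coefficient.\<close>
    let ?w = "\<lambda>x. cmod (F (r 0) x) + (\<Sum>j. cmod (d j x))"
    have iw: "integrable T3 ?w"
    proof (rule Bochner_Integration.integrable_add)
      show "integrable T3 (\<lambda>x. cmod (F (r 0) x))"
        using bounded_T3_integrable[OF bF] by auto
      show "integrable T3 (\<lambda>x. \<Sum>j. cmod (d j x))"
        using id sd aes by (intro integrable_suminf) auto
    qed
    have dom: "AE x in T3. norm (F (r n) x * fexp (- k) x) \<le> ?w x" for n k
      using aes
    proof eventually_elim
      case (elim x)
      have "norm (F (r n) x) \<le> norm (F (r 0) x) + (\<Sum>j<n. norm (d j x))"
        unfolding tele[of n] by (rule norm_triangle_le) (simp add: norm_sum)
      also have "(\<Sum>j<n. norm (d j x)) \<le> (\<Sum>j. cmod (d j x))"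
        by (rule sum_le_suminf[OF elim]) auto
      finally show ?case by (simp add: norm_mult)
    qed
    have lim': "AE x in T3. (\<lambda>n. F (r n) x * fexp (- k) x) \<longlonglongrightarrow> G x * fexp (- k) x" for k
      using limG by eventually_elim (auto intro: tendsto_intros)
    have "integrable T3 (\<lambda>x. G x * fexp (- 0) x)"
      by (rule integrable_dominated_convergence[OF _ _ iw lim' dom]) simp_all
    then show "integrable T3 G" by simp
    have lim: "(\<lambda>n. LINT x|T3. F (r n) x * fexp (- k) x) \<longlonglongrightarrow> (LINT x|T3. G x * fexp (- k) x)"
      by (rule integral_dominated_convergence[OF _ _ iw lim' dom]) simp_all
    obtain n0 where n0: "e n0 = k" using e by (metis bij_pointE)
    have "(LINT x|T3. F m x * fexp (- k) x) = c k" if "m > n0" for m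
    proof -
      have "(LINT x|T3. F m x * fexp (- k) x) = (LINT x|T3. (\<Sum>i<m. c (e i) * fexp (e i - k) x))"
        unfolding F_def sum_distrib_right using fexp_add[of _ "- k"]
        by (intro Bochner_Integration.integral_cong sum.cong refl) (simp add: mult.assoc)
      also have "\<dots> = (\<Sum>i<m. c (e i) * (if e i = k then 1 else 0))"
        by (simp add: integral_fexp bounded_T3_integrable[OF bounded_T3_fexp])
      also have "\<dots> = (\<Sum>i<m. if i = n0 then c k else 0)"
        using n0 e by (intro sum.cong refl) (auto simp: bij_def inj_def)
      also have "\<dots> = c k" using that by simp
      finally show ?thesis .
    qed
    then have "eventually (\<lambda>n. (LINT x|T3. F (r n) x * fexp (- k) x) = c k) sequentially"
      using rj by (intro eventually_sequentiallyI[of "Suc n0"]) (metis Suc_le_eq le_trans)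
    then have "(\<lambda>n. LINT x|T3. F (r n) x * fexp (- k) x) \<longlonglongrightarrow> c k"
      by (rule tendsto_eventually)
    then show "(LINT x|T3. G x * fexp (- k) x) = c k"
      using lim LIMSEQ_unique by blast
  qed
  \<comment> \<open>By \<open>herm\<close>, \<open>G\<close> and its conjugate have the same
    coefficients, so taking the real part changes none of them.\<close>
  let ?g = "\<lambda>x. Re (G x)"
  have "fcoef ?g k = c k" for k
  proof -
    have i: "integrable T3 (\<lambda>x. G x * fexp l x)" for l
      using integrable_fexp_mult[OF iG, of l] by (simp add: mult.commute)
    have "fcoef ?g k = (LINT x|T3. 1/2 * (G x * fexp (- k) x) + 1/2 * cnj (G x * fexp (- (- k)) x))"
      unfolding fcoef_fexp
    proof (rule Bochner_Integration.integral_cong[OF refl])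
      fix x
      have "complex_of_real (Re (G x)) = 1/2 * G x + 1/2 * cnj (G x)"
        by (simp add: complex_eq_iff)
      then show "complex_of_real (Re (G x)) * fexp (- k) x = 1/2 * (G x * fexp (- k) x) + 1/2 * cnj (G x * fexp (- (- k)) x)"
        by (simp add: fexp_minus algebra_simps)
    qed
    also have "\<dots> = 1/2 * (LINT x|T3. G x * fexp (- k) x) + 1/2 * cnj (LINT x|T3. G x * fexp (- (- k)) x)"
      using i[of "- k"] i[of "- (- k)"] by (simp del: minus_minus complex_cnj_mult)
    also have "\<dots> = 1/2 * c k + 1/2 * cnj (c (- k))"
      unfolding coef ..
    also have "\<dots> = c k" using herm by (simp add: herm_def)
    finally show ?thesis .
  qed
  moreover have "?g \<in> L2"
    unfolding L2_def
  proof (intro CollectI conjI)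
    show "periodic ?g" by (simp add: periodic_def perG)
    show "integrable T3 (\<lambda>x. (norm (Re (G x)))\<^sup>2)"
      by (rule Bochner_Integration.integrable_bound[OF G2]) (auto intro!: AE_I2 simp: cmod_power2)
  qed simp
  ultimately show ?thesis by blast
qed

section \<open>Weak derivatives and componentwise square integrability\<close>

lemma herm_dsym_mult: "herm c \<Longrightarrow> herm (\<lambda>k. dsym j k * c k)"
  by (simp add: herm_def dsym_def)

text \<open>Riesz--Fischer supplies the witness that \<open>SOME\<close> asks for; the factor i in
  the symbol is what preserves the symmetry of real functions.\<close>

lemma pd_properties:
  assumes "(\<lambda>k. (cmod (dsym j k * fcoef f k))\<^sup>2) summable_on UNIV"
  shows "pd j f \<in> L2" "fcoef (pd j f) k = dsym j k * fcoef f k"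
proof -
  have "\<exists>g. g \<in> L2 \<and> (\<forall>k. fcoef g k = dsym j k * fcoef f k)"
    by (rule Riesz_Fischer[OF herm_dsym_mult[OF herm_fcoef] assms])
  then have "pd j f \<in> L2 \<and> (\<forall>k. fcoef (pd j f) k = dsym j k * fcoef f k)"
    unfolding pd_def fourier_mult_def dsym_def by (rule someI_ex)
  then show "pd j f \<in> L2" "fcoef (pd j f) k = dsym j k * fcoef f k" by auto
qed

lemma L2_integrable: "f \<in> L2 \<Longrightarrow> integrable T3 f" for f :: "real^3 \<Rightarrow> real"
  unfolding L2_def by (auto intro: T3.square_integrable_imp_integrable)

lemma L2_inner_component:
  fixes f :: "real^3 \<Rightarrow> 'a::euclidean_space"
  assumes "f \<in> L2" "b \<in> Basis"
  shows "(\<lambda>x. f x \<bullet> b) \<in> L2"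
  unfolding L2_def
proof (intro CollectI conjI)
  have f: "periodic f" "f \<in> borel_measurable T3" "integrable T3 (\<lambda>x. (norm (f x))\<^sup>2)"
    using assms by (auto simp: L2_def)
  show "periodic (\<lambda>x. f x \<bullet> b)" using f by (simp add: periodic_def)
  show m: "(\<lambda>x. f x \<bullet> b) \<in> borel_measurable T3" using f by simp
  show "integrable T3 (\<lambda>x. (norm (f x \<bullet> b))\<^sup>2)"
  proof (rule Bochner_Integration.integrable_bound[OF f(3)])
    have "(norm (f x \<bullet> b))\<^sup>2 \<le> (norm (f x))\<^sup>2" for x
      using Basis_le_norm[OF assms(2), of "f x"] by (intro power_mono) auto
    then show "AE x in T3. norm ((norm (f x \<bullet> b))\<^sup>2) \<le> norm ((norm (f x))\<^sup>2)"
      by simp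
  qed (use m in simp)
qed

lemma L2_componentI:
  fixes f :: "real^3 \<Rightarrow> 'a::euclidean_space"
  assumes "\<And>b. b \<in> Basis \<Longrightarrow> (\<lambda>x. f x \<bullet> b) \<in> L2"
  shows "f \<in> L2"
  unfolding L2_def
proof (intro CollectI conjI)
  show "periodic f"
  proof -
    have "f (x + rvec k) \<bullet> b = f x \<bullet> b" if "b \<in> Basis" for x k b
      using assms[OF that] unfolding L2_def periodic_def by blast
    then show ?thesis
      unfolding periodic_def by (blast intro: euclidean_eqI)
  qed
  show "f \<in> borel_measurable T3"
    by (subst borel_measurable_euclidean_space) (use assms in \<open>auto simp: L2_def\<close>)
  have "(\<lambda>x. (norm (f x))\<^sup>2) = (\<lambda>x. \<Sum>b\<in>Basis. (f x \<bullet> b)\<^sup>2)"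
    by (subst norm_eq_sqrt_inner, subst euclidean_inner) (auto simp: power2_eq_square sum_nonneg)
  moreover have "integrable T3 (\<lambda>x. \<Sum>b\<in>Basis. (f x \<bullet> b)\<^sup>2)"
    using assms by (intro Bochner_Integration.integrable_sum) (auto simp: L2_def)
  ultimately show "integrable T3 (\<lambda>x. (norm (f x))\<^sup>2)" by simp
qed

lemma L2_integrable_vec:
  fixes f :: "real^3 \<Rightarrow> 'a::euclidean_space"
  assumes "f \<in> L2"
  shows "integrable T3 f"
proof -
  have "integrable T3 (\<lambda>x. \<Sum>b\<in>Basis. (f x \<bullet> b) *\<^sub>R b)"
    using assms by (intro Bochner_Integration.integrable_sum integrable_scaleR_left) (auto intro: L2_integrable L2_inner_component)
  then show ?thesis by (simp add: euclidean_representation)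
qed

lemma fcoef_0: "fcoef f 0 = complex_of_real (LINT x|T3. f x)"
  unfolding fcoef_fexp by simp

lemma integral_eq_0_iff_fcoef:
  fixes f :: "real^3 \<Rightarrow> 'a::euclidean_space"
  assumes "f \<in> L2"
  shows "(LINT x|T3. f x) = 0 \<longleftrightarrow> (\<forall>b\<in>Basis. fcoef (\<lambda>x. f x \<bullet> b) 0 = 0)"
  using L2_integrable_vec[OF assms] by (auto simp: fcoef_0 euclidean_eq_iff[where 'a='a])

lemma HdotI:
  fixes f :: "real^3 \<Rightarrow> 'a::euclidean_space"
  assumes "\<And>b. b \<in> Basis \<Longrightarrow> (\<lambda>x. f x \<bullet> b) \<in> L2" "\<And>b. b \<in> Basis \<Longrightarrow> fcoef (\<lambda>x. f x \<bullet> b) 0 = 0"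
    and "(\<lambda>k. lap_symbol k powr s * fcoef_sq f k) summable_on {k. k \<noteq> 0}"
  shows "f \<in> Hdot s"
  using L2_componentI[of f] integral_eq_0_iff_fcoef[of f] assms by (auto simp: Hdot_def)

section \<open>Functions as sums of their Fourier series, and Parseval's identity\<close>

lemma fser_herm: "herm c \<Longrightarrow> cnj (fser c x) = fser c x"
proof -
  assume h: "herm c"
  have "cnj (fser c x) = (\<Sum>\<^sub>\<infinity>k. cnj (c k) * fexp (- k) x)"
    unfolding fser_def infsum_cnj[symmetric] by (simp add: fexp_minus)
  also have "\<dots> = (\<Sum>\<^sub>\<infinity>k. c (- k) * fexp (- k) x)"
    using h by (simp add: herm_def)
  also have "\<dots> = (\<Sum>\<^sub>\<infinity>k. c k * fexp k x)"
    by (rule infsum_reindex_bij_witness[of _ uminus uminus]) auto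
  finally show ?thesis by (simp add: fser_def)
qed

lemma fser_herm_real: "herm c \<Longrightarrow> complex_of_real (Re (fser c x)) = fser c x"
  using fser_herm[of c x] by (simp add: complex_eq_iff)

lemma integral_of_real_fexp: "(LINT x|T3. fexp k x * complex_of_real (f x)) = cnj (fcoef f k)"
proof -
  have "(LINT x|T3. fexp k x * complex_of_real (f x)) = fcoef f (- k)"
    unfolding fcoef_fexp by (simp add: mult.commute)
  then show ?thesis using herm_fcoef[of f] by (simp add: herm_def)
qed

lemma integrable_of_real_fexp:
  "integrable T3 f \<Longrightarrow> integrable T3 (\<lambda>x. complex_of_real (f x) * fexp k x)"
  using integrable_fexp_mult[of "\<lambda>x. complex_of_real (f x)" k] by (simp add: mult.commute)

lemma fcoef_diff:
  assumes "integrable T3 f" "integrable T3 g"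
  shows "fcoef (\<lambda>x. f x - g x) k = fcoef f k - fcoef g k"
  using integrable_of_real_fexp[OF assms(1)] integrable_of_real_fexp[OF assms(2)]
  unfolding fcoef_fexp by (simp add: left_diff_distrib)

lemma fcoef_add:
  assumes "integrable T3 f" "integrable T3 g"
  shows "fcoef (\<lambda>x. f x + g x) k = fcoef f k + fcoef g k"
  using integrable_of_real_fexp[OF assms(1)] integrable_of_real_fexp[OF assms(2)]
  unfolding fcoef_fexp by (simp add: distrib_right)

lemma fcoef_cmult: "fcoef (\<lambda>x. r * f x) k = r * fcoef f k"
  unfolding fcoef_fexp by (simp add: mult.assoc)

text \<open>The difference has vanishing coefficients, so completeness applies. Through this step
  arbitrarily chosen representatives become explicit series.\<close>

theorem L2_eq_fser:
  assumes f: "f \<in> L2" and c: "abs_coef (fcoef f)"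
  shows "AE x in T3. complex_of_real (f x) = fser (fcoef f) x"
proof -
  let ?F = "fser (fcoef f)"
  note i = L2_integrable[OF f]
  have iF: "integrable T3 (\<lambda>x. Re (?F x))"
    using bounded_T3_integrable[OF bounded_T3_fser[OF c]] by simp
  have "fcoef (\<lambda>x. Re (?F x)) k = fcoef f k" for k
    using integral_fser_fexp[OF c, of k] by (simp add: fcoef_fexp[of "\<lambda>x. Re (?F x)"] fser_herm_real[OF herm_fcoef])
  then have "fcoef (\<lambda>x. f x - Re (?F x)) k = 0" for k
    by (simp add: fcoef_diff[OF i iF])
  then have "AE x in T3. f x - Re (?F x) = 0"
    by (intro AE_zero_if_fcoef_zero Bochner_Integration.integrable_diff i iF)
  then show ?thesis
    by eventually_elim (metis eq_iff_diff_eq_0 fser_herm_real[OF herm_fcoef])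
qed

text \<open>Only one factor is expanded, so the other may be merely integrable, as the nonlinearity
  will be.\<close>

lemma has_sum_inner_L2:
  assumes f: "f \<in> L2" and c: "abs_coef (fcoef f)" and g: "integrable T3 g"
  shows "((\<lambda>k. fcoef f k * cnj (fcoef g k)) has_sum complex_of_real (LINT x|T3. f x * g x)) UNIV"
proof -
  have ig: "integrable T3 (\<lambda>x. complex_of_real (g x))" using g by simp
  have [measurable]: "f \<in> borel_measurable T3" "g \<in> borel_measurable T3" "fser (fcoef f) \<in> borel_measurable T3"
    using f g bounded_T3_fser[OF c] by (auto simp: L2_def bounded_T3_def)
  have "(LINT x|T3. fser (fcoef f) x * complex_of_real (g x)) = (LINT x|T3. complex_of_real (f x * g x))"
    using L2_eq_fser[OF f c] by (intro integral_cong_AE) auto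
  also have "\<dots> = complex_of_real (LINT x|T3. f x * g x)"
    by (rule integral_complex_of_real)
  finally show ?thesis
    using has_sum_integral_fser[OF c ig] by (simp add: integral_of_real_fexp)
qed

lemma Parseval:
  assumes f: "f \<in> L2" and c: "abs_coef (fcoef f)"
  shows "((\<lambda>k. (cmod (fcoef f k))\<^sup>2) has_sum (LINT x|T3. (f x)\<^sup>2)) UNIV"
proof -
  have "((\<lambda>k. complex_of_real ((cmod (fcoef f k))\<^sup>2)) has_sum complex_of_real (LINT x|T3. f x * f x)) UNIV"
    using has_sum_inner_L2[OF f c L2_integrable[OF f]] unfolding complex_norm_square .
  then show ?thesis by (simp only: has_sum_of_real_iff power2_eq_square[of "f _"])
qed

lemma has_sum_sum:
  "finite S \<Longrightarrow> (\<And>i. i \<in> S \<Longrightarrow> (g i has_sum G i) A) \<Longrightarrow> ((\<lambda>k. \<Sum>i\<in>S. g i k) has_sum (\<Sum>i\<in>S. G i)) A"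
  for G :: "_ \<Rightarrow> 'b::topological_comm_monoid_add"
proof (induction S rule: finite_induct)
  case (insert i S)
  then have "((\<lambda>k. g i k + (\<Sum>i\<in>S. g i k)) has_sum G i + (\<Sum>i\<in>S. G i)) A"
    by (intro has_sum_add) simp_all
  then show ?case using insert by simp
qed simp

lemma Parseval_vec:
  fixes f :: "real^3 \<Rightarrow> 'a::euclidean_space"
  assumes f: "\<And>b. b \<in> Basis \<Longrightarrow> (\<lambda>x. f x \<bullet> b) \<in> L2" and c: "\<And>b. b \<in> Basis \<Longrightarrow> abs_coef (fcoef (\<lambda>x. f x \<bullet> b))"
  shows "(fcoef_sq f has_sum (l2_norm f)\<^sup>2) UNIV"
proof -
  have "(\<lambda>x. (norm (f x))\<^sup>2) = (\<lambda>x. \<Sum>b\<in>Basis. (f x \<bullet> b)\<^sup>2)"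
    by (subst norm_eq_sqrt_inner, subst euclidean_inner) (auto simp: power2_eq_square sum_nonneg)
  then have "(l2_norm f)\<^sup>2 = (LINT x|T3. (\<Sum>b\<in>Basis. (f x \<bullet> b)\<^sup>2))"
    by (simp add: l2_norm_def integral_nonneg_AE sum_nonneg)
  also have "\<dots> = (\<Sum>b\<in>Basis. LINT x|T3. (f x \<bullet> b)\<^sup>2)"
    using f by (intro Bochner_Integration.integral_sum) (auto simp: L2_def)
  finally show ?thesis
    unfolding fcoef_sq_def[abs_def] using has_sum_sum[OF finite_Basis Parseval[OF f c]] by simp
qed

lemma sum_Basis_vec:
  fixes F :: "('a::euclidean_space)^'n \<Rightarrow> 'b::comm_monoid_add"
  shows "(\<Sum>b\<in>Basis. F b) = (\<Sum>i\<in>UNIV. \<Sum>b\<in>Basis. F (axis i b))"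
proof -
  have "(\<Sum>i\<in>UNIV. \<Sum>b\<in>Basis. F (axis i b)) = (\<Sum>(i, b)\<in>UNIV \<times> Basis. F (axis i b))"
    by (rule sum.cartesian_product)
  also have "\<dots> = (\<Sum>b\<in>Basis. F b)"
  proof -
    have "bij_betw (\<lambda>(i, b). axis i b) (UNIV \<times> Basis) (Basis :: ('a^'n) set)"
      by (auto simp: bij_betw_def inj_on_def Basis_vec_def axis_eq_axis image_iff)
    from sum.reindex_bij_betw[OF this, of F] show ?thesis
      by (simp add: case_prod_unfold)
  qed
  finally show ?thesis by simp
qed

lemma fcoef_sq_vec3: "fcoef_sq u k = (\<Sum>i\<in>UNIV. (cmod (fcoef (\<lambda>x. u x $ i) k))\<^sup>2)" for u :: "real^3 \<Rightarrow> real^3"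
  unfolding fcoef_sq_def sum_Basis_vec inner_axis by simp

lemma fcoef_sq_mat3: "fcoef_sq u k = (\<Sum>i\<in>UNIV. \<Sum>j\<in>UNIV. (cmod (fcoef (\<lambda>x. u x $ i $ j) k))\<^sup>2)" for u :: "real^3 \<Rightarrow> real^3^3"
  unfolding fcoef_sq_def sum_Basis_vec inner_axis by simp

section \<open>Interactions of the sparse frequencies\<close>

text \<open>An exact substitute for |k|: divided by 3, the pairing with \<open>sigma\<close> is
  precisely a power of two on each shell, so comparing scales becomes integer arithmetic.\<close>

definition Wt :: "int^3 \<Rightarrow> real" where
  "Wt k = real_of_int \<bar>k $ 1 + k $ 2 + k $ 3\<bar> / 3"

definition Mlev :: "nat \<Rightarrow> (int^3) set" where
  "Mlev n = shell n \<union> uminus ` shell n"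

lemma Mfreq_eq: "Mfreq = (\<Union>n. Mlev n)"
  by (auto simp: Mfreq_def Mplus_def Mlev_def)

lemma perms_sum:
  assumes "l \<in> perms v"
  shows "l $ 1 + l $ 2 + l $ 3 = v $ 1 + v $ 2 + v $ 3"
proof -
  obtain p where p: "p permutes UNIV" "l = (\<chi> i. v $ p i)"
    using assms by (auto simp: perms_def)
  have "(\<Sum>i\<in>UNIV. v $ p i) = (\<Sum>i\<in>UNIV. v $ i)"
    using sum.permute[OF p(1), of "\<lambda>i. v $ i"] by (simp add: o_def)
  then show ?thesis by (simp add: p(2) sum_3)
qed

lemma perms_bound:
  assumes "l \<in> perms v" "\<And>i. \<bar>v $ i\<bar> \<le> B"
  shows "\<bar>l $ i\<bar> \<le> B"
  using assms by (auto simp: perms_def)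

lemma perms_finite: "finite (perms v)" and card_perms: "card (perms v) \<le> 6"
proof -
  have eq: "perms v = (\<lambda>p. \<chi> i. v $ p i) ` {p. p permutes (UNIV :: 3 set)}"
    by (auto simp: perms_def)
  have f: "finite {p. p permutes (UNIV :: 3 set)}" by (rule finite_permutations) simp
  show "finite (perms v)" unfolding eq using f by simp
  have "card (perms v) \<le> card {p. p permutes (UNIV :: 3 set)}"
    unfolding eq by (rule card_image_le[OF f])
  also have "\<dots> = fact 3" by (subst card_permutations[of _ 3]) auto
  finally show "card (perms v) \<le> 6" by (simp add: fact_numeral)
qed

lemma shell_finite: "finite (shell n)"
  by (simp add: shell_def perms_finite)

lemma card_shell: "card (shell n) \<le> 12"
  using card_perms[of "freq_k (n div 2)"] card_Un_le[of "perms (freq_h (n div 2))" "perms (freq_j (n div 2))"]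
    card_perms[of "freq_h (n div 2)"] card_perms[of "freq_j (n div 2)"]
  by (auto simp: shell_def)

text \<open>The perturbations of \<open>sigma\<close> have entries summing to zero, so only the
  multiple of \<open>sigma\<close> contributes to the sum; \<open>3 ^ m \<le> 2 ^ (2 * m)\<close>
  keeps the entries at the same scale.\<close>

lemma shell_sum:
  assumes "k \<in> shell n"
  shows "k $ 1 + k $ 2 + k $ 3 = 3 * 2 ^ n" and "\<bar>k $ i\<bar> \<le> 2 * 2 ^ n"
proof -
  define m where "m = n div 2"
  have pw: "(3::int) ^ m \<le> 2 ^ (2 * m)" "(0::int) \<le> 3 ^ m"
    by (auto simp: power_mult intro: power_mono)
  have nn: "n = (if even n then 2 * m else 2 * m + 1)"
    by (auto simp: m_def)
  have comp: "freq_k m $ i = 2 ^ (2 * m) + 3 ^ m * (vector [1, 0, -1] :: int^3) $ i"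
    "freq_h m $ i = 2 ^ (2 * m + 1) + 3 ^ m * (vector [1, 1, -2] :: int^3) $ i"
    "freq_j m $ i = 2 ^ (2 * m + 1) + 3 ^ m * (vector [2, -1, -1] :: int^3) $ i" for i
    using exhaust_3[of i] by (auto simp: freq_k_def freq_h_def freq_j_def sigma_def)
  show "k $ 1 + k $ 2 + k $ 3 = 3 * 2 ^ n"
    using assms nn
    by (auto simp: shell_def m_def[symmetric] comp dest!: perms_sum split: if_splits)
  have b: "\<bar>freq_k m $ i\<bar> \<le> 2 * 2 ^ (2 * m)" "\<bar>freq_h m $ i\<bar> \<le> 2 * 2 ^ (2 * m + 1)"
    "\<bar>freq_j m $ i\<bar> \<le> 2 * 2 ^ (2 * m + 1)" for i
    using exhaust_3[of i] by (auto simp: comp abs_le_iff) (use pw in linarith)+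
  show "\<bar>k $ i\<bar> \<le> 2 * 2 ^ n"
  proof (cases "even n")
    case True
    then have "k \<in> perms (freq_k m)" "n = 2 * m" using assms nn by (auto simp: shell_def m_def)
    then show ?thesis using perms_bound b(1) by auto
  next
    case False
    then have "k \<in> perms (freq_h m) \<or> k \<in> perms (freq_j m)" "n = 2 * m + 1"
      using assms nn by (auto simp: shell_def m_def)
    then show ?thesis using perms_bound[of k _ "2 * 2 ^ (2 * m + 1)"] b(2,3) by blast
  qed
qed

lemma Mlev_props:
  assumes "k \<in> Mlev n"
  shows "\<bar>k $ 1 + k $ 2 + k $ 3\<bar> = 3 * 2 ^ n" "Wt k = 2 ^ n" "\<bar>k $ i\<bar> \<le> 2 * 2 ^ n"
proof -
  consider "k \<in> shell n" | "- k \<in> shell n" using assms by (auto simp: Mlev_def)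
  then show 1: "\<bar>k $ 1 + k $ 2 + k $ 3\<bar> = 3 * 2 ^ n"
  proof cases
    case 1
    from shell_sum(1)[OF this] show ?thesis by simp
  next
    case 2
    from shell_sum(1)[OF this] have "k $ 1 + k $ 2 + k $ 3 = - (3 * 2 ^ n)" by simp
    then show ?thesis by simp
  qed
  show "Wt k = 2 ^ n" unfolding Wt_def 1 by simp
  from assms consider "k \<in> shell n" | "- k \<in> shell n" by (auto simp: Mlev_def)
  then show "\<bar>k $ i\<bar> \<le> 2 * 2 ^ n"
    by cases (force dest: shell_sum(2)[of _ _ i])+
qed

lemma Mlev_finite: "finite (Mlev n)"
  by (simp add: Mlev_def shell_finite)

lemma card_Mlev: "card (Mlev n) \<le> 24"
proof -
  have "card (Mlev n) \<le> card (shell n) + card (uminus ` shell n)"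
    unfolding Mlev_def by (rule card_Un_le)
  also have "card (uminus ` shell n) \<le> card (shell n)"
    by (rule card_image_le[OF shell_finite])
  finally show ?thesis using card_shell[of n] by linarith
qed

lemma Mfreq_cases: "k \<in> Mfreq \<Longrightarrow> \<exists>n. k \<in> Mlev n \<and> Wt k = 2 ^ n"
  using Mlev_props(2) by (auto simp: Mfreq_eq)

lemma Wt_pos: "k \<in> Mfreq \<Longrightarrow> 1 \<le> Wt k"
  using Mfreq_cases[of k] by auto

lemma zero_notin_Mfreq: "0 \<notin> Mfreq"
  using Wt_pos[of 0] by (auto simp: Wt_def)

lemma Mfreq_component: "k \<in> Mfreq \<Longrightarrow> \<bar>real_of_int (k $ i)\<bar> \<le> 2 * Wt k"
proof -
  assume "k \<in> Mfreq"
  then obtain n where n: "k \<in> Mlev n" "Wt k = 2 ^ n" using Mfreq_cases by blast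
  then have "real_of_int \<bar>k $ i\<bar> \<le> real_of_int (2 * 2 ^ n)"
    using Mlev_props(3)[of k n i] by (simp only: of_int_le_iff)
  then show ?thesis using n by simp
qed

lemma norm_rvec_sq: "(norm (rvec k))\<^sup>2 = (real_of_int (k $ 1))\<^sup>2 + (real_of_int (k $ 2))\<^sup>2 + (real_of_int (k $ 3))\<^sup>2"
  unfolding power2_norm_eq_inner by (simp add: rvec_def inner_vec_def sum_3 power2_eq_square)

text \<open>Cauchy--Schwarz against \<open>sigma\<close>, whose squared length is 3, with the
  division by 3 in \<open>Wt\<close> taken into account.\<close>

lemma Wt_sq_le_norm: "3 * (Wt k)\<^sup>2 \<le> (norm (rvec k))\<^sup>2"
proof -
  have "(a + b + c)\<^sup>2 \<le> 3 * (a\<^sup>2 + b\<^sup>2 + c\<^sup>2)" for a b c :: real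
    using sum_squares_ge_zero[of "a - b" "b - c"] zero_le_square[of "a - c"]
    by (simp add: power2_eq_square algebra_simps)
  from this[of "k $ 1" "k $ 2" "k $ 3"] show ?thesis
    by (simp add: norm_rvec_sq Wt_def power_divide)
qed

lemma lap_symbol_ge: "(Wt k)\<^sup>2 \<le> lap_symbol k"
proof -
  have "1 \<le> 4 * pi\<^sup>2" using pi_ge_two power_mono[of 2 pi 2] by simp
  then have "1 * (norm (rvec k))\<^sup>2 \<le> lap_symbol k"
    unfolding lap_symbol_def by (intro mult_right_mono) auto
  then show ?thesis using Wt_sq_le_norm[of k] zero_le_power2[of "Wt k"] by linarith
qed

lemma lap_symbol_nonneg [simp]: "0 \<le> lap_symbol k"
  by (simp add: lap_symbol_def)

text \<open>The constant is 4 \<pi>^2 times 12, from three components each of size at most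
  \<open>2 * Wt k\<close>.\<close>

lemma lap_symbol_le:
  assumes "k \<in> Mfreq" shows "lap_symbol k \<le> 48 * pi\<^sup>2 * (Wt k)\<^sup>2"
proof -
  have "(real_of_int (k $ i))\<^sup>2 \<le> 4 * (Wt k)\<^sup>2" for i
    using power_mono[OF Mfreq_component[OF assms, of i] abs_ge_zero, of 2] by (simp add: power_mult_distrib)
  from this[of 1] this[of 2] this[of 3] have "(norm (rvec k))\<^sup>2 \<le> 12 * (Wt k)\<^sup>2"
    by (simp add: norm_rvec_sq)
  then have "4 * pi\<^sup>2 * (norm (rvec k))\<^sup>2 \<le> 4 * pi\<^sup>2 * (12 * (Wt k)\<^sup>2)"
    by (intro mult_left_mono) auto
  then show ?thesis by (simp add: lap_symbol_def)
qed

text \<open>The exponent \<open>r\<close> exceeds both others but is at most one above their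
  maximum, which leaves no room for unequal summands. This rigidity is what turns additive relations
  between frequencies into adjacency of shells.\<close>

lemma pow2_add: assumes "(2::int) ^ p + 2 ^ q = 2 ^ r" shows "p = q \<and> r = Suc p"
proof -
  have less: "p < r" "q < r"
    using assms by (smt (verit) power_strict_increasing_iff zero_less_power)+
  have "r \<le> Suc (max p q)"
  proof (rule ccontr)
    assume "\<not> ?thesis"
    then have "(2::int) ^ Suc (Suc (max p q)) \<le> 2 ^ r" by (intro power_increasing) auto
    moreover have "(2::int) ^ p \<le> 2 ^ max p q" "(2::int) ^ q \<le> 2 ^ max p q" by (auto intro: power_increasing)
    ultimately show False using assms zero_less_power[of "2::int" "max p q"] by (simp, linarith)
  qed
  then have r: "r = Suc (max p q)" using less by auto
  have "p = q"
  proof (cases p q rule: linorder_cases)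
    case less
    then have "(2::int) ^ p < 2 ^ q" by simp
    then show ?thesis using assms r less by simp
  next
    case greater
    then have "(2::int) ^ q < 2 ^ p" by simp
    then show ?thesis using assms r greater by simp
  qed
  then show ?thesis using r by simp
qed

text \<open>The pairings with \<open>sigma\<close> have unknown signs, so additivity yields one of
  three relations between powers of two, according to which modulus is the sum of the other
  two.\<close>

lemma Mfreq_interaction:
  assumes k: "k \<in> Mlev n" and l: "l \<in> Mlev p" and kl: "k - l \<in> Mlev q"
  shows "n \<le> Suc p \<and> p \<le> Suc n \<and> n \<le> Suc q \<and> q \<le> Suc n"
proof -
  define a b c where "a = k $ 1 + k $ 2 + k $ 3" and "b = l $ 1 + l $ 2 + l $ 3"
    and "c = (k - l) $ 1 + (k - l) $ 2 + (k - l) $ 3"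
  have "a = b + c" by (simp add: a_def b_def c_def)
  moreover have "\<bar>a\<bar> = 3 * 2 ^ n" "\<bar>b\<bar> = 3 * 2 ^ p" "\<bar>c\<bar> = 3 * 2 ^ q"
    using Mlev_props(1)[OF k] Mlev_props(1)[OF l] Mlev_props(1)[OF kl] by (simp_all add: a_def b_def c_def)
  moreover have "(2::int) ^ n > 0" "(2::int) ^ p > 0" "(2::int) ^ q > 0" by simp_all
  ultimately have "(2::int) ^ p + 2 ^ q = 2 ^ n \<or> (2::int) ^ n + 2 ^ q = 2 ^ p \<or> (2::int) ^ p + 2 ^ n = 2 ^ q"
    by linarith
  then show ?thesis
    using pow2_add[of p q n] pow2_add[of n q p] pow2_add[of p n q] by auto
qed

lemma Mfreq_interaction_Wt:
  assumes "k \<in> Mfreq" "l \<in> Mfreq" "k - l \<in> Mfreq"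
  shows "Wt k \<le> 2 * Wt l" "Wt l \<le> 2 * Wt k" "Wt k \<le> 2 * Wt (k - l)" "Wt (k - l) \<le> 2 * Wt k"
proof -
  obtain n p q where n: "k \<in> Mlev n" "l \<in> Mlev p" "k - l \<in> Mlev q"
    using assms by (auto simp: Mfreq_eq)
  have "(2::real) ^ a \<le> 2 * 2 ^ b" if "a \<le> Suc b" for a b
    using power_increasing[OF that, of "2::real"] by simp
  then show "Wt k \<le> 2 * Wt l" "Wt l \<le> 2 * Wt k" "Wt k \<le> 2 * Wt (k - l)" "Wt (k - l) \<le> 2 * Wt k"
    using Mfreq_interaction[OF n] by (simp_all add: Mlev_props(2)[OF n(1)] Mlev_props(2)[OF n(2)] Mlev_props(2)[OF n(3)])
qed

definition partners :: "int^3 \<Rightarrow> (int^3) set" where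
  "partners k = {l \<in> Mfreq. k - l \<in> Mfreq}"

lemma partners_card:
  assumes "k \<in> Mfreq"
  shows "finite (partners k)" "card (partners k) \<le> 72"
proof -
  obtain n where n: "k \<in> Mlev n" using assms by (auto simp: Mfreq_eq)
  \<comment> \<open>Three levels of at most 24 frequencies account for the 72; for
    \<open>n = 0\<close> the truncated \<open>n - 1\<close> merely repeats level 0.\<close>
  let ?U = "Mlev (n - 1) \<union> Mlev n \<union> Mlev (Suc n)"
  have sub: "partners k \<subseteq> ?U"
  proof
    fix l assume "l \<in> partners k"
    then obtain p q where pq: "l \<in> Mlev p" "k - l \<in> Mlev q" by (auto simp: partners_def Mfreq_eq)
    then have "p = n - 1 \<or> p = n \<or> p = Suc n" using Mfreq_interaction[OF n pq] by linarith
    then show "l \<in> ?U" using pq by auto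
  qed
  have fin: "finite ?U" by (simp add: Mlev_finite)
  show "finite (partners k)" using sub fin by (rule finite_subset)
  have "card (partners k) \<le> card ?U" by (rule card_mono[OF fin sub])
  also have "\<dots> \<le> card (Mlev (n - 1)) + card (Mlev n) + card (Mlev (Suc n))"
    by (meson card_Un_le add_right_mono order_trans)
  finally show "card (partners k) \<le> 72"
    using card_Mlev[of "n - 1"] card_Mlev[of n] card_Mlev[of "Suc n"] by linarith
qed

text \<open>Each scale contributes at most 24 equal terms, so a geometric series dominates whatever
  positive \<open>s\<close> is. On the full lattice the corresponding sum would require s >
  3.\<close>

lemma Wt_powr_summable:
  assumes "s > 0"
  shows "(\<lambda>k. Wt k powr (- s)) summable_on Mfreq"
proof (rule nonneg_bounded_partial_sums_imp_summable_on)
  define q where "q = (2::real) powr (- s)"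
  have q: "0 < q" "q < 1" using assms by (auto simp: q_def powr_less_one)
  have lev: "(\<Sum>k\<in>Mlev n. Wt k powr (- s)) \<le> 24 * q ^ n" for n
  proof -
    have "Wt k powr (- s) = q ^ n" if "k \<in> Mlev n" for k
      unfolding Mlev_props(2)[OF that] q_def
      by (simp add: powr_realpow[symmetric] powr_powr mult.commute)
    then have "(\<Sum>k\<in>Mlev n. Wt k powr (- s)) = real (card (Mlev n)) * q ^ n" by simp
    also have "\<dots> \<le> 24 * q ^ n" using card_Mlev[of n] q by (intro mult_right_mono) auto
    finally show ?thesis .
  qed
  have "(\<Sum>k\<in>F. Wt k powr (- s)) \<le> 24 * (1 / (1 - q))" if F: "finite F" "F \<subseteq> Mfreq" for F
  proof -
    obtain N where N: "\<And>k. k \<in> F \<Longrightarrow> k \<in> Mlev (N k)"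
      using F Mfreq_cases by (metis subsetD)
    let ?m = "Suc (Max (insert 0 (N ` F)))"
    have "N k < ?m" if "k \<in> F" for k
      using that F by (auto simp: less_Suc_eq_le)
    then have sub: "F \<subseteq> (\<Union>n<?m. Mlev n)" using N by blast
    have "(\<Sum>k\<in>F. Wt k powr (- s)) \<le> (\<Sum>k\<in>(\<Union>n<?m. Mlev n). Wt k powr (- s))"
      by (rule sum_mono2[OF _ sub]) (auto simp: Mlev_finite)
    also have "\<dots> = (\<Sum>n<?m. \<Sum>k\<in>Mlev n. Wt k powr (- s))"
    proof (rule sum.UNION_disjoint)
      have "n = n'" if "k \<in> Mlev n" "k \<in> Mlev n'" for k n n'
        using Mlev_props(2)[OF that(1)] Mlev_props(2)[OF that(2)] by simp
      then show "\<forall>n\<in>{..<?m}. \<forall>n'\<in>{..<?m}. n \<noteq> n' \<longrightarrow> Mlev n \<inter> Mlev n' = {}" by blast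
    qed (auto simp: Mlev_finite)
    also have "\<dots> \<le> (\<Sum>n<?m. 24 * q ^ n)" by (rule sum_mono[OF lev])
    also have "\<dots> = 24 * (\<Sum>n<?m. q ^ n)" by (simp add: sum_distrib_left)
    also have "\<dots> \<le> 24 * (1 / (1 - q))"
      using q sum_le_suminf[OF summable_geometric[of q], of "{..<?m}"] suminf_geometric[of q] by auto
    finally show ?thesis .
  qed
  then show "\<forall>\<^sub>F F in finite_subsets_at_top Mfreq. (\<Sum>k\<in>F. Wt k powr (- s)) \<le> 24 * (1 / (1 - q))"
    by (intro eventually_finite_subsets_at_top_weakI) auto
qed auto

text \<open>The degenerate case, in which division by zero makes \<open>vdir k\<close> vanish, is
  kept; thus no frequency has to be shown non-parallel to \<open>sigma\<close>.\<close>

lemma norm_vdir: "(norm (vdir k))\<^sup>2 = (if vdir k = 0 then 0 else 1)"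
  by (auto simp: vdir_def)

lemma rvec_inner_vdir: "rvec k \<bullet> vdir k = 0"
proof -
  have "rvec k \<bullet> perp_proj k x = 0" for x
    by (cases "rvec k = 0") (auto simp: perp_proj_def inner_diff_right power2_norm_eq_inner)
  then show ?thesis by (simp add: vdir_def)
qed

section \<open>Fields in the constraint space\<close>

definition cf :: "(real^3 \<Rightarrow> real^3) \<Rightarrow> 3 \<Rightarrow> int^3 \<Rightarrow> complex" where
  "cf u i = fcoef (\<lambda>x. u x $ i)"

lemma vfcoef_nth: "vfcoef u k $ i = cf u i k"
  by (simp add: vfcoef_def cf_def)

lemma fcoef_sq_cf: "fcoef_sq u k = (\<Sum>i\<in>UNIV. (cmod (cf u i k))\<^sup>2)"
  by (simp add: fcoef_sq_vec3 cf_def)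

lemma L2_vec_nth: "u \<in> L2 \<Longrightarrow> (\<lambda>x. u x $ i) \<in> L2" for u :: "real^3 \<Rightarrow> real^3"
  using L2_inner_component[of u "axis i 1"] by (simp add: inner_axis)

lemma cmod_cf_sq_le: "(cmod (cf u i k))\<^sup>2 \<le> fcoef_sq u k"
  unfolding fcoef_sq_cf by (rule member_le_sum) auto

lemma HdotM_L2: "u \<in> HdotM s \<Longrightarrow> u \<in> L2"
  by (auto simp: HdotM_def Hdot_def)

lemma HdotM_L2_nth: "u \<in> HdotM s \<Longrightarrow> (\<lambda>x. u x $ i) \<in> L2"
  by (rule L2_vec_nth[OF HdotM_L2])

lemma HdotM_supp: "u \<in> HdotM s \<Longrightarrow> k \<notin> Mfreq \<Longrightarrow> cf u i k = 0"
  by (auto simp: HdotM_def vfcoef_nth[symmetric])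

lemma HdotM_dir: "u \<in> HdotM s \<Longrightarrow> k \<in> Mfreq \<Longrightarrow> \<exists>c. \<forall>i. cf u i k = c * complex_of_real (vdir k $ i)"
  by (force simp: HdotM_def vfcoef_nth[symmetric] cvec_def)

lemma HdotM_div_free:
  assumes "u \<in> HdotM s" shows "(\<Sum>i\<in>UNIV. complex_of_int (k $ i) * cf u i k) = 0"
proof (cases "k \<in> Mfreq")
  case True
  then obtain c where c: "\<And>i. cf u i k = c * complex_of_real (vdir k $ i)"
    using HdotM_dir[OF assms] by blast
  have "(\<Sum>i\<in>UNIV. complex_of_int (k $ i) * cf u i k) = c * complex_of_real (rvec k \<bullet> vdir k)"
    by (simp add: c inner_vec_def rvec_def sum_distrib_left mult_ac)
  then show ?thesis by (simp add: rvec_inner_vdir)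
qed (simp add: HdotM_supp[OF assms])

lemma HdotM_fcoef_sq_supp: "u \<in> HdotM s \<Longrightarrow> k \<notin> Mfreq \<Longrightarrow> fcoef_sq u k = 0"
  by (simp add: fcoef_sq_cf HdotM_supp)

lemma fcoef_sq_nonneg: "0 \<le> fcoef_sq u k"
  by (simp add: fcoef_sq_def sum_nonneg)

text \<open>Separated from \<open>HdotM\<close> so that it can be applied to difference quotients
  without placing them in the constraint space.\<close>

definition H1_sum :: "(real^3 \<Rightarrow> real^3) \<Rightarrow> bool" where
  "H1_sum u \<longleftrightarrow> (\<lambda>k. lap_symbol k powr 1 * fcoef_sq u k) summable_on {k. k \<noteq> 0}"

lemma HdotM_H1: "u \<in> HdotM 1 \<Longrightarrow> H1_sum u"
  by (simp add: HdotM_def Hdot_def H1_sum_def)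

lemma H1_sum_UNIV: "H1_sum u \<Longrightarrow> (\<lambda>k. lap_symbol k * fcoef_sq u k) summable_on UNIV"
proof -
  assume "H1_sum u"
  then show ?thesis
    unfolding H1_sum_def
    by (rule summable_on_cong_neutral[THEN iffD1, rotated -1]) (auto simp: lap_symbol_def)
qed

text \<open>One term of a nonnegative convergent series is at most the sum. In this pointwise form
  the H^1 hypothesis feeds the decay estimates.\<close>

lemma Wt_cf_le_Hdot_norm:
  assumes "H1_sum u"
  shows "Wt k * cmod (cf u i k) \<le> Hdot_norm 1 u"
proof (cases "k = 0")
  case False
  have "(Wt k * cmod (cf u i k))\<^sup>2 \<le> lap_symbol k * fcoef_sq u k"
    unfolding power_mult_distrib by (intro mult_mono lap_symbol_ge cmod_cf_sq_le) auto
  also have "\<dots> \<le> (\<Sum>\<^sub>\<infinity>k\<in>{k. k \<noteq> 0}. lap_symbol k powr 1 * fcoef_sq u k)"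
    using finite_sum_le_infsum[OF assms[unfolded H1_sum_def], of "{k}"] False fcoef_sq_nonneg[of u] by auto
  finally show ?thesis
    unfolding Hdot_norm_def by (rule real_le_rsqrt)
next
  case True
  then show ?thesis
    unfolding Hdot_norm_def by (auto simp: Wt_def intro!: infsum_nonneg mult_nonneg_nonneg fcoef_sq_nonneg)
qed

lemma HdotM_pd_summable:
  assumes "u \<in> HdotM 1"
  shows "(\<lambda>k. (cmod (dsym j k * cf u i k))\<^sup>2) summable_on UNIV"
proof (rule summable_on_comparison_test[OF H1_sum_UNIV[OF HdotM_H1[OF assms]]])
  fix k
  have "(cmod (dsym j k))\<^sup>2 \<le> lap_symbol k"
  proof -
    have "(real_of_int (k $ j))\<^sup>2 \<le> (norm (rvec k))\<^sup>2"
      using component_le_norm_cart[of "rvec k" j] power_mono[of "\<bar>rvec k $ j\<bar>" "norm (rvec k)" 2]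
      by (simp add: rvec_def)
    then show ?thesis
      by (simp add: dsym_def norm_mult power_mult_distrib lap_symbol_def)
  qed
  then show "(cmod (dsym j k * cf u i k))\<^sup>2 \<le> lap_symbol k * fcoef_sq u k"
    unfolding norm_mult power_mult_distrib by (intro mult_mono cmod_cf_sq_le) auto
qed auto

lemma HdotM_pd:
  assumes "u \<in> HdotM 1"
  shows "pd j (\<lambda>x. u x $ i) \<in> L2" "fcoef (pd j (\<lambda>x. u x $ i)) k = dsym j k * cf u i k"
  using pd_properties[OF HdotM_pd_summable[OF assms, of j i, unfolded cf_def]] by (simp_all add: cf_def)

lemma abs_coef_supp_Mfreq:
  assumes "\<And>k. k \<notin> Mfreq \<Longrightarrow> c k = 0" "\<And>k. k \<in> Mfreq \<Longrightarrow> cmod (c k) \<le> f k" "f summable_on Mfreq"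
  shows "abs_coef c"
proof -
  have "(\<lambda>k. cmod (c k)) summable_on Mfreq"
    by (rule summable_on_comparison_test[OF assms(3)]) (use assms(2) in auto)
  then show ?thesis
    unfolding abs_coef_def
    by (rule summable_on_cong_neutral[THEN iffD1, rotated -1]) (use assms(1) in auto)
qed

lemma abs_coef_powr:
  assumes "\<And>k. k \<notin> Mfreq \<Longrightarrow> c k = 0" "\<And>k. k \<in> Mfreq \<Longrightarrow> cmod (c k) \<le> C * Wt k powr (- s)" "s > 0"
  shows "abs_coef c"
  by (rule abs_coef_supp_Mfreq[OF assms(1,2) summable_on_cmult_right[OF Wt_powr_summable[OF assms(3)]]])

text \<open>The pointwise H^1 bound decays like \<open>Wt k powr (- 1)\<close>, which is summable
  over the sparse set \<open>Mfreq\<close>.\<close>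

lemma HdotM_abs_coef:
  assumes "u \<in> HdotM 1" shows "abs_coef (cf u i)"
proof (rule abs_coef_powr[of _ "Hdot_norm 1 u" 1])
  fix k assume k: "k \<in> Mfreq"
  then show "cmod (cf u i k) \<le> Hdot_norm 1 u * Wt k powr (- 1)"
    using Wt_cf_le_Hdot_norm[OF HdotM_H1[OF assms], of k i] Wt_pos[OF k]
    by (simp add: powr_minus field_simps)
qed (use HdotM_supp[OF assms] in auto)

lemma L2_mult_integrable:
  assumes f: "f \<in> L2" and c: "abs_coef (fcoef f)" and g: "integrable T3 g"
  shows "integrable T3 (\<lambda>x. f x * g x)"
proof -
  have ig: "integrable T3 (\<lambda>x. complex_of_real (g x))" using g by simp
  have [measurable]: "f \<in> borel_measurable T3" "g \<in> borel_measurable T3" "fser (fcoef f) \<in> borel_measurable T3"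
    using f g bounded_T3_fser[OF c] by (auto simp: L2_def bounded_T3_def)
  have "integrable T3 (\<lambda>x. complex_of_real (f x * g x))"
    by (rule integrable_cong_AE_imp[OF fser_mult_integrable(1)[OF c ig]])
      (use L2_eq_fser[OF f c] in auto)
  then show ?thesis by (simp only: complex_of_real_integrable_eq)
qed

section \<open>The nonlinearity as a finite convolution, and its size\<close>

lemma HdotM_convect_integrable:
  assumes "u \<in> HdotM 1"
  shows "integrable T3 (\<lambda>x. u x $ j * pd j (\<lambda>x. u x $ i) x)"
  using L2_mult_integrable[OF HdotM_L2_nth[OF assms, of j] HdotM_abs_coef[OF assms, of j, unfolded cf_def]
      L2_integrable[OF HdotM_pd(1)[OF assms]]] .

text \<open>Only the velocity is expanded, its gradient being merely square integrable at this
  stage; integrating the gradient against each exponential gives its coefficient at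
  \<open>k - l\<close>, and the supports leave finitely many \<open>l\<close>.\<close>

lemma cf_convect:
  assumes u: "u \<in> HdotM 1" and k: "k \<in> Mfreq"
  shows "cf (convect u u) i k = (\<Sum>j\<in>UNIV. \<Sum>l\<in>partners k. cf u j l * (dsym j (k - l) * cf u i (k - l)))"
proof -
  have one: "fcoef (\<lambda>x. u x $ j * pd j (\<lambda>x. u x $ i) x) k = (\<Sum>l\<in>partners k. cf u j l * (dsym j (k - l) * cf u i (k - l)))" for j
  proof -
    let ?g = "pd j (\<lambda>x. u x $ i)"
    let ?G = "\<lambda>x. complex_of_real (?g x) * fexp (- k) x"
    have iG: "integrable T3 ?G"
      by (rule integrable_of_real_fexp[OF L2_integrable[OF HdotM_pd(1)[OF u]]])
    note c = HdotM_abs_coef[OF u, of j]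
    have [measurable]: "(\<lambda>x. u x $ j) \<in> borel_measurable T3" "?g \<in> borel_measurable T3" "fser (fcoef (\<lambda>x. u x $ j)) \<in> borel_measurable T3"
      using HdotM_L2_nth[OF u, of j] HdotM_pd(1)[OF u] bounded_T3_fser[OF c] by (auto simp: L2_def bounded_T3_def cf_def)
    have "fcoef (\<lambda>x. u x $ j * ?g x) k = (LINT x|T3. complex_of_real (u x $ j) * ?G x)"
      unfolding fcoef_fexp by (simp add: mult.assoc)
    also have "\<dots> = (LINT x|T3. fser (cf u j) x * ?G x)"
      using L2_eq_fser[OF HdotM_L2_nth[OF u, of j] c[unfolded cf_def]]
      by (intro integral_cong_AE) (auto simp: cf_def)
    finally have eq: "fcoef (\<lambda>x. u x $ j * ?g x) k = (LINT x|T3. fser (cf u j) x * ?G x)" .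
    have "(LINT x|T3. fexp l x * ?G x) = dsym j (k - l) * cf u i (k - l)" for l
    proof -
      have "(LINT x|T3. fexp l x * ?G x) = (LINT x|T3. complex_of_real (?g x) * fexp (- (k - l)) x)"
        using fexp_add[of l "- k"] by (intro Bochner_Integration.integral_cong) (auto simp: mult_ac)
      then show ?thesis using HdotM_pd(2)[OF u, of j i "k - l"] by (simp only: fcoef_fexp)
    qed
    then have "((\<lambda>l. cf u j l * (dsym j (k - l) * cf u i (k - l))) has_sum fcoef (\<lambda>x. u x $ j * ?g x) k) UNIV"
      using has_sum_integral_fser[OF c iG] by (simp add: eq)
    moreover have "((\<lambda>l. cf u j l * (dsym j (k - l) * cf u i (k - l))) has_sum
        (\<Sum>l\<in>partners k. cf u j l * (dsym j (k - l) * cf u i (k - l)))) UNIV"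
      by (rule has_sum_finite_neutralI[OF partners_card(1)[OF k]])
        (use HdotM_supp[OF u] in \<open>auto simp: partners_def\<close>)
    ultimately show ?thesis by (rule has_sum_unique)
  qed
  have "cf (convect u u) i k = (LINT x|T3. (\<Sum>j\<in>UNIV. complex_of_real (u x $ j * pd j (\<lambda>x. u x $ i) x) * fexp (- k) x))"
    unfolding cf_def fcoef_fexp by (simp add: convect_def sum_distrib_right)
  also have "\<dots> = (\<Sum>j\<in>UNIV. fcoef (\<lambda>x. u x $ j * pd j (\<lambda>x. u x $ i) x) k)"
    unfolding fcoef_fexp
    by (intro Bochner_Integration.integral_sum integrable_of_real_fexp HdotM_convect_integrable[OF u])
  finally show ?thesis by (simp only: one)
qed

lemma cmod_dsym_le: "k \<in> Mfreq \<Longrightarrow> cmod (dsym j k) \<le> 4 * pi * Wt k"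
  using Mfreq_component[of k j] by (simp add: dsym_def norm_mult)

text \<open>Both factors live within a factor two of the scale of \<open>k\<close>, so each bound
  transfers to \<open>Wt k\<close> at the price \<open>2 powr s\<close>, and the derivative costs at
  most \<open>8 * pi * Wt k\<close>. The factors 3 and 72 count the components \<open>j\<close> and
  the partners \<open>l\<close>.\<close>

lemma cf_convect_bound:
  assumes u: "u \<in> HdotM 1" and s: "0 \<le> s"
    and B: "\<And>l i. l \<in> Mfreq \<Longrightarrow> cmod (cf u i l) \<le> C * Wt l powr (- s)"
    and k: "k \<in> Mfreq"
  shows "cmod (cf (convect u u) i k) \<le> 3 * (72 * (8 * pi * (2 powr s)\<^sup>2 * C\<^sup>2 * Wt k powr (1 - 2 * s)))"
proof -
  have C: "0 \<le> C" 
    using order_trans[OF norm_ge_zero B[OF k]] Wt_pos[OF k] by (simp add: zero_le_mult_iff)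
  have trm: "cmod (cf u j l * (dsym j (k - l) * cf u i (k - l))) \<le> 8 * pi * (2 powr s)\<^sup>2 * C\<^sup>2 * Wt k powr (1 - 2 * s)"
    if "l \<in> partners k" for j l
  proof -
    have l: "l \<in> Mfreq" "k - l \<in> Mfreq" using that by (auto simp: partners_def)
    note W = Mfreq_interaction_Wt[OF k l] and P = Wt_pos[OF l(1)] Wt_pos[OF l(2)] Wt_pos[OF k]
    have b: "cmod (cf u j' m) \<le> 2 powr s * C * Wt k powr (- s)" if m: "m \<in> Mfreq" "Wt k \<le> 2 * Wt m" for m j'
    proof -
      have "Wt m powr (- s) \<le> (Wt k / 2) powr (- s)"
        using m Wt_pos[OF m(1)] P s by (intro powr_mono2') auto
      also have "\<dots> = 2 powr s * Wt k powr (- s)"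
        using P by (simp add: powr_divide powr_minus field_simps)
      finally have "C * Wt m powr (- s) \<le> C * (2 powr s * Wt k powr (- s))" using C by (rule mult_left_mono)
      then show ?thesis using B[OF m(1), of j'] by (simp add: mult_ac)
    qed
    have "cmod (dsym j (k - l)) \<le> 8 * pi * Wt k"
    proof -
      have "4 * pi * Wt (k - l) \<le> 4 * pi * (2 * Wt k)"
        by (intro mult_left_mono W(4)) auto
      moreover have "4 * pi * (2 * Wt k) = 8 * pi * Wt k" by simp
      ultimately show ?thesis using cmod_dsym_le[OF l(2), of j] by linarith
    qed
    then have "cmod (cf u j l * (dsym j (k - l) * cf u i (k - l))) \<le>
        (2 powr s * C * Wt k powr (- s)) * ((8 * pi * Wt k) * (2 powr s * C * Wt k powr (- s)))"
      unfolding norm_mult using b[OF l(1) W(1)] b[OF l(2) W(3)] C P by (intro mult_mono) auto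
    also have "\<dots> = 8 * pi * (2 powr s)\<^sup>2 * C\<^sup>2 * (Wt k * Wt k powr (- s) * Wt k powr (- s))"
      by (simp add: power2_eq_square mult_ac)
    also have "Wt k * Wt k powr (- s) * Wt k powr (- s) = Wt k powr (1 - 2 * s)"
      using P powr_add[of "Wt k" 1 "- s"] powr_add[of "Wt k" "1 - s" "- s"] by simp
    finally show ?thesis .
  qed
  let ?b = "8 * pi * (2 powr s)\<^sup>2 * C\<^sup>2 * Wt k powr (1 - 2 * s)"
  have "cmod (cf (convect u u) i k) \<le> (\<Sum>j\<in>(UNIV::3 set). \<Sum>l\<in>partners k. ?b)"
    unfolding cf_convect[OF u k] by (intro order_trans[OF norm_sum] sum_mono order_trans[OF norm_sum] trm) auto
  also have "\<dots> = 3 * (real (card (partners k)) * ?b)" by simp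
  also have "\<dots> \<le> 3 * (72 * ?b)"
    using partners_card(2)[OF k] by (intro mult_left_mono mult_right_mono) auto
  finally show ?thesis .
qed

definition pmc :: "(real^3 \<Rightarrow> real^3) \<Rightarrow> 3 \<Rightarrow> int^3 \<Rightarrow> complex" where
  "pmc w i k = PM_coef w k $ i"

lemma pmc_eq: "k \<in> Mfreq \<Longrightarrow> pmc w i k = (\<Sum>j\<in>UNIV. complex_of_real (vdir k $ j) * cf w j k) * complex_of_real (vdir k $ i)"
  by (simp add: pmc_def PM_coef_def vfcoef_nth cvec_def)

lemma abs_vdir_le: "\<bar>vdir k $ i\<bar> \<le> 1"
proof -
  have "norm (vdir k) \<le> 1" using norm_vdir[of k] by (cases "vdir k = 0") (auto simp: power2_eq_1_iff)
  then show ?thesis using component_le_norm_cart[of "vdir k" i] by linarith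
qed

lemma pmc_bound:
  assumes "k \<in> Mfreq" "\<And>j. cmod (cf w j k) \<le> B"
  shows "cmod (pmc w i k) \<le> 3 * B"
proof -
  have "cmod (\<Sum>j\<in>UNIV. complex_of_real (vdir k $ j) * cf w j k) \<le> (\<Sum>j\<in>(UNIV::3 set). 1 * B)"
  proof (intro order_trans[OF norm_sum] sum_mono)
    fix j
    show "cmod (complex_of_real (vdir k $ j) * cf w j k) \<le> 1 * B"
      unfolding norm_mult norm_of_real by (intro mult_mono abs_vdir_le assms(2)) auto
  qed
  then have "cmod (pmc w i k) \<le> (3 * B) * 1"
    unfolding pmc_eq[OF assms(1)] norm_mult norm_of_real
    by (intro mult_mono abs_vdir_le) (auto intro: order_trans[OF norm_ge_zero assms(2)])
  then show ?thesis by simp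
qed

section \<open>Smoothing of mild solutions\<close>

lemma cf_diff_quotient:
  assumes "u \<in> HdotM 1" "v \<in> HdotM 1" "w \<in> HdotM 1"
  shows "cf (\<lambda>x. (u x - v x) /\<^sub>R r - w x) i k = (cf u i k - cf v i k) / r - cf w i k"
proof -
  note i = assms[THEN HdotM_L2_nth, THEN L2_integrable, of i]
  have "cf (\<lambda>x. (u x - v x) /\<^sub>R r - w x) i k = fcoef (\<lambda>x. inverse r * (u x $ i - v x $ i) - w x $ i) k"
    unfolding cf_def by simp
  also have "\<dots> = fcoef (\<lambda>x. inverse r * (u x $ i - v x $ i)) k - fcoef (\<lambda>x. w x $ i) k"
    using i by (intro fcoef_diff) auto
  also have "fcoef (\<lambda>x. inverse r * (u x $ i - v x $ i)) k = inverse r * (fcoef (\<lambda>x. u x $ i) k - fcoef (\<lambda>x. v x $ i) k)"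
    unfolding fcoef_cmult fcoef_diff[OF i(1,2)] ..
  finally show ?thesis by (simp add: cf_def divide_inverse mult.commute)
qed

text \<open>Needed before a small \<open>Hdot_norm\<close> says anything: a divergent
  \<open>infsum\<close> is 0 by convention, so smallness alone would bound no coefficient.\<close>

lemma H1_sum_diff_quotient:
  assumes "u \<in> HdotM 1" "v \<in> HdotM 1" "w \<in> HdotM 1"
  shows "H1_sum (\<lambda>x. (u x - v x) /\<^sub>R r - w x)"
proof -
  let ?D = "\<lambda>x. (u x - v x) /\<^sub>R r - w x"
  have sq: "(cmod ((a - b) / complex_of_real r - c))\<^sup>2 \<le> 3 * (inverse r)\<^sup>2 * (cmod a)\<^sup>2 + 3 * (inverse r)\<^sup>2 * (cmod b)\<^sup>2 + 3 * (cmod c)\<^sup>2" for a b c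
  proof -
    define x y z where "x = cmod (a / r)" and "y = cmod (b / r)" and "z = cmod c"
    have "cmod ((a - b) / complex_of_real r - c) \<le> x + y + z"
      unfolding x_def y_def z_def diff_divide_distrib by (intro order_trans[OF norm_triangle_ineq4] add_mono) auto
    then have "(cmod ((a - b) / complex_of_real r - c))\<^sup>2 \<le> (x + y + z)\<^sup>2" by (rule power_mono) simp
    also have "\<dots> \<le> 3 * x\<^sup>2 + 3 * y\<^sup>2 + 3 * z\<^sup>2"
      using sum_squares_ge_zero[of "x - y" "y - z"] zero_le_square[of "x - z"]
      by (simp add: power2_eq_square algebra_simps)
    also have "\<dots> = 3 * (inverse r)\<^sup>2 * (cmod a)\<^sup>2 + 3 * (inverse r)\<^sup>2 * (cmod b)\<^sup>2 + 3 * (cmod c)\<^sup>2"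
      unfolding x_def y_def z_def norm_divide power_divide norm_of_real power2_abs
      by (simp add: divide_inverse power_inverse mult.commute)
    finally show ?thesis .
  qed
  let ?b = "\<lambda>k. 3 * (inverse r)\<^sup>2 * (lap_symbol k * fcoef_sq u k) + 3 * (inverse r)\<^sup>2 * (lap_symbol k * fcoef_sq v k)
     + 3 * (lap_symbol k * fcoef_sq w k)"
  have "?b summable_on UNIV"
    using assms by (intro summable_on_add summable_on_cmult_right H1_sum_UNIV HdotM_H1)
  then have "(\<lambda>k. lap_symbol k powr 1 * fcoef_sq ?D k) summable_on UNIV"
  proof (rule summable_on_comparison_test)
    fix k
    have "fcoef_sq ?D k \<le> (\<Sum>i\<in>UNIV. 3 * (inverse r)\<^sup>2 * (cmod (cf u i k))\<^sup>2 + 3 * (inverse r)\<^sup>2 * (cmod (cf v i k))\<^sup>2 + 3 * (cmod (cf w i k))\<^sup>2)"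
      unfolding fcoef_sq_cf[of ?D] cf_diff_quotient[OF assms] by (intro sum_mono sq)
    also have "\<dots> = 3 * (inverse r)\<^sup>2 * fcoef_sq u k + 3 * (inverse r)\<^sup>2 * fcoef_sq v k + 3 * fcoef_sq w k"
      by (simp add: fcoef_sq_cf sum.distrib sum_distrib_left)
    finally have "lap_symbol k * fcoef_sq ?D k \<le> lap_symbol k * (3 * (inverse r)\<^sup>2 * fcoef_sq u k + 3 * (inverse r)\<^sup>2 * fcoef_sq v k + 3 * fcoef_sq w k)"
      by (rule mult_left_mono) simp
    then show "lap_symbol k powr 1 * fcoef_sq ?D k \<le> ?b k"
      by (simp add: algebra_simps)
  qed (auto intro: mult_nonneg_nonneg fcoef_sq_nonneg)
  then show ?thesis
    unfolding H1_sum_def by (rule summable_on_subset_banach) auto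
qed

text \<open>A single term x^n / n! of the exponential series is at most exp x; it suffices to take
  \<open>n\<close> so large that \<open>\<beta> * n\<close> reaches \<open>r\<close>.\<close>

lemma exp_decay_powr:
  assumes "y > 0" "\<beta> > 0"
  shows "\<exists>C. \<forall>W::real. 1 \<le> W \<longrightarrow> exp (- y * W powr \<beta>) \<le> C * W powr (- r)"
proof -
  obtain n :: nat where "r / \<beta> \<le> real n"
    using real_arch_simple by blast
  then have n: "r \<le> \<beta> * real n"
    using assms by (simp add: pos_divide_le_eq mult.commute)
  have "exp (- y * W powr \<beta>) \<le> (fact n / y ^ n) * W powr (- r)" if W: "1 \<le> W" for W :: real
  proof -
    define x where "x = y * W powr \<beta>"
    have x: "x > 0" using assms W by (simp add: x_def)
    have "x ^ n / fact n \<le> exp x"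
      using sum_le_suminf[OF summable_exp_generic[of x], of "{n}"] x by (simp add: exp_def divide_inverse mult.commute)
    then have "exp (- x) \<le> fact n / x ^ n"
      using x by (simp add: exp_minus field_simps)
    also have "x ^ n = y ^ n * W powr (\<beta> * real n)"
      using W by (simp add: x_def power_mult_distrib powr_powr[symmetric] powr_realpow)
    also have "fact n / (y ^ n * W powr (\<beta> * real n)) = (fact n / y ^ n) * W powr (- (\<beta> * real n))"
      by (simp add: powr_minus field_simps)
    also have "\<dots> \<le> (fact n / y ^ n) * W powr (- r)"
      using assms W n by (intro mult_left_mono powr_mono) auto
    finally show ?thesis by (simp add: x_def)
  qed
  then show ?thesis by blast
qed

locale mild_C1 =
  fixes \<nu> \<alpha> :: real and Tmax :: ereal and u :: "real \<Rightarrow> real^3 \<Rightarrow> real^3"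
  assumes nu: "\<nu> > 0" and alpha: "\<alpha> > 0"
    and C1: "u \<in> C1_HdotM1 Tmax"
    and mild: "mild_solution \<nu> \<alpha> Tmax u"
begin

abbreviation "c i k t \<equiv> cf (u t) i k"

definition lam :: "int^3 \<Rightarrow> real" where "lam k = lap_symbol k powr \<alpha>"

definition P :: "3 \<Rightarrow> int^3 \<Rightarrow> real \<Rightarrow> complex" where
  "P i k t = pmc (convect (u t) (u t)) i k"

lemma in_HdotM: "t \<in> time_dom Tmax \<Longrightarrow> u t \<in> HdotM 1"
  using C1 by (auto simp: C1_HdotM1_def)

lemma lam_ge: "k \<in> Mfreq \<Longrightarrow> Wt k powr (2 * \<alpha>) \<le> lam k"
proof -
  assume k: "k \<in> Mfreq"
  have "Wt k powr (2 * \<alpha>) = ((Wt k)\<^sup>2) powr \<alpha>"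
    using Wt_pos[OF k] by (simp add: powr_powr[symmetric])
  also have "\<dots> \<le> lam k"
    unfolding lam_def using lap_symbol_ge alpha by (intro powr_mono2) auto
  finally show ?thesis .
qed

lemma lam_pos: "k \<in> Mfreq \<Longrightarrow> 0 < lam k"
  using lam_ge[of k] Wt_pos[of k] by (smt (verit) powr_gt_zero)

text \<open>Near \<open>t\<close> the difference quotient is within 1 of the derivative in H^1,
  which bounds all coefficients at once. That \<open>d\<close> and \<open>L\<close> depend on
  neither \<open>k\<close> nor \<open>i\<close> is what the later gluing requires.\<close>

lemma local_Lipschitz:
  assumes t: "t \<in> time_dom Tmax"
  shows "\<exists>d>0. \<exists>L. \<forall>s\<in>time_dom Tmax. \<bar>s - t\<bar> < d \<longrightarrow> (\<forall>k i. Wt k * cmod (c i k s - c i k t) \<le> L * \<bar>s - t\<bar>)"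
proof -
  obtain u' where u': "u' \<in> HdotM 1"
    and lim: "((\<lambda>s. Hdot_norm 1 (\<lambda>x. (u s x - u t x) /\<^sub>R (s - t) - u' x)) \<longlongrightarrow> 0) (at t within time_dom Tmax)"
    using C1 t by (auto simp: C1_HdotM1_def)
  have "\<forall>\<^sub>F s in at t within time_dom Tmax. Hdot_norm 1 (\<lambda>x. (u s x - u t x) /\<^sub>R (s - t) - u' x) < 1"
    by (rule order_tendstoD(2)[OF lim]) simp
  then obtain d where d: "d > 0"
    and dd: "\<And>s. s \<in> time_dom Tmax \<Longrightarrow> s \<noteq> t \<Longrightarrow> dist s t < d \<Longrightarrow> Hdot_norm 1 (\<lambda>x. (u s x - u t x) /\<^sub>R (s - t) - u' x) < 1"
    by (auto simp: eventually_at)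
  have "Wt k * cmod (c i k s - c i k t) \<le> (1 + Hdot_norm 1 u') * \<bar>s - t\<bar>"
    if s: "s \<in> time_dom Tmax" "\<bar>s - t\<bar> < d" for s k i
  proof (cases "s = t")
    case False
    let ?D = "\<lambda>x. (u s x - u t x) /\<^sub>R (s - t) - u' x"
    note H = in_HdotM[OF s(1)] in_HdotM[OF t] u'
    have "Wt k * cmod (cf ?D i k) \<le> 1"
      using Wt_cf_le_Hdot_norm[OF H1_sum_diff_quotient[OF H], of k "s - t" i] dd[OF s(1) False] s(2)
      by (simp add: dist_real_def)
    moreover have "Wt k * cmod (cf u' i k) \<le> Hdot_norm 1 u'"
      by (rule Wt_cf_le_Hdot_norm[OF HdotM_H1[OF u']])
    ultimately have "Wt k * cmod (cf ?D i k) + Wt k * cmod (cf u' i k) \<le> 1 + Hdot_norm 1 u'"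
      by (rule add_mono)
    moreover have "cmod (cf ?D i k + cf u' i k) \<le> cmod (cf ?D i k) + cmod (cf u' i k)"
      by (rule norm_triangle_ineq)
    then have "Wt k * cmod (cf ?D i k + cf u' i k) \<le> Wt k * (cmod (cf ?D i k) + cmod (cf u' i k))"
      by (rule mult_left_mono) (simp add: Wt_def)
    ultimately have *: "Wt k * cmod (cf ?D i k + cf u' i k) \<le> 1 + Hdot_norm 1 u'"
      by (simp add: distrib_left)
    have "c i k s - c i k t = (cf ?D i k + cf u' i k) * complex_of_real (s - t)"
      using False by (simp add: cf_diff_quotient[OF H])
    then have "Wt k * cmod (c i k s - c i k t) = Wt k * cmod (cf ?D i k + cf u' i k) * \<bar>s - t\<bar>"
      by (simp only: norm_mult norm_of_real mult.assoc)
    also have "\<dots> \<le> (1 + Hdot_norm 1 u') * \<bar>s - t\<bar>"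
      by (rule mult_right_mono[OF *]) simp
    finally show ?thesis .
  qed simp
  with d show ?thesis by blast
qed

lemma Wt_nonneg: "0 \<le> Wt k"
  by (simp add: Wt_def)

lemma continuous_cf: "continuous_on (time_dom Tmax) (c i k)"
  unfolding continuous_on_def
proof
  fix t assume t: "t \<in> time_dom Tmax"
  show "(c i k \<longlongrightarrow> c i k t) (at t within time_dom Tmax)"
  proof (cases "k \<in> Mfreq")
    case True
    obtain d L where d: "d > 0" "\<And>s. s \<in> time_dom Tmax \<Longrightarrow> \<bar>s - t\<bar> < d \<Longrightarrow> Wt k * cmod (c i k s - c i k t) \<le> L * \<bar>s - t\<bar>"
      using local_Lipschitz[OF t] by blast
    have "((\<lambda>s. L * \<bar>s - t\<bar>) \<longlongrightarrow> L * \<bar>t - t\<bar>) (at t within time_dom Tmax)"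
      by (intro tendsto_intros)
    then have lim: "((\<lambda>s. L * \<bar>s - t\<bar>) \<longlongrightarrow> 0) (at t within time_dom Tmax)" by simp
    have "((\<lambda>s. c i k s - c i k t) \<longlongrightarrow> 0) (at t within time_dom Tmax)"
    proof (rule Lim_null_comparison[OF _ lim])
      have "cmod (c i k s - c i k t) \<le> L * \<bar>s - t\<bar>" if "s \<in> time_dom Tmax" "\<bar>s - t\<bar> < d" for s
        using d(2)[OF that] mult_right_mono[OF Wt_pos[OF True], of "cmod (c i k s - c i k t)"] by simp
      then show "\<forall>\<^sub>F s in at t within time_dom Tmax. cmod (c i k s - c i k t) \<le> L * \<bar>s - t\<bar>"
        unfolding eventually_at using d(1) by (auto simp: dist_real_def)
    qed
    then show ?thesis by (rule LIM_zero_cancel)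
  next
    case False
    have "\<forall>\<^sub>F s in at t within time_dom Tmax. c i k s = c i k t"
      unfolding eventually_at using HdotM_supp[OF in_HdotM False] t by (auto intro: exI[of _ 1])
    then show ?thesis by (rule tendsto_eventually)
  qed
qed

lemma time_dom_mono: "0 \<le> s \<Longrightarrow> s \<le> b \<Longrightarrow> b \<in> time_dom Tmax \<Longrightarrow> s \<in> time_dom Tmax"
  by (auto simp: time_dom_def) (meson ereal_less_eq(3) le_less_trans)

text \<open>Compactness of the time interval, in the form of bisection: the local bounds hold for
  all frequencies simultaneously, and adjacent ones combine by taking a maximum.\<close>

lemma uniform_H1_bound:
  assumes b: "b \<in> time_dom Tmax"
  shows "\<exists>C. \<forall>t\<in>{0..b}. \<forall>k i. Wt k * cmod (c i k t) \<le> C"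
proof -
  \<comment> \<open>The intersection with \<open>{0..b}\<close> is needed because the small
    intervals tested by \<open>Bolzano\<close> may reach beyond the ends, where nothing is known
    about \<open>u\<close>.\<close>
  define Q where "Q x y \<longleftrightarrow> (\<exists>C. \<forall>t\<in>{x..y} \<inter> {0..b}. \<forall>k i. Wt k * cmod (c i k t) \<le> C)" for x y
  have "Q 0 b"
  proof (rule Bolzano)
    show "0 \<le> b" using b by (simp add: time_dom_def)
    fix x y z assume "Q x y" "Q y z" "x \<le> y" "y \<le> z"
    then obtain C C' where "\<forall>t\<in>{x..y} \<inter> {0..b}. \<forall>k i. Wt k * cmod (c i k t) \<le> C"
      "\<forall>t\<in>{y..z} \<inter> {0..b}. \<forall>k i. Wt k * cmod (c i k t) \<le> C'" unfolding Q_def by blast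
    then have "\<forall>t\<in>{x..z} \<inter> {0..b}. \<forall>k i. Wt k * cmod (c i k t) \<le> max C C'"
      using \<open>x \<le> y\<close> \<open>y \<le> z\<close> by (metis IntE IntI atLeastAtMost_iff le_cases max.coboundedI1 max.coboundedI2)
    then show "Q x z" unfolding Q_def by blast
  next
    fix x assume x: "0 \<le> x" "x \<le> b"
    then have xd: "x \<in> time_dom Tmax" using b time_dom_mono by blast
    obtain d L where d: "d > 0" "\<And>s k i. s \<in> time_dom Tmax \<Longrightarrow> \<bar>s - x\<bar> < d \<Longrightarrow> Wt k * cmod (c i k s - c i k x) \<le> L * \<bar>s - x\<bar>"
      using local_Lipschitz[OF xd] by blast
    have "Wt k * cmod (c i k t) \<le> \<bar>L\<bar> * d + Hdot_norm 1 (u x)" if "t \<in> {0..b}" "\<bar>t - x\<bar> < d" for t k i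
    proof -
      have td: "t \<in> time_dom Tmax" using that b time_dom_mono by auto
      have "Wt k * cmod (c i k t) \<le> Wt k * (cmod (c i k t - c i k x) + cmod (c i k x))"
        using norm_triangle_ineq[of "c i k t - c i k x" "c i k x"] by (intro mult_left_mono Wt_nonneg) simp
      moreover have "L * \<bar>t - x\<bar> \<le> \<bar>L\<bar> * d"
        using that by (intro mult_mono) auto
      ultimately show ?thesis
        using d(2)[OF td that(2), of k i] Wt_cf_le_Hdot_norm[OF HdotM_H1[OF in_HdotM[OF xd]], of k i]
        by (simp add: distrib_left)
    qed
    then have "\<forall>p q. p \<le> x \<and> x \<le> q \<and> q - p < d \<longrightarrow> Q p q"
      unfolding Q_def by (intro allI impI exI[of _ "\<bar>L\<bar> * d + Hdot_norm 1 (u x)"]) auto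
    then show "\<exists>d>0. \<forall>p q. p \<le> x \<and> x \<le> q \<and> q - p < d \<longrightarrow> Q p q"
      using d(1) by blast
  qed
  then show ?thesis by (auto simp: Q_def)
qed

lemma P_eq:
  assumes "t \<in> time_dom Tmax" "k \<in> Mfreq"
  shows "P i k t = (\<Sum>i'\<in>UNIV. complex_of_real (vdir k $ i') *
     (\<Sum>j\<in>UNIV. \<Sum>l\<in>partners k. c j l t * (dsym j (k - l) * c i' (k - l) t))) * complex_of_real (vdir k $ i)"
  by (simp add: P_def pmc_eq[OF assms(2)] cf_convect[OF in_HdotM[OF assms(1)] assms(2)])

text \<open>The convolution is finite, so continuity of the individual coefficients suffices and no
  uniformity in the frequency is involved.\<close>

lemma continuous_P:
  assumes "k \<in> Mfreq" shows "continuous_on (time_dom Tmax) (P i k)"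
proof -
  have "continuous_on (time_dom Tmax) (\<lambda>t. (\<Sum>i'\<in>UNIV. complex_of_real (vdir k $ i') *
     (\<Sum>j\<in>UNIV. \<Sum>l\<in>partners k. c j l t * (dsym j (k - l) * c i' (k - l) t))) * complex_of_real (vdir k $ i))"
    by (intro continuous_intros continuous_cf)
  then show ?thesis
    by (rule continuous_on_cong[THEN iffD1, rotated -1]) (auto simp: P_eq[OF _ assms])
qed

lemma mild_component:
  assumes t: "t \<in> time_dom Tmax"
  shows "((\<lambda>\<tau>. exp (- \<nu> * (t - \<tau>) * lam k) *\<^sub>R P i k \<tau>) has_integral
      (exp (- \<nu> * t * lam k) *\<^sub>R c i k 0 - c i k t)) {0..t}"
proof -
  let ?d = "\<lambda>\<tau>. exp (- \<nu> * (t - \<tau>) * lap_symbol k powr \<alpha>) *\<^sub>R PM_coef (convect (u \<tau>) (u \<tau>)) k"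
  have 1: "?d integrable_on {0..t}"
    and 2: "vfcoef (u t) k = exp (- \<nu> * t * lap_symbol k powr \<alpha>) *\<^sub>R vfcoef (u 0) k - integral {0..t} ?d"
    using mild t unfolding mild_solution_def Let_def by blast+
  have "((\<lambda>z. z $ i) \<circ> ?d has_integral (integral {0..t} ?d) $ i) {0..t}"
    by (rule has_integral_linear[OF integrable_integral[OF 1] bounded_linear_vec_nth])
  moreover have "(integral {0..t} ?d) $ i = exp (- \<nu> * t * lam k) *\<^sub>R c i k 0 - c i k t"
    using 2 by (simp add: vfcoef_nth[symmetric] lam_def)
  ultimately show ?thesis
    by (simp add: o_def P_def pmc_def lam_def)
qed

end

lemma ereal_less_dense: "ereal t < T \<Longrightarrow> \<exists>b>t. ereal b < T"
proof (cases T)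
  case (real r)
  assume "ereal t < T"
  then show ?thesis using real by (intro exI[of _ "(t + r) / 2"]) (auto simp: field_simps)
next
  case PInf
  then show ?thesis by (intro exI[of _ "t + 1"]) auto
qed auto

text \<open>The Weierstrass test applied to the differentiated series, along an enumeration of the
  lattice.\<close>

lemma has_real_derivative_infsum:
  fixes f f' :: "int^3 \<Rightarrow> real \<Rightarrow> real"
  assumes ab: "a < t" "t < b"
    and deriv: "\<And>k s. s \<in> {a..b} \<Longrightarrow> (f k has_real_derivative f' k s) (at s)"
    and bound: "\<And>k s. s \<in> {a..b} \<Longrightarrow> \<bar>f' k s\<bar> \<le> B k" and B: "B summable_on UNIV"
    and sum: "\<And>s. s \<in> {a..b} \<Longrightarrow> (\<lambda>k. f k s) summable_on UNIV"
  shows "((\<lambda>s. \<Sum>\<^sub>\<infinity>k. f k s) has_real_derivative (\<Sum>\<^sub>\<infinity>k. f' k t)) (at t)"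
proof -
  obtain e :: "nat \<Rightarrow> int^3" where e: "bij e" using ex_enumeration_int3 by blast
  have conv: "(\<lambda>n. g (e n)) sums (\<Sum>\<^sub>\<infinity>k. g k)" if "g summable_on UNIV" for g :: "int^3 \<Rightarrow> real"
    using has_sum_infsum[OF that] by (intro has_sum_imp_sums) (subst has_sum_reindex_bij_betw[OF e])
  have Bs: "summable (\<lambda>n. B (e n))" using conv[OF B] by (rule sums_summable)
  have uc: "uniformly_convergent_on {a..b} (\<lambda>n s. \<Sum>i<n. f' (e i) s)"
    by (rule Weierstrass_m_test'[OF _ Bs]) (use bound in auto)
  have t: "t \<in> {a..b}" "t \<in> interior {a..b}" using ab by auto
  have "((\<lambda>s. \<Sum>n. f (e n) s) has_real_derivative (\<Sum>n. f' (e n) t)) (at t)"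
    using conv[OF sum[OF t(1)]] deriv
    by (intro has_field_derivative_series'(2)[OF _ _ uc t(1) _ t(2)])
      (auto intro: sums_summable DERIV_subset has_field_derivative_at_within)
  moreover have "(\<lambda>k. f' k t) summable_on UNIV"
    using bound[OF t(1)] by (intro abs_summable_summable[OF summable_on_comparison_test[OF B]]) auto
  then have "(\<Sum>n. f' (e n) t) = (\<Sum>\<^sub>\<infinity>k. f' k t)"
    using sums_unique[OF conv, of "\<lambda>k. f' k t"] by simp
  moreover have "(\<Sum>n. f (e n) s) = (\<Sum>\<^sub>\<infinity>k. f k s)" if "s \<in> {a<..<b}" for s
    using sums_unique[OF conv[OF sum[of s]]] that by auto
  ultimately show ?thesis
    using ab by (auto intro: has_field_derivative_transform_within_open[of _ _ _ "{a<..<b}"])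
qed

section \<open>The bootstrap and the differential equation for each mode\<close>

context mild_C1
begin

text \<open>The constant may depend on the time interval but not on the time, frequency or
  component. Uniformity in time lets the bound pass under the Duhamel integral, and later under a
  termwise derivative.\<close>

definition decay :: "real \<Rightarrow> bool" where
  "decay s \<longleftrightarrow> (\<forall>a b. 0 < a \<longrightarrow> a \<le> b \<longrightarrow> ereal b < Tmax \<longrightarrow>
     (\<exists>C. \<forall>t\<in>{a..b}. \<forall>k\<in>Mfreq. \<forall>i. cmod (c i k t) \<le> C * Wt k powr (- s)))"

text \<open>Unlike \<open>decay\<close>, this bound reaches time 0; it controls the early part of
  the Duhamel integral and the initial value.\<close>

lemma bound_1:
  assumes b: "b \<in> time_dom Tmax"
  shows "\<exists>C. \<forall>t\<in>{0..b}. \<forall>k\<in>Mfreq. \<forall>i. cmod (c i k t) \<le> C * Wt k powr (- 1)"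
proof -
  obtain C where C: "\<And>t k i. t \<in> {0..b} \<Longrightarrow> Wt k * cmod (c i k t) \<le> C"
    using uniform_H1_bound[OF b] by blast
  have "cmod (c i k t) \<le> C * Wt k powr (- 1)" if "t \<in> {0..b}" "k \<in> Mfreq" for t k i
    using C[OF that(1), of k i] Wt_pos[OF that(2)] by (simp add: powr_minus field_simps)
  then show ?thesis by blast
qed

lemma decay_1: "decay 1"
  unfolding decay_def
proof (intro allI impI)
  fix a b :: real assume ab: "0 < a" "a \<le> b" "ereal b < Tmax"
  then obtain C where "\<forall>t\<in>{0..b}. \<forall>k\<in>Mfreq. \<forall>i. cmod (c i k t) \<le> C * Wt k powr (- 1)"
    using bound_1[of b] by (auto simp: time_dom_def)
  then show "\<exists>C. \<forall>t\<in>{a..b}. \<forall>k\<in>Mfreq. \<forall>i. cmod (c i k t) \<le> C * Wt k powr (- 1)"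
    using ab by (intro exI[of _ C]) auto
qed

text \<open>The number 5184 is 3 * 3 * 72 * 8: the sum inside the projection, the components, the
  partners, and the constant of the derivative.\<close>

lemma P_bound:
  assumes t: "t \<in> time_dom Tmax" and s: "0 \<le> s" and k: "k \<in> Mfreq"
    and B: "\<And>l i. l \<in> Mfreq \<Longrightarrow> cmod (c i l t) \<le> C * Wt l powr (- s)"
  shows "cmod (P i k t) \<le> (5184 * pi * (2 powr s)\<^sup>2 * C\<^sup>2) * Wt k powr (1 - 2 * s)"
proof -
  have "cmod (P i k t) \<le> 3 * (3 * (72 * (8 * pi * (2 powr s)\<^sup>2 * C\<^sup>2 * Wt k powr (1 - 2 * s))))"
    unfolding P_def by (rule pmc_bound[OF k cf_convect_bound[OF in_HdotM[OF t] s B k]])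
  also have "\<dots> = (5184 * pi * (2 powr s)\<^sup>2 * C\<^sup>2) * Wt k powr (1 - 2 * s)" by simp
  finally show ?thesis .
qed

text \<open>The Duhamel integral is treated differently before and after \<open>a / 2\<close>. Early
  times are at distance at least \<open>a / 2\<close> from \<open>t\<close>, so the kernel is
  exponentially small and a crude bound on the nonlinearity suffices. At late times the hypothesis
  gives the exponent 1 - 2s, which is at most -s because s \<ge> 1, and integrating the kernel gains
  \<open>1 / (\<nu> * lam k)\<close>, that is, 2 \<alpha> powers.\<close>

lemma decay_step:
  assumes s: "1 \<le> s" and decay: "decay s"
  shows "decay (s + 2 * \<alpha>)"
  unfolding decay_def
proof (intro allI impI)
  fix a b :: real assume ab: "0 < a" "a \<le> b" "ereal b < Tmax"
  have bd: "b \<in> time_dom Tmax" using ab by (simp add: time_dom_def)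
  have td: "t \<in> time_dom Tmax" if "t \<in> {0..b}" for t
    using that time_dom_mono[OF _ _ bd] by auto
  let ?r = "s + 2 * \<alpha>"
  obtain C1' where C1': "\<forall>t\<in>{0..b}. \<forall>k\<in>Mfreq. \<forall>i. cmod (c i k t) \<le> C1' * Wt k powr (- 1)"
    using bound_1[OF bd] by blast
  define C1 where "C1 = max 0 C1'"
  have C1: "C1 \<ge> 0" by (simp add: C1_def)
  have C1b: "cmod (c i k t) \<le> C1 * Wt k powr (- 1)" if "t \<in> {0..b}" "k \<in> Mfreq" for t k i
  proof -
    have "cmod (c i k t) \<le> C1' * Wt k powr (- 1)" using C1' that by blast
    also have "\<dots> \<le> C1 * Wt k powr (- 1)" by (intro mult_right_mono) (auto simp: C1_def)
    finally show ?thesis .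
  qed
  have "0 < a / 2" "a / 2 \<le> b" using ab by auto
  then obtain Cs where "\<forall>t\<in>{a/2..b}. \<forall>k\<in>Mfreq. \<forall>i. cmod (c i k t) \<le> Cs * Wt k powr (- s)"
    using decay ab(3) unfolding decay_def by blast
  then have Cs: "cmod (c i k t) \<le> Cs * Wt k powr (- s)" if "t \<in> {a/2..b}" "k \<in> Mfreq" for t k i
    using that by blast
  define K1 where "K1 = 5184 * pi * (2 powr 1)\<^sup>2 * C1\<^sup>2"
  define Ks where "Ks = 5184 * pi * (2 powr s)\<^sup>2 * Cs\<^sup>2"
  have K: "K1 \<ge> 0" "Ks \<ge> 0" by (simp_all add: K1_def Ks_def)
  have P1: "cmod (P i k \<tau>) \<le> K1" if "\<tau> \<in> {0..b}" "k \<in> Mfreq" for \<tau> k i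
  proof -
    have "cmod (P i k \<tau>) \<le> K1 * Wt k powr (1 - 2 * 1)"
      unfolding K1_def by (rule P_bound[OF td[OF that(1)] _ that(2) C1b[OF that(1)]]) auto
    also have "\<dots> \<le> K1 * 1"
      using K Wt_pos[OF that(2)] by (intro mult_left_mono) (auto simp: powr_minus field_simps)
    finally show ?thesis by simp
  qed
  have Ps: "cmod (P i k \<tau>) \<le> Ks * Wt k powr (1 - 2 * s)" if "\<tau> \<in> {a/2..b}" "k \<in> Mfreq" for \<tau> k i
    unfolding Ks_def using s that ab by (intro P_bound[OF td _ that(2) Cs[OF that(1)]]) auto
  \<comment> \<open>Across a time gap \<open>a / 2\<close> the kernel is exponentially small in a
    power of \<open>Wt k\<close>, hence below the target rate \<open>?r\<close>.\<close>
  obtain Ce where Ce: "\<And>W::real. 1 \<le> W \<Longrightarrow> exp (- (\<nu> * a / 2) * W powr (2 * \<alpha>)) \<le> Ce * W powr (- ?r)"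
    using exp_decay_powr[of "\<nu> * a / 2" "2 * \<alpha>" ?r] nu alpha ab by auto
  let ?C = "Ce * C1 + b * (Ce * K1) + Ks / \<nu>"
  have "cmod (c i k t) \<le> ?C * Wt k powr (- ?r)" if t: "t \<in> {a..b}" and k: "k \<in> Mfreq" for t k i
  proof -
    note W = Wt_pos[OF k]
    let ?W = "Wt k powr (- ?r)"
    have t0: "t \<in> {0..b}" "0 < t" using t ab by auto
    define E where "E = exp (- (\<nu> * a / 2) * lam k)"
    have "- (\<nu> * a / 2) * lam k \<le> - (\<nu> * a / 2) * Wt k powr (2 * \<alpha>)"
      using lam_ge[OF k] nu ab by (intro mult_left_mono_neg) auto
    then have E: "0 \<le> E" "E \<le> Ce * ?W"
      using Ce[OF W] unfolding E_def by (auto intro: order_trans[of _ "exp (- (\<nu> * a / 2) * Wt k powr (2 * \<alpha>))"])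
    let ?f = "\<lambda>\<tau>. exp (- \<nu> * (t - \<tau>) * lam k) *\<^sub>R P i k \<tau>"
    \<comment> \<open>The sum of the early and the late majorant, used on the whole of
      \<open>{0..t}\<close>, so that the integral itself is never split.\<close>
    let ?g = "\<lambda>\<tau>. E * K1 + exp (- \<nu> * (t - \<tau>) * lam k) * (Ks * Wt k powr (1 - 2 * s))"
    note f = mild_component[OF td[OF t0(1)], of k i]
    have vl: "\<nu> * lam k > 0" using nu lam_pos[OF k] by simp
    have "((\<lambda>\<tau>. exp (- \<nu> * (t - \<tau>) * lam k)) has_integral
        (exp (- \<nu> * (t - t) * lam k) / (\<nu> * lam k) - exp (- \<nu> * (t - 0) * lam k) / (\<nu> * lam k))) {0..t}"
      using vl t0
      by (intro fundamental_theorem_of_calculus)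
        (auto simp flip: has_real_derivative_iff_has_vector_derivative intro!: derivative_eq_intros)
    then have g: "(?g has_integral (t * (E * K1) + (1 / (\<nu> * lam k) - exp (- \<nu> * t * lam k) / (\<nu> * lam k)) * (Ks * Wt k powr (1 - 2 * s)))) {0..t}"
      using t0 has_integral_const_real[of "E * K1" 0 t]
      by (intro has_integral_add has_integral_mult_left) auto
    have fg: "norm (?f \<tau>) \<le> ?g \<tau>" if "\<tau> \<in> {0..t}" for \<tau>
    proof -
      have tau: "\<tau> \<in> {0..b}" using that t by auto
      show ?thesis
      proof (cases "\<tau> \<le> a / 2")
        case True
        then have "(\<nu> * a / 2) * lam k \<le> \<nu> * (t - \<tau>) * lam k"
          using t nu lam_pos[OF k] by (intro mult_right_mono) auto
        then have "exp (- \<nu> * (t - \<tau>) * lam k) \<le> E" by (simp add: E_def)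
        then have "norm (?f \<tau>) \<le> E * K1"
          using P1[OF tau k, of i] E by (simp add: mult_mono)
        then show ?thesis using K by (simp add: add_increasing2)
      next
        case False
        then have "norm (?f \<tau>) \<le> exp (- \<nu> * (t - \<tau>) * lam k) * (Ks * Wt k powr (1 - 2 * s))"
          using Ps[OF _ k, of \<tau> i] tau by simp
        then show ?thesis using E K by (simp add: add_increasing)
      qed
    qed
    have "norm (integral {0..t} ?f) \<le> integral {0..t} ?g"
      using f g fg by (intro integral_norm_bound_integral) (auto dest: has_integral_integrable)
    then have I: "norm (exp (- \<nu> * t * lam k) *\<^sub>R c i k 0 - c i k t) \<le>
        t * (E * K1) + (1 / (\<nu> * lam k) - exp (- \<nu> * t * lam k) / (\<nu> * lam k)) * (Ks * Wt k powr (1 - 2 * s))"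
      using integral_unique[OF f] integral_unique[OF g] by simp
    also have "\<dots> \<le> b * (Ce * ?W * K1) + Ks / \<nu> * ?W"
    proof (rule add_mono)
      have "E * K1 \<le> Ce * ?W * K1" using E K by (intro mult_right_mono) auto
      then show "t * (E * K1) \<le> b * (Ce * ?W * K1)"
        using t0 E K by (intro mult_mono) auto
      have "(1 / (\<nu> * lam k) - exp (- \<nu> * t * lam k) / (\<nu> * lam k)) \<le> 1 / (\<nu> * lam k)"
        using vl by simp
      also have "\<dots> \<le> 1 / (\<nu> * Wt k powr (2 * \<alpha>))"
        using lam_ge[OF k] nu W vl by (intro divide_left_mono mult_left_mono) (auto intro!: mult_pos_pos)
      also have "\<dots> = 1 / \<nu> * Wt k powr (- (2 * \<alpha>))" by (simp add: powr_minus field_simps)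
      finally have "(1 / (\<nu> * lam k) - exp (- \<nu> * t * lam k) / (\<nu> * lam k)) * (Ks * Wt k powr (1 - 2 * s))
         \<le> (1 / \<nu> * Wt k powr (- (2 * \<alpha>))) * (Ks * Wt k powr (1 - 2 * s))"
        using K by (intro mult_right_mono) auto
      also have "\<dots> = Ks / \<nu> * Wt k powr (1 - 2 * s - 2 * \<alpha>)"
        using W powr_add[of "Wt k" "- (2 * \<alpha>)" "1 - 2 * s"] by (simp add: mult_ac)
      also have "\<dots> \<le> Ks / \<nu> * ?W"
        using W s K nu by (intro mult_left_mono powr_mono) auto
      finally show "(1 / (\<nu> * lam k) - exp (- \<nu> * t * lam k) / (\<nu> * lam k)) * (Ks * Wt k powr (1 - 2 * s)) \<le> Ks / \<nu> * ?W" .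
    qed
    finally have I': "norm (exp (- \<nu> * t * lam k) *\<^sub>R c i k 0 - c i k t) \<le> b * (Ce * ?W * K1) + Ks / \<nu> * ?W" .
    have "exp (- \<nu> * t * lam k) \<le> E"
    proof -
      have "(\<nu> * a / 2) * lam k \<le> \<nu> * t * lam k"
        using t nu ab lam_pos[OF k] by (intro mult_right_mono) auto
      then show ?thesis by (simp add: E_def)
    qed
    moreover have "cmod (c i k 0) \<le> C1"
    proof -
      have "cmod (c i k 0) \<le> C1 * Wt k powr (- 1)" using C1b[of 0 k i] k ab by auto
      also have "\<dots> \<le> C1 * 1" using C1 W by (intro mult_left_mono) (auto simp: powr_minus field_simps)
      finally show ?thesis by simp
    qed
    ultimately have "norm (exp (- \<nu> * t * lam k) *\<^sub>R c i k 0) \<le> E * C1"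
      using E by (simp add: mult_mono)
    also have "\<dots> \<le> Ce * ?W * C1" using E C1 by (intro mult_right_mono) auto
    finally have "norm (c i k t) \<le> Ce * ?W * C1 + (b * (Ce * ?W * K1) + Ks / \<nu> * ?W)"
      using I' norm_triangle_ineq4[of "exp (- \<nu> * t * lam k) *\<^sub>R c i k 0" "exp (- \<nu> * t * lam k) *\<^sub>R c i k 0 - c i k t"]
      by simp
    also have "\<dots> = ?C * ?W" by (simp add: algebra_simps)
    finally show ?thesis .
  qed
  then show "\<exists>C. \<forall>t\<in>{a..b}. \<forall>k\<in>Mfreq. \<forall>i. cmod (c i k t) \<le> C * Wt k powr (- ?r)" by blast
qed

lemma decay_all: "decay s"
proof -
  have n: "decay (1 + 2 * \<alpha> * real n)" for n
  proof (induction n)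
    case (Suc n)
    then have "decay (1 + 2 * \<alpha> * real n + 2 * \<alpha>)" using alpha by (intro decay_step) auto
    then show ?case by (simp add: algebra_simps)
  qed (simp add: decay_1)
  obtain n :: nat where "s / (2 * \<alpha>) \<le> real n" using real_arch_simple by blast
  then have sn: "s \<le> 1 + 2 * \<alpha> * real n"
    using alpha by (simp add: pos_divide_le_eq mult_ac)
  show ?thesis
    unfolding decay_def
  proof (intro allI impI)
    fix a b :: real assume ab: "0 < a" "a \<le> b" "ereal b < Tmax"
    then obtain C where C: "\<forall>t\<in>{a..b}. \<forall>k\<in>Mfreq. \<forall>i. cmod (c i k t) \<le> C * Wt k powr (- (1 + 2 * \<alpha> * real n))"
      using n[of n] unfolding decay_def by blast
    have "cmod (c i k t) \<le> \<bar>C\<bar> * Wt k powr (- s)" if "t \<in> {a..b}" "k \<in> Mfreq" for t k i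
    proof -
      have "cmod (c i k t) \<le> C * Wt k powr (- (1 + 2 * \<alpha> * real n))" using C that by blast
      also have "\<dots> \<le> \<bar>C\<bar> * Wt k powr (- s)"
        using sn Wt_pos[OF that(2)] by (intro mult_mono powr_mono) auto
      finally show ?thesis .
    qed
    then show "\<exists>C. \<forall>t\<in>{a..b}. \<forall>k\<in>Mfreq. \<forall>i. cmod (c i k t) \<le> C * Wt k powr (- s)" by blast
  qed
qed

text \<open>The integrating factor \<open>exp (\<nu> * s * lam k)\<close> removes the upper limit
  from the Duhamel integrand, after which the fundamental theorem of calculus applies to the
  continuous \<open>P i k\<close>.\<close>

lemma ode:
  assumes t: "0 < t" "ereal t < Tmax" and k: "k \<in> Mfreq"
  shows "(c i k has_vector_derivative (- (\<nu> * lam k) *\<^sub>R c i k t - P i k t)) (at t)"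
proof -
  obtain b where b: "t < b" "ereal b < Tmax" using ereal_less_dense[OF t(2)] by blast
  have bd: "b \<in> time_dom Tmax" using b t by (simp add: time_dom_def)
  have sub: "{0..b} \<subseteq> time_dom Tmax" using time_dom_mono[OF _ _ bd] by auto
  let ?f = "\<lambda>\<tau>. exp (\<nu> * \<tau> * lam k) *\<^sub>R P i k \<tau>"
  define g where "g s = integral {0..s} ?f" for s
  have g: "c i k s = exp (- \<nu> * s * lam k) *\<^sub>R (c i k 0 - g s)" if s: "s \<in> {0..b}" for s
  proof -
    have "((\<lambda>\<tau>. exp (\<nu> * s * lam k) *\<^sub>R (exp (- \<nu> * (s - \<tau>) * lam k) *\<^sub>R P i k \<tau>)) has_integral
       exp (\<nu> * s * lam k) *\<^sub>R (exp (- \<nu> * s * lam k) *\<^sub>R c i k 0 - c i k s)) {0..s}"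
      using mild_component[of s k i] s sub by (intro has_integral_cmul) auto
    moreover have "(\<lambda>\<tau>. exp (\<nu> * s * lam k) *\<^sub>R (exp (- \<nu> * (s - \<tau>) * lam k) *\<^sub>R P i k \<tau>)) = ?f"
      by (simp add: exp_add[symmetric] algebra_simps)
    ultimately have "g s = exp (\<nu> * s * lam k) *\<^sub>R (exp (- \<nu> * s * lam k) *\<^sub>R c i k 0 - c i k s)"
      unfolding g_def by (simp add: integral_unique)
    then show ?thesis
      by (simp add: scaleR_right_diff_distrib exp_add[symmetric])
  qed
  have "continuous_on {0..b} ?f"
    by (intro continuous_intros continuous_on_subset[OF continuous_P[OF k] sub])
  then have "(g has_vector_derivative ?f t) (at t within {0..b})"
    unfolding g_def using b t by (intro integral_has_vector_derivative) auto
  then have dg: "(g has_vector_derivative ?f t) (at t)"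
    using at_within_Icc_at[of 0 t b] b t by simp
  have "((\<lambda>s. exp (- \<nu> * s * lam k) *\<^sub>R (c i k 0 - g s)) has_vector_derivative
     (exp (- \<nu> * t * lam k) *\<^sub>R (0 - ?f t) + (exp (- \<nu> * t * lam k) * (- \<nu> * lam k)) *\<^sub>R (c i k 0 - g t))) (at t)"
    by (intro has_vector_derivative_scaleR has_vector_derivative_diff dg has_vector_derivative_const)
      (auto intro!: derivative_eq_intros)
  moreover have "exp (- \<nu> * t * lam k) *\<^sub>R (0 - ?f t) + (exp (- \<nu> * t * lam k) * (- \<nu> * lam k)) *\<^sub>R (c i k 0 - g t)
     = - (\<nu> * lam k) *\<^sub>R c i k t - P i k t"
    using g[of t] b t by (simp add: exp_add[symmetric] mult.commute)
  ultimately have "((\<lambda>s. exp (- \<nu> * s * lam k) *\<^sub>R (c i k 0 - g s)) has_vector_derivative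
     (- (\<nu> * lam k) *\<^sub>R c i k t - P i k t)) (at t)" by simp
  moreover have "exp (- \<nu> * s * lam k) *\<^sub>R (c i k 0 - g s) = c i k s" if "s \<in> {0<..<b}" for s
    by (rule g[symmetric]) (use that in auto)
  ultimately show ?thesis
    using b t by (auto intro: has_vector_derivative_transform_within_open[of _ _ _ "{0<..<b}"])
qed

end

section \<open>Fields with rapidly decaying coefficients\<close>

lemma L2_add: "f \<in> L2 \<Longrightarrow> g \<in> L2 \<Longrightarrow> (\<lambda>x. f x + g x) \<in> L2" for f g :: "real^3 \<Rightarrow> real"
proof -
  assume f: "f \<in> L2" and g: "g \<in> L2"
  then have [measurable]: "f \<in> borel_measurable T3" "g \<in> borel_measurable T3" by (auto simp: L2_def)
  have i: "integrable T3 (\<lambda>x. 2 * (f x)\<^sup>2 + 2 * (g x)\<^sup>2)"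
    using f g by (auto simp: L2_def)
  have "(f x + g x)\<^sup>2 \<le> 2 * (f x)\<^sup>2 + 2 * (g x)\<^sup>2" for x
    using zero_le_power2[of "f x - g x"] by (simp add: power2_eq_square algebra_simps)
  then have "integrable T3 (\<lambda>x. (f x + g x)\<^sup>2)"
    by (intro Bochner_Integration.integrable_bound[OF i]) (auto intro!: AE_I2)
  then show ?thesis using f g by (auto simp: L2_def periodic_def)
qed

lemma L2_cmult: "f \<in> L2 \<Longrightarrow> (\<lambda>x. r * f x) \<in> L2" for f :: "real^3 \<Rightarrow> real"
  by (auto simp: L2_def periodic_def power_mult_distrib)

lemma L2_diff: "f \<in> L2 \<Longrightarrow> g \<in> L2 \<Longrightarrow> (\<lambda>x. f x - g x) \<in> L2" for f g :: "real^3 \<Rightarrow> real"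
  using L2_add[of f "\<lambda>x. (-1) * g x"] L2_cmult[of g "-1"] by simp

lemma abs_coef_add: "abs_coef c \<Longrightarrow> abs_coef d \<Longrightarrow> abs_coef (\<lambda>k. c k + d k)"
  unfolding abs_coef_def
  by (rule summable_on_comparison_test[OF summable_on_add[of "\<lambda>k. cmod (c k)" UNIV "\<lambda>k. cmod (d k)"]])
    (auto intro: norm_triangle_ineq)

lemma abs_coef_cmult: "abs_coef c \<Longrightarrow> abs_coef (\<lambda>k. r * c k)"
  unfolding abs_coef_def norm_mult by (rule summable_on_cmult_right)

lemma abs_coef_square_summable: "abs_coef c \<Longrightarrow> (\<lambda>k. (cmod (c k))\<^sup>2) summable_on UNIV"
proof -
  assume c: "abs_coef c"
  let ?S = "\<Sum>\<^sub>\<infinity>k. cmod (c k)"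
  have "cmod (c k) \<le> ?S" for k
    using finite_sum_le_infsum[of "\<lambda>k. cmod (c k)" UNIV "{k}"] c by (auto simp: abs_coef_def)
  then have le: "(cmod (c k))\<^sup>2 \<le> ?S * cmod (c k)" for k
    unfolding power2_eq_square by (rule mult_right_mono) simp
  have sm: "(\<lambda>k. ?S * cmod (c k)) summable_on UNIV"
    using c unfolding abs_coef_def by (rule summable_on_cmult_right)
  show ?thesis
    by (rule summable_on_comparison_test[OF sm]) (use le in auto)
qed

lemma fourier_mult_properties:
  assumes "herm (\<lambda>k. m k * fcoef f k)" "abs_coef (\<lambda>k. m k * fcoef f k)"
  shows "fourier_mult m f \<in> L2" "fcoef (fourier_mult m f) k = m k * fcoef f k"
proof -
  have "fourier_mult m f \<in> L2 \<and> (\<forall>k. fcoef (fourier_mult m f) k = m k * fcoef f k)"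
    unfolding fourier_mult_def
    by (rule someI_ex[OF Riesz_Fischer[OF assms(1) abs_coef_square_summable[OF assms(2)]]])
  then show "fourier_mult m f \<in> L2" "fcoef (fourier_mult m f) k = m k * fcoef f k" by auto
qed

lemma cmod_dsym_sq: "(cmod (dsym j k * z))\<^sup>2 = 4 * pi\<^sup>2 * ((real_of_int (k $ j))\<^sup>2 * (cmod z)\<^sup>2)"
  by (simp add: dsym_def norm_mult power_mult_distrib)

text \<open>Lagrange's identity for the real and imaginary parts separately, the real vector being
  orthogonal to both. It makes each coefficient of the vorticity as large as that of the
  gradient.\<close>

lemma cross_norm_identity:
  fixes k1 k2 k3 :: real and z1 z2 z3 :: complex
  assumes "k1 * z1 + k2 * z2 + k3 * z3 = 0"
  shows "(cmod (k2 * z3 - k3 * z2))\<^sup>2 + (cmod (k3 * z1 - k1 * z3))\<^sup>2 + (cmod (k1 * z2 - k2 * z1))\<^sup>2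
    = (k1\<^sup>2 + k2\<^sup>2 + k3\<^sup>2) * ((cmod z1)\<^sup>2 + (cmod z2)\<^sup>2 + (cmod z3)\<^sup>2)"
proof -
  have L: "(k2 * c - k3 * b)\<^sup>2 + (k3 * a - k1 * c)\<^sup>2 + (k1 * b - k2 * a)\<^sup>2
    = (k1\<^sup>2 + k2\<^sup>2 + k3\<^sup>2) * (a\<^sup>2 + b\<^sup>2 + c\<^sup>2)" if "k1 * a + k2 * b + k3 * c = 0" for a b c :: real
  proof -
    have "(k2 * c - k3 * b)\<^sup>2 + (k3 * a - k1 * c)\<^sup>2 + (k1 * b - k2 * a)\<^sup>2 + (k1 * a + k2 * b + k3 * c)\<^sup>2
      = (k1\<^sup>2 + k2\<^sup>2 + k3\<^sup>2) * (a\<^sup>2 + b\<^sup>2 + c\<^sup>2)" by algebra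
    then show ?thesis using that by simp
  qed
  have "k1 * Re z1 + k2 * Re z2 + k3 * Re z3 = 0" "k1 * Im z1 + k2 * Im z2 + k3 * Im z3 = 0"
    using assms by (simp_all add: complex_eq_iff)
  from L[OF this(1)] L[OF this(2)] show ?thesis
    unfolding cmod_power2 by (simp add: algebra_simps)
qed

text \<open>Expanding the square leaves, besides the stated product, only half the square of the
  pairing with \<open>k\<close>, which the divergence condition removes. This is the factor 1/2
  between the strain and the other two norms.\<close>

lemma sym_norm_identity:
  fixes k :: "3 \<Rightarrow> real" and z :: "3 \<Rightarrow> complex"
  assumes "(\<Sum>i\<in>UNIV. k i * z i) = 0"
  shows "(\<Sum>l\<in>UNIV. \<Sum>i\<in>UNIV. (cmod ((k l * z i + k i * z l) / 2))\<^sup>2) = 1/2 * ((\<Sum>l\<in>UNIV. (k l)\<^sup>2) * (\<Sum>i\<in>UNIV. (cmod (z i))\<^sup>2))"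
proof -
  have L: "(\<Sum>l\<in>UNIV. \<Sum>i\<in>UNIV. ((k l * a i + k i * a l) / 2)\<^sup>2) = 1/2 * ((\<Sum>l\<in>UNIV. (k l)\<^sup>2) * (\<Sum>i\<in>UNIV. (a i)\<^sup>2))"
    if "(\<Sum>i\<in>UNIV. k i * a i) = 0" for a :: "3 \<Rightarrow> real"
  proof -
    have "(\<Sum>l\<in>UNIV. \<Sum>i\<in>UNIV. ((k l * a i + k i * a l) / 2)\<^sup>2) =
       1/2 * ((\<Sum>l\<in>UNIV. (k l)\<^sup>2) * (\<Sum>i\<in>UNIV. (a i)\<^sup>2)) + 1/2 * (\<Sum>i\<in>UNIV. k i * a i)\<^sup>2"
      by (simp add: sum_3 power2_eq_square field_simps)
    then show ?thesis using that by simp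
  qed
  have re: "(\<Sum>i\<in>UNIV. k i * Re (z i)) = 0" and im: "(\<Sum>i\<in>UNIV. k i * Im (z i)) = 0"
    using assms by (simp_all add: complex_eq_iff)
  have "(cmod ((k l * z i + k i * z l) / 2))\<^sup>2 = ((k l * Re (z i) + k i * Re (z l)) / 2)\<^sup>2 + ((k l * Im (z i) + k i * Im (z l)) / 2)\<^sup>2" for l i
    unfolding cmod_power2 by simp
  then show ?thesis
    using L[OF re] L[OF im] by (simp add: cmod_power2 sum.distrib distrib_left)
qed

text \<open>A single time slice: the spatial identities concern one field with rapidly decaying
  coefficients, and time returns only when the enstrophy is differentiated.\<close>

locale smooth_M =
  fixes v :: "real^3 \<Rightarrow> real^3"
  assumes vM: "v \<in> HdotM 1"
    and vdecay: "\<And>s. \<exists>C. \<forall>k\<in>Mfreq. \<forall>i. cmod (cf v i k) \<le> C * Wt k powr (- s)"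
begin

text \<open>Decay of order \<open>p + 1\<close> absorbs a multiplier of order \<open>p\<close> and
  leaves one inverse power of \<open>Wt\<close>, enough for summability.\<close>

lemma abs_coef_mult:
  assumes m: "\<And>k. k \<in> Mfreq \<Longrightarrow> cmod (m k) \<le> A * Wt k powr p" and A: "0 \<le> A"
  shows "abs_coef (\<lambda>k. m k * cf v i k)"
proof -
  obtain C where C: "\<forall>k\<in>Mfreq. \<forall>i. cmod (cf v i k) \<le> C * Wt k powr (- (p + 1))"
    using vdecay by blast
  show ?thesis
  proof (rule abs_coef_powr[of _ "A * C" 1])
    fix k assume k: "k \<in> Mfreq"
    have "cmod (m k * cf v i k) \<le> (A * Wt k powr p) * (C * Wt k powr (- (p + 1)))"
      unfolding norm_mult using m[OF k] C k A by (intro mult_mono) auto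
    also have "\<dots> = A * C * Wt k powr (- 1)"
      using powr_add[of "Wt k" p "- (p + 1)"] by (simp add: mult_ac)
    finally show "cmod (m k * cf v i k) \<le> A * C * Wt k powr (- 1)" .
  qed (use HdotM_supp[OF vM] in auto)
qed

lemma abs_coef_0: "abs_coef (cf v i)"
  by (rule HdotM_abs_coef[OF vM])

lemma abs_coef_1: "abs_coef (\<lambda>k. dsym l k * cf v i k)"
  by (rule abs_coef_mult[of _ "4 * pi" 1]) (use cmod_dsym_le Wt_pos in \<open>auto simp: Wt_def\<close>)

lemma abs_coef_2: "abs_coef (\<lambda>k. dsym l k * (dsym j k * cf v i k))"
proof -
  have "abs_coef (\<lambda>k. (dsym l k * dsym j k) * cf v i k)"
  proof (rule abs_coef_mult[of _ "(4 * pi) * (4 * pi)" 2])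
    fix k assume k: "k \<in> Mfreq"
    have "cmod (dsym l k * dsym j k) \<le> (4 * pi * Wt k) * (4 * pi * Wt k)"
      unfolding norm_mult using Wt_pos[OF k] by (intro mult_mono cmod_dsym_le[OF k]) auto
    also have "\<dots> = (4 * pi) * (4 * pi) * Wt k powr 2"
      using Wt_pos[OF k] by (simp add: power2_eq_square)
    finally show "cmod (dsym l k * dsym j k) \<le> (4 * pi) * (4 * pi) * Wt k powr 2" .
  qed simp
  then show ?thesis by (simp only: mult.assoc)
qed

lemma lap_fcoef_sq_summable:
  assumes s: "0 \<le> s"
  shows "(\<lambda>k. lap_symbol k powr s * fcoef_sq v k) summable_on A"
proof -
  obtain C where C: "\<forall>k\<in>Mfreq. \<forall>i. cmod (cf v i k) \<le> C * Wt k powr (- (s + 1))"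
    using vdecay by blast
  let ?K = "(48 * pi\<^sup>2) powr s * (3 * C\<^sup>2)"
  have b: "lap_symbol k powr s * fcoef_sq v k \<le> ?K * Wt k powr (- 2)" if k: "k \<in> Mfreq" for k
  proof -
    note W = Wt_pos[OF k]
    have "lap_symbol k powr s \<le> (48 * pi\<^sup>2 * (Wt k)\<^sup>2) powr s"
      using lap_symbol_le[OF k] s by (intro powr_mono2) auto
    also have "\<dots> = (48 * pi\<^sup>2) powr s * Wt k powr (2 * s)"
      using W by (simp add: powr_mult powr_powr[symmetric])
    finally have l: "lap_symbol k powr s \<le> (48 * pi\<^sup>2) powr s * Wt k powr (2 * s)" .
    have "fcoef_sq v k \<le> (\<Sum>i\<in>(UNIV::3 set). (C * Wt k powr (- (s + 1)))\<^sup>2)"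
      unfolding fcoef_sq_cf using C k by (intro sum_mono power_mono) auto
    also have "\<dots> = 3 * C\<^sup>2 * (Wt k powr (- (s + 1)) * Wt k powr (- (s + 1)))"
      by (simp add: power_mult_distrib power2_eq_square)
    also have "Wt k powr (- (s + 1)) * Wt k powr (- (s + 1)) = Wt k powr (- (2 * s) - 2)"
      by (simp add: powr_add[symmetric])
    finally have "lap_symbol k powr s * fcoef_sq v k \<le>
        ((48 * pi\<^sup>2) powr s * Wt k powr (2 * s)) * (3 * C\<^sup>2 * Wt k powr (- (2 * s) - 2))"
      using l by (intro mult_mono) (auto simp: fcoef_sq_nonneg)
    also have "\<dots> = ?K * (Wt k powr (2 * s) * Wt k powr (- (2 * s) - 2))" by (simp add: mult_ac)
    also have "Wt k powr (2 * s) * Wt k powr (- (2 * s) - 2) = Wt k powr (- 2)"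
      by (simp add: powr_add[symmetric])
    finally show ?thesis .
  qed
  have "(\<lambda>k. lap_symbol k powr s * fcoef_sq v k) summable_on Mfreq"
    by (rule summable_on_comparison_test[OF summable_on_cmult_right[OF Wt_powr_summable[of 2]]])
      (use b in \<open>auto intro: mult_nonneg_nonneg fcoef_sq_nonneg\<close>)
  then have "(\<lambda>k. lap_symbol k powr s * fcoef_sq v k) summable_on UNIV"
    by (rule summable_on_cong_neutral[THEN iffD1, rotated -1]) (auto simp: HdotM_fcoef_sq_supp[OF vM])
  then show ?thesis by (rule summable_on_subset_banach) auto
qed

lemma in_Hdot: "0 \<le> s \<Longrightarrow> v \<in> Hdot s"
  using vM lap_fcoef_sq_summable[of s] by (auto simp: HdotM_def Hdot_def)

abbreviation "G l i \<equiv> pd l (\<lambda>x. v x $ i)"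

lemmas G_L2 = HdotM_pd(1)[OF vM]
lemmas G_coef = HdotM_pd(2)[OF vM]

lemma grad_nth: "(\<lambda>x. grad v x $ l $ i) = G l i"
  by (simp add: grad_def)

lemma strain_nth: "(\<lambda>x. strain v x $ l $ i) = (\<lambda>x. (1/2) * (G l i x + G i l x))"
  by (simp add: strain_def)

lemma vorticity_nth: "(\<lambda>x. vorticity v x $ 1) = (\<lambda>x. G 2 3 x - G 3 2 x)"
   "(\<lambda>x. vorticity v x $ 2) = (\<lambda>x. G 3 1 x - G 1 3 x)"
   "(\<lambda>x. vorticity v x $ 3) = (\<lambda>x. G 1 2 x - G 2 1 x)"
  by (simp_all add: vorticity_def)

lemma strain_nth_L2: "(\<lambda>x. strain v x $ l $ i) \<in> L2"
  unfolding strain_nth by (intro L2_cmult L2_add G_L2)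

lemma vorticity_nth_L2: "(\<lambda>x. vorticity v x $ i) \<in> L2"
proof -
  have "(\<lambda>x. vorticity v x $ 1) \<in> L2" "(\<lambda>x. vorticity v x $ 2) \<in> L2" "(\<lambda>x. vorticity v x $ 3) \<in> L2"
    unfolding vorticity_nth by (intro L2_diff G_L2)+
  then show ?thesis using exhaust_3[of i] by auto
qed

lemma strain_coef: "fcoef (\<lambda>x. strain v x $ l $ i) = (\<lambda>k. (1/2) * (dsym l k * cf v i k + dsym i k * cf v l k))"
  unfolding strain_nth
  by (rule ext, subst fcoef_cmult, subst fcoef_add) (auto intro: L2_integrable[OF G_L2] simp: G_coef)

lemma fcoef_diff_G: "fcoef (\<lambda>x. G l i x - G l' i' x) = (\<lambda>k. dsym l k * cf v i k + (-1) * (dsym l' k * cf v i' k))"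
  by (rule ext, subst fcoef_diff) (auto intro: L2_integrable[OF G_L2] simp: G_coef)

lemma vorticity_coef:
  "fcoef (\<lambda>x. vorticity v x $ 1) = (\<lambda>k. dsym 2 k * cf v 3 k + (-1) * (dsym 3 k * cf v 2 k))"
  "fcoef (\<lambda>x. vorticity v x $ 2) = (\<lambda>k. dsym 3 k * cf v 1 k + (-1) * (dsym 1 k * cf v 3 k))"
  "fcoef (\<lambda>x. vorticity v x $ 3) = (\<lambda>k. dsym 1 k * cf v 2 k + (-1) * (dsym 2 k * cf v 1 k))"
  unfolding vorticity_nth fcoef_diff_G by auto

lemma vorticity_abs_coef: "abs_coef (fcoef (\<lambda>x. vorticity v x $ i))"
proof -
  have "abs_coef (fcoef (\<lambda>x. vorticity v x $ 1))" "abs_coef (fcoef (\<lambda>x. vorticity v x $ 2))" "abs_coef (fcoef (\<lambda>x. vorticity v x $ 3))"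
    unfolding vorticity_coef by (intro abs_coef_add abs_coef_cmult[of "\<lambda>k. dsym _ k * cf v _ k"] abs_coef_1)+
  then show ?thesis using exhaust_3[of i] by auto
qed

lemma strain_abs_coef: "abs_coef (fcoef (\<lambda>x. strain v x $ l $ i))"
  unfolding strain_coef by (intro abs_coef_cmult abs_coef_add abs_coef_1)

lemma grad_abs_coef: "abs_coef (fcoef (\<lambda>x. grad v x $ l $ i))"
  unfolding grad_nth G_coef[abs_def] by (rule abs_coef_1)

lemma lap_symbol_3: "lap_symbol k = 4 * pi\<^sup>2 * ((real_of_int (k $ 1))\<^sup>2 + (real_of_int (k $ 2))\<^sup>2 + (real_of_int (k $ 3))\<^sup>2)"
  by (simp add: lap_symbol_def norm_rvec_sq)

lemma grad_fcoef_sq: "fcoef_sq (grad v) k = lap_symbol k * fcoef_sq v k"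
  unfolding fcoef_sq_mat3 grad_nth G_coef cmod_dsym_sq fcoef_sq_cf lap_symbol_3
  by (simp add: sum_3 algebra_simps)

lemma div_free_3: "complex_of_int (k $ 1) * cf v 1 k + complex_of_int (k $ 2) * cf v 2 k + complex_of_int (k $ 3) * cf v 3 k = 0"
  using HdotM_div_free[OF vM, of k] by (simp add: sum_3)

lemma vorticity_fcoef_sq: "fcoef_sq (vorticity v) k = lap_symbol k * fcoef_sq v k"
proof -
  have e: "(cmod (dsym l k * a + (-1) * (dsym m k * b)))\<^sup>2 = 4 * pi\<^sup>2 * (cmod (real_of_int (k $ l) * a - real_of_int (k $ m) * b))\<^sup>2" for l m and a b :: complex
  proof -
    have "dsym l k * a + (-1) * (dsym m k * b) = 2 * pi * \<i> * (real_of_int (k $ l) * a - real_of_int (k $ m) * b)"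
      by (simp add: dsym_def algebra_simps)
    then show ?thesis by (simp add: norm_mult power_mult_distrib)
  qed
  have "fcoef_sq (vorticity v) k = 4 * pi\<^sup>2 * ((cmod (real_of_int (k $ 2) * cf v 3 k - real_of_int (k $ 3) * cf v 2 k))\<^sup>2 +
     (cmod (real_of_int (k $ 3) * cf v 1 k - real_of_int (k $ 1) * cf v 3 k))\<^sup>2 +
     (cmod (real_of_int (k $ 1) * cf v 2 k - real_of_int (k $ 2) * cf v 1 k))\<^sup>2)"
    unfolding fcoef_sq_vec3 sum_3 vorticity_coef e by (simp add: algebra_simps)
  also have "\<dots> = lap_symbol k * fcoef_sq v k"
    unfolding lap_symbol_3 fcoef_sq_cf sum_3
    by (subst cross_norm_identity) (use div_free_3[of k] in simp_all)
  finally show ?thesis .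
qed

lemma strain_fcoef_sq: "fcoef_sq (strain v) k = 1/2 * (lap_symbol k * fcoef_sq v k)"
proof -
  have e: "(cmod ((1/2) * (dsym l k * a + dsym m k * b)))\<^sup>2 = 4 * pi\<^sup>2 * (cmod ((real_of_int (k $ l) * a + real_of_int (k $ m) * b) / 2))\<^sup>2" for l m and a b :: complex
  proof -
    have "(1/2) * (dsym l k * a + dsym m k * b) = 2 * pi * \<i> * ((real_of_int (k $ l) * a + real_of_int (k $ m) * b) / 2)"
      by (simp add: dsym_def algebra_simps)
    then show ?thesis by (simp add: norm_mult power_mult_distrib power_divide)
  qed
  have "fcoef_sq (strain v) k = 4 * pi\<^sup>2 * (\<Sum>l\<in>UNIV. \<Sum>i\<in>UNIV. (cmod ((real_of_int (k $ l) * cf v i k + real_of_int (k $ i) * cf v l k) / 2))\<^sup>2)"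
    unfolding fcoef_sq_mat3 strain_coef e by (simp add: sum_distrib_left)
  also have "\<dots> = 4 * pi\<^sup>2 * (1/2 * ((\<Sum>l\<in>UNIV. (real_of_int (k $ l))\<^sup>2) * (\<Sum>i\<in>UNIV. (cmod (cf v i k))\<^sup>2)))"
    by (subst sym_norm_identity) (use HdotM_div_free[OF vM, of k] in simp_all)
  also have "\<dots> = 1/2 * (lap_symbol k * fcoef_sq v k)"
    by (simp add: lap_symbol_3 fcoef_sq_cf sum_3)
  finally show ?thesis .
qed

lemma
  shows grad_Basis: "b \<in> Basis \<Longrightarrow> (\<lambda>x. grad v x \<bullet> b) \<in> L2 \<and> abs_coef (fcoef (\<lambda>x. grad v x \<bullet> b)) \<and> fcoef (\<lambda>x. grad v x \<bullet> b) 0 = 0"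
    and vorticity_Basis: "b' \<in> Basis \<Longrightarrow> (\<lambda>x. vorticity v x \<bullet> b') \<in> L2 \<and> abs_coef (fcoef (\<lambda>x. vorticity v x \<bullet> b')) \<and> fcoef (\<lambda>x. vorticity v x \<bullet> b') 0 = 0"
    and strain_Basis: "b \<in> Basis \<Longrightarrow> (\<lambda>x. strain v x \<bullet> b) \<in> L2 \<and> abs_coef (fcoef (\<lambda>x. strain v x \<bullet> b)) \<and> fcoef (\<lambda>x. strain v x \<bullet> b) 0 = 0"
proof -
  have d0: "dsym l 0 = 0" for l by (simp add: dsym_def)
  { assume "b \<in> Basis"
    then obtain l i where b: "b = axis l (axis i 1)" by (auto simp: Basis_vec_def)
    show "(\<lambda>x. grad v x \<bullet> b) \<in> L2 \<and> abs_coef (fcoef (\<lambda>x. grad v x \<bullet> b)) \<and> fcoef (\<lambda>x. grad v x \<bullet> b) 0 = 0"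
      using G_L2[of l i] grad_abs_coef[of l i] G_coef[of l i 0] by (simp add: b inner_axis grad_nth d0)
    show "(\<lambda>x. strain v x \<bullet> b) \<in> L2 \<and> abs_coef (fcoef (\<lambda>x. strain v x \<bullet> b)) \<and> fcoef (\<lambda>x. strain v x \<bullet> b) 0 = 0"
      using strain_nth_L2[of l i] strain_abs_coef[of l i] fun_cong[OF strain_coef[of l i], of 0] by (simp add: b inner_axis d0)
  }
  assume "b' \<in> Basis"
  then obtain i where b: "b' = axis i 1" by (auto simp: Basis_vec_def)
  have "fcoef (\<lambda>x. vorticity v x $ i) 0 = 0"
    using exhaust_3[of i] by (auto simp: vorticity_coef d0)
  then show "(\<lambda>x. vorticity v x \<bullet> b') \<in> L2 \<and> abs_coef (fcoef (\<lambda>x. vorticity v x \<bullet> b')) \<and> fcoef (\<lambda>x. vorticity v x \<bullet> b') 0 = 0"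
    using vorticity_nth_L2[of i] vorticity_abs_coef[of i] by (simp add: b inner_axis)
qed

text \<open>The zero frequency is no exception, because \<open>0 powr x = 0\<close> for every
  exponent.\<close>

lemma lap_powr_Suc: "lap_symbol k powr s * (lap_symbol k * F) = lap_symbol k powr (s + 1) * F"
  by (cases "lap_symbol k = 0") (simp_all add: powr_add)

lemma lap_1_fcoef_sq_summable: "(\<lambda>k. lap_symbol k * fcoef_sq v k) summable_on UNIV"
  using lap_fcoef_sq_summable[of 1] by simp

lemma derivatives_in_Hdot:
  assumes "0 \<le> s"
  shows "grad v \<in> Hdot s" "vorticity v \<in> Hdot s" "strain v \<in> Hdot s"
proof -
  have s: "(\<lambda>k. lap_symbol k powr (s + 1) * fcoef_sq v k) summable_on {k. k \<noteq> 0}"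
    using lap_fcoef_sq_summable assms by simp
  show "grad v \<in> Hdot s"
    using grad_Basis s by (intro HdotI) (auto simp: grad_fcoef_sq lap_powr_Suc)
  show "vorticity v \<in> Hdot s"
    using vorticity_Basis s by (intro HdotI) (auto simp: vorticity_fcoef_sq lap_powr_Suc)
  have "(\<lambda>k. lap_symbol k powr s * fcoef_sq (strain v) k) = (\<lambda>k. 1/2 * (lap_symbol k powr (s + 1) * fcoef_sq v k))"
    by (simp add: strain_fcoef_sq lap_powr_Suc[symmetric])
  then have "(\<lambda>k. lap_symbol k powr s * fcoef_sq (strain v) k) summable_on {k. k \<noteq> 0}"
    using summable_on_cmult_right[OF s, of "1/2"] by (simp only:)
  then show "strain v \<in> Hdot s"
    using strain_Basis by (intro HdotI) blast+
qed

lemma infsum_nonzero: "(\<Sum>\<^sub>\<infinity>k\<in>{k. k \<noteq> 0}. lap_symbol k powr s * fcoef_sq v k) = (\<Sum>\<^sub>\<infinity>k. lap_symbol k powr s * fcoef_sq v k)"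
  by (rule infsum_cong_neutral) (auto simp: HdotM_fcoef_sq_supp[OF vM zero_notin_Mfreq])

lemma Hdot_norm_derivatives:
  assumes "0 \<le> s"
  shows "(Hdot_norm s (grad v))\<^sup>2 = (\<Sum>\<^sub>\<infinity>k. lap_symbol k powr (s + 1) * fcoef_sq v k)"
    "(Hdot_norm s (vorticity v))\<^sup>2 = (\<Sum>\<^sub>\<infinity>k. lap_symbol k powr (s + 1) * fcoef_sq v k)"
    "(Hdot_norm s (strain v))\<^sup>2 = 1/2 * (\<Sum>\<^sub>\<infinity>k. lap_symbol k powr (s + 1) * fcoef_sq v k)"
proof -
  have nn: "(Hdot_norm s w)\<^sup>2 = (\<Sum>\<^sub>\<infinity>k\<in>{k. k \<noteq> 0}. lap_symbol k powr s * fcoef_sq w k)"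
    for w :: "real^3 \<Rightarrow> 'b::euclidean_space"
  proof -
    have "0 \<le> (\<Sum>\<^sub>\<infinity>k\<in>{k. k \<noteq> 0}. lap_symbol k powr s * fcoef_sq w k)"
      by (intro infsum_nonneg mult_nonneg_nonneg fcoef_sq_nonneg) auto
    then show ?thesis by (simp only: Hdot_norm_def real_sqrt_pow2)
  qed
  show "(Hdot_norm s (grad v))\<^sup>2 = (\<Sum>\<^sub>\<infinity>k. lap_symbol k powr (s + 1) * fcoef_sq v k)"
    unfolding nn grad_fcoef_sq lap_powr_Suc infsum_nonzero ..
  show "(Hdot_norm s (vorticity v))\<^sup>2 = (\<Sum>\<^sub>\<infinity>k. lap_symbol k powr (s + 1) * fcoef_sq v k)"
    unfolding nn vorticity_fcoef_sq lap_powr_Suc infsum_nonzero ..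
  have "(\<lambda>k. lap_symbol k powr s * fcoef_sq (strain v) k) = (\<lambda>k. 1/2 * (lap_symbol k powr (s + 1) * fcoef_sq v k))"
    by (simp add: strain_fcoef_sq lap_powr_Suc[symmetric])
  then show "(Hdot_norm s (strain v))\<^sup>2 = 1/2 * (\<Sum>\<^sub>\<infinity>k. lap_symbol k powr (s + 1) * fcoef_sq v k)"
    unfolding nn by (simp only: infsum_cmult_right' infsum_nonzero)
qed

lemma l2_norm_derivatives:
  "(l2_norm (grad v))\<^sup>2 = (\<Sum>\<^sub>\<infinity>k. lap_symbol k * fcoef_sq v k)"
  "(l2_norm (vorticity v))\<^sup>2 = (\<Sum>\<^sub>\<infinity>k. lap_symbol k * fcoef_sq v k)"
  "(l2_norm (strain v))\<^sup>2 = 1/2 * (\<Sum>\<^sub>\<infinity>k. lap_symbol k * fcoef_sq v k)"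
proof -
  show "(l2_norm (grad v))\<^sup>2 = (\<Sum>\<^sub>\<infinity>k. lap_symbol k * fcoef_sq v k)"
    using Parseval_vec[of "grad v"] grad_Basis by (auto simp: has_sum_iff grad_fcoef_sq[abs_def])
  show "(l2_norm (vorticity v))\<^sup>2 = (\<Sum>\<^sub>\<infinity>k. lap_symbol k * fcoef_sq v k)"
    using Parseval_vec[of "vorticity v"] vorticity_Basis by (auto simp: has_sum_iff vorticity_fcoef_sq[abs_def])
  have "(l2_norm (strain v))\<^sup>2 = (\<Sum>\<^sub>\<infinity>k. fcoef_sq (strain v) k)"
    using Parseval_vec[of "strain v"] strain_Basis by (auto simp: has_sum_iff)
  then show "(l2_norm (strain v))\<^sup>2 = 1/2 * (\<Sum>\<^sub>\<infinity>k. lap_symbol k * fcoef_sq v k)"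
    unfolding strain_fcoef_sq infsum_cmult_right' .
qed

end

section \<open>Trilinear integral identities\<close>

text \<open>Split the matrix into its symmetric part S and its antisymmetric part W, which acts as
  half the cross product with \<open>w\<close>. For trace-free S, Cayley--Hamilton gives tr S^3 = 3
  det S, and tr (S W^2) is a quarter of \<open>S \<bullet> outer w w\<close>. That term occurs with
  total coefficient -1 when one factor is transposed and 3 when none is.\<close>

lemma gradient_cubic_identities:
  fixes a :: "3 \<Rightarrow> 3 \<Rightarrow> real"
  assumes tr: "a 1 1 + a 2 2 + a 3 3 = 0"
  defines "S \<equiv> (\<chi> l i. (a l i + a i l) / 2) :: real^3^3"
    and "w \<equiv> vector [a 2 3 - a 3 2, a 3 1 - a 1 3, a 1 2 - a 2 1] :: real^3"
  shows "(\<Sum>i\<in>UNIV. \<Sum>j\<in>UNIV. \<Sum>l\<in>UNIV. a l j * a j i * a l i) = 3 * det S - 1/4 * (S \<bullet> outer w w)"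
    and "(\<Sum>i\<in>UNIV. \<Sum>j\<in>UNIV. \<Sum>l\<in>UNIV. a i j * a j l * a l i) = 3 * det S + 3/4 * (S \<bullet> outer w w)"
proof -
  have a3: "a 3 3 = - a 1 1 - a 2 2" using tr by simp
  have 1: "det S = a 1 1 * a 2 2 * a 3 3 + 2 * ((a 1 2 + a 2 1) / 2 * ((a 2 3 + a 3 2) / 2) * ((a 1 3 + a 3 1) / 2))
      - a 1 1 * ((a 2 3 + a 3 2) / 2)^2 - a 2 2 * ((a 1 3 + a 3 1) / 2)^2 - a 3 3 * ((a 1 2 + a 2 1) / 2)^2"
    unfolding S_def det_3 by (simp add: field_simps power2_eq_square)
  have 2: "S \<bullet> outer w w = a 1 1 * (a 2 3 - a 3 2)^2 + a 2 2 * (a 3 1 - a 1 3)^2 + a 3 3 * (a 1 2 - a 2 1)^2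
     + (a 1 2 + a 2 1) * (a 2 3 - a 3 2) * (a 3 1 - a 1 3) + (a 1 3 + a 3 1) * (a 2 3 - a 3 2) * (a 1 2 - a 2 1)
     + (a 2 3 + a 3 2) * (a 3 1 - a 1 3) * (a 1 2 - a 2 1)"
    unfolding S_def w_def outer_def inner_vec_def sum_3 by (simp add: field_simps power2_eq_square)
  show "(\<Sum>i\<in>UNIV. \<Sum>j\<in>UNIV. \<Sum>l\<in>UNIV. a l j * a j i * a l i) = 3 * det S - 1/4 * (S \<bullet> outer w w)"
    unfolding 1 2 sum_3 a3 by (simp add: field_simps power2_eq_square)
  show "(\<Sum>i\<in>UNIV. \<Sum>j\<in>UNIV. \<Sum>l\<in>UNIV. a i j * a j l * a l i) = 3 * det S + 3/4 * (S \<bullet> outer w w)"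
    unfolding 1 2 sum_3 a3 by (simp add: field_simps power2_eq_square)
qed

lemma fser_add: "abs_coef c \<Longrightarrow> abs_coef d \<Longrightarrow> fser (\<lambda>k. c k + d k) x = fser c x + fser d x"
proof -
  assume c: "abs_coef c" and d: "abs_coef d"
  have s: "(\<lambda>k. c k * fexp k x) summable_on UNIV" if "abs_coef c" for c
    using that unfolding abs_coef_def by (intro abs_summable_summable[where f = "\<lambda>k. c k * fexp k x"]) (simp add: norm_mult)
  show ?thesis
    unfolding fser_def distrib_right using s[OF c] s[OF d] by (rule infsum_add)
qed

lemma fser_cmult: "fser (\<lambda>k. r * c k) x = r * fser c x"
  unfolding fser_def mult.assoc by (rule infsum_cmult_right')

lemma fser_0 [simp]: "fser (\<lambda>k. 0) x = 0"
  by (simp add: fser_def)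

lemma integral_derivation_real3:
  fixes c1 c2 c3 :: "int^3 \<Rightarrow> complex"
  assumes h: "herm c1" "herm c2" "herm c3"
    and c: "abs_coef c1" "abs_coef c2" "abs_coef c3"
    and d: "abs_coef (\<lambda>k. dsym j k * c1 k)" "abs_coef (\<lambda>k. dsym j k * c2 k)" "abs_coef (\<lambda>k. dsym j k * c3 k)"
  shows "(LINT x|T3. Re (fser (\<lambda>k. dsym j k * c1 k) x) * Re (fser c2 x) * Re (fser c3 x)
    + Re (fser c1 x) * Re (fser (\<lambda>k. dsym j k * c2 k) x) * Re (fser c3 x)
    + Re (fser c1 x) * Re (fser c2 x) * Re (fser (\<lambda>k. dsym j k * c3 k) x)) = 0" (is "integral\<^sup>L T3 ?f = 0")
proof -
  have "complex_of_real (integral\<^sup>L T3 ?f) = (LINT x|T3. complex_of_real (?f x))"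
    by (rule integral_complex_of_real[symmetric])
  also have "\<dots> = 0"
    unfolding of_real_add of_real_mult h[THEN fser_herm_real] h[THEN herm_dsym_mult, THEN fser_herm_real]
    by (rule integral_derivation_fser3[OF c d])
  finally show ?thesis by (simp only: of_real_eq_0_iff)
qed

lemma bounded_T3_Re_fser: "abs_coef c \<Longrightarrow> bounded_T3 (\<lambda>x. Re (fser c x))"
  using bounded_T3_fser[of c] unfolding bounded_T3_def by (auto intro: order_trans[OF abs_Re_le_cmod])

lemma bounded_T3_sum: "finite S \<Longrightarrow> (\<And>i. i \<in> S \<Longrightarrow> bounded_T3 (f i)) \<Longrightarrow> bounded_T3 (\<lambda>x. \<Sum>i\<in>S. f i x)"
proof (induction S rule: finite_induct)
  case empty
  show ?case using bounded_T3_const[of 0] by simp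
next
  case (insert i S)
  then show ?case using bounded_T3_add[of "f i" "\<lambda>x. \<Sum>i\<in>S. f i x"] by simp
qed

lemma integral_sum3_eq_0:
  fixes f :: "3 \<Rightarrow> 3 \<Rightarrow> 3 \<Rightarrow> real^3 \<Rightarrow> real"
  assumes b: "\<And>i j l. bounded_T3 (f i j l)" and z: "\<And>i j l. (LINT x|T3. f i j l x) = 0"
  shows "(LINT x|T3. (\<Sum>i\<in>UNIV. \<Sum>j\<in>UNIV. \<Sum>l\<in>UNIV. f i j l x)) = 0"
proof -
  note i = bounded_T3_integrable[OF b]
  have "(LINT x|T3. (\<Sum>i\<in>UNIV. \<Sum>j\<in>UNIV. \<Sum>l\<in>UNIV. f i j l x)) = (\<Sum>i\<in>UNIV. \<Sum>j\<in>UNIV. \<Sum>l\<in>UNIV. LINT x|T3. f i j l x)"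
    by (simp add: i)
  then show ?thesis by (simp add: z)
qed

context smooth_M
begin

text \<open>Everywhere defined bounded series for the velocity and its first and second derivatives;
  for these the divergence condition and the symmetry of second derivatives hold at every
  point.\<close>

definition U :: "3 \<Rightarrow> real^3 \<Rightarrow> real" where "U i x = Re (fser (cf v i) x)"
definition A :: "3 \<Rightarrow> 3 \<Rightarrow> real^3 \<Rightarrow> real" where "A l i x = Re (fser (\<lambda>k. dsym l k * cf v i k) x)"
definition H :: "3 \<Rightarrow> 3 \<Rightarrow> 3 \<Rightarrow> real^3 \<Rightarrow> real" where "H l j i x = Re (fser (\<lambda>k. dsym l k * (dsym j k * cf v i k)) x)"

lemma herm_0: "herm (cf v i)"
  unfolding cf_def by (rule herm_fcoef)

lemmas herm_1 = herm_dsym_mult[OF herm_0]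
lemma bounded_U: "bounded_T3 (U i)" and bounded_A: "bounded_T3 (A l i)" and bounded_H: "bounded_T3 (H l j i)"
  unfolding U_def[abs_def] A_def[abs_def] H_def[abs_def]
  by (intro bounded_T3_Re_fser abs_coef_0 abs_coef_1 abs_coef_2)+

lemmas bounded_UAH = bounded_T3_mult bounded_T3_add bounded_U bounded_A bounded_H

lemma H_commute: "H l j i = H j l i"
  by (simp add: H_def[abs_def] mult.left_commute)

lemma div_coef: "dsym 1 k * cf v 1 k + (dsym 2 k * cf v 2 k + dsym 3 k * cf v 3 k) = 0"
proof -
  have "dsym 1 k * cf v 1 k + (dsym 2 k * cf v 2 k + dsym 3 k * cf v 3 k)
    = 2 * pi * \<i> * (complex_of_int (k $ 1) * cf v 1 k + complex_of_int (k $ 2) * cf v 2 k + complex_of_int (k $ 3) * cf v 3 k)"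
    by (simp add: dsym_def algebra_simps)
  then show ?thesis by (simp add: div_free_3)
qed

lemma div_A: "(\<Sum>i\<in>UNIV. A i i x) = 0"
proof -
  have "fser (\<lambda>k. dsym 1 k * cf v 1 k + (dsym 2 k * cf v 2 k + dsym 3 k * cf v 3 k)) x =
    fser (\<lambda>k. dsym 1 k * cf v 1 k) x + (fser (\<lambda>k. dsym 2 k * cf v 2 k) x + fser (\<lambda>k. dsym 3 k * cf v 3 k) x)"
    by (simp only: fser_add abs_coef_1 abs_coef_add)
  then show ?thesis by (simp add: div_coef sum_3 A_def complex_eq_iff)
qed

lemma div_H: "(\<Sum>i\<in>UNIV. H l i i x) = 0"
proof -
  have "fser (\<lambda>k. dsym l k * (dsym 1 k * cf v 1 k) + (dsym l k * (dsym 2 k * cf v 2 k) + dsym l k * (dsym 3 k * cf v 3 k))) x =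
    fser (\<lambda>k. dsym l k * (dsym 1 k * cf v 1 k)) x + (fser (\<lambda>k. dsym l k * (dsym 2 k * cf v 2 k)) x + fser (\<lambda>k. dsym l k * (dsym 3 k * cf v 3 k)) x)"
    by (simp only: fser_add abs_coef_2 abs_coef_add)
  moreover have "dsym l k * (dsym 1 k * cf v 1 k) + (dsym l k * (dsym 2 k * cf v 2 k) + dsym l k * (dsym 3 k * cf v 3 k)) = 0" for k
    using div_coef[of k] by (simp only: distrib_left[symmetric] mult_zero_right)
  ultimately show ?thesis by (simp add: sum_3 H_def complex_eq_iff)
qed

lemma ibp_UAA:
  "(LINT x|T3. A m j x * A p i x * A q l x + U j x * H m p i x * A q l x + U j x * A p i x * H m q l x) = 0"
  unfolding U_def A_def H_def
  by (intro integral_derivation_real3 herm_0 herm_1 abs_coef_0 abs_coef_1 abs_coef_2)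

text \<open>The integrand is half of u applied as a derivation to the squared gradient, and
  transport by a divergence-free field does not change an integral.\<close>

lemma integral_UHA_symmetric: "(LINT x|T3. (\<Sum>i\<in>UNIV. \<Sum>j\<in>UNIV. \<Sum>l\<in>UNIV. U j x * H j l i x * A l i x)) = 0"
proof -
  have "(LINT x|T3. (\<Sum>i\<in>UNIV. \<Sum>j\<in>UNIV. \<Sum>l\<in>UNIV.
      A j j x * A l i x * A l i x + U j x * H j l i x * A l i x + U j x * A l i x * H j l i x)) = 0"
    by (rule integral_sum3_eq_0) (intro bounded_UAH, rule ibp_UAA)
  moreover have "(\<Sum>i\<in>UNIV. \<Sum>j\<in>UNIV. \<Sum>l\<in>UNIV.
      A j j x * A l i x * A l i x + U j x * H j l i x * A l i x + U j x * A l i x * H j l i x)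
    = 2 * (\<Sum>i\<in>UNIV. \<Sum>j\<in>UNIV. \<Sum>l\<in>UNIV. U j x * H j l i x * A l i x)" for x
  proof -
    have "(\<Sum>i\<in>UNIV. \<Sum>j\<in>UNIV. \<Sum>l\<in>UNIV. A j j x * A l i x * A l i x)
      = (\<Sum>i\<in>(UNIV::3 set). (\<Sum>j\<in>UNIV. A j j x) * (\<Sum>l\<in>UNIV. A l i x * A l i x))"
      by (simp add: sum_product mult.assoc)
    then have "(\<Sum>i\<in>UNIV. \<Sum>j\<in>UNIV. \<Sum>l\<in>UNIV. A j j x * A l i x * A l i x) = 0"
      by (simp add: div_A)
    moreover have "U j x * A l i x * H j l i x = U j x * H j l i x * A l i x" for i j l by simp
    ultimately show ?thesis
      by (simp only: sum.distrib)
  qed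
  ultimately show ?thesis by simp
qed

text \<open>One derivative is moved off the Laplacian. It falls either on the velocity, which gives
  the cubic term, or on the gradient, which gives the transport term already known to
  vanish.\<close>

lemma integral_AAH:
  "(LINT x|T3. (\<Sum>i\<in>UNIV. \<Sum>j\<in>UNIV. \<Sum>l\<in>UNIV. U j x * A j i x * H l l i x))
   = - (LINT x|T3. (\<Sum>i\<in>UNIV. \<Sum>j\<in>UNIV. \<Sum>l\<in>UNIV. A l j x * A j i x * A l i x))"
proof -
  have b: "bounded_T3 (\<lambda>x. \<Sum>i\<in>UNIV. \<Sum>j\<in>UNIV. \<Sum>l\<in>UNIV. U j x * A j i x * H l l i x)"
    "bounded_T3 (\<lambda>x. \<Sum>i\<in>UNIV. \<Sum>j\<in>UNIV. \<Sum>l\<in>UNIV. A l j x * A j i x * A l i x)"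
    "bounded_T3 (\<lambda>x. \<Sum>i\<in>UNIV. \<Sum>j\<in>UNIV. \<Sum>l\<in>UNIV. U j x * H j l i x * A l i x)"
    by (intro bounded_T3_sum finite bounded_UAH)+
  have "(LINT x|T3. (\<Sum>i\<in>UNIV. \<Sum>j\<in>UNIV. \<Sum>l\<in>UNIV.
      A l j x * A j i x * A l i x + U j x * H j l i x * A l i x + U j x * A j i x * H l l i x)) = 0"
    by (rule integral_sum3_eq_0) (intro bounded_UAH, subst H_commute, rule ibp_UAA)
  then have "(LINT x|T3. (\<Sum>i\<in>UNIV. \<Sum>j\<in>UNIV. \<Sum>l\<in>UNIV. A l j x * A j i x * A l i x)
     + (\<Sum>i\<in>UNIV. \<Sum>j\<in>UNIV. \<Sum>l\<in>UNIV. U j x * H j l i x * A l i x)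
     + (\<Sum>i\<in>UNIV. \<Sum>j\<in>UNIV. \<Sum>l\<in>UNIV. U j x * A j i x * H l l i x)) = 0"
    by (simp only: sum.distrib)
  then show ?thesis
    using integral_UHA_symmetric b[THEN bounded_T3_integrable] by simp
qed

text \<open>Two integrations by parts. Differentiating u_j (d_i u_l) (d_l u_i) in direction j kills
  the integral of u_j (d_j d_i u_l) (d_l u_i); differentiating u_j (d_j u_l) (d_l u_i) in direction
  i expresses the cubic term through that integral and a multiple of d_l div u.\<close>

lemma integral_trace_cube: "(LINT x|T3. (\<Sum>i\<in>UNIV. \<Sum>j\<in>UNIV. \<Sum>l\<in>UNIV. A i j x * A j l x * A l i x)) = 0"
proof -
  have b: "bounded_T3 (\<lambda>x. \<Sum>i\<in>UNIV. \<Sum>j\<in>UNIV. \<Sum>l\<in>UNIV. A i j x * A j l x * A l i x)"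
    "bounded_T3 (\<lambda>x. \<Sum>i\<in>UNIV. \<Sum>j\<in>UNIV. \<Sum>l\<in>UNIV. U j x * H i j l x * A l i x)"
    by (intro bounded_T3_sum finite bounded_UAH)+
  have "(LINT x|T3. (\<Sum>i\<in>UNIV. \<Sum>j\<in>UNIV. \<Sum>l\<in>UNIV.
      A j j x * A i l x * A l i x + U j x * H j i l x * A l i x + U j x * A i l x * H j l i x)) = 0"
    by (rule integral_sum3_eq_0) (intro bounded_UAH, rule ibp_UAA)
  moreover have "(\<Sum>i\<in>UNIV. \<Sum>j\<in>UNIV. \<Sum>l\<in>UNIV.
      A j j x * A i l x * A l i x + U j x * H j i l x * A l i x + U j x * A i l x * H j l i x)
    = 2 * (\<Sum>i\<in>UNIV. \<Sum>j\<in>UNIV. \<Sum>l\<in>UNIV. U j x * H i j l x * A l i x)" for x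
  proof -
    have "(\<Sum>i\<in>UNIV. \<Sum>j\<in>UNIV. \<Sum>l\<in>UNIV. A j j x * A i l x * A l i x)
      = (\<Sum>i\<in>(UNIV::3 set). (\<Sum>j\<in>UNIV. A j j x) * (\<Sum>l\<in>UNIV. A i l x * A l i x))"
      by (simp add: sum_product mult.assoc)
    then have 1: "(\<Sum>i\<in>UNIV. \<Sum>j\<in>UNIV. \<Sum>l\<in>UNIV. A j j x * A i l x * A l i x) = 0"
      by (simp add: div_A)
    \<comment> \<open>Exchanging the names of \<open>i\<close> and \<open>l\<close> identifies the
      two halves of the Leibniz expansion.\<close>
    have "(\<Sum>i\<in>UNIV. \<Sum>j\<in>UNIV. \<Sum>l\<in>UNIV. U j x * A i l x * H j l i x)
      = (\<Sum>l\<in>UNIV. \<Sum>j\<in>UNIV. \<Sum>i\<in>UNIV. U j x * A i l x * H j l i x)"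
      by (subst sum.swap, subst (2) sum.swap, subst sum.swap) (rule refl)
    also have "\<dots> = (\<Sum>i\<in>UNIV. \<Sum>j\<in>UNIV. \<Sum>l\<in>UNIV. U j x * H i j l x * A l i x)"
      by (intro sum.cong refl) (subst H_commute, simp)
    finally have 2: "(\<Sum>i\<in>UNIV. \<Sum>j\<in>UNIV. \<Sum>l\<in>UNIV. U j x * A i l x * H j l i x)
      = (\<Sum>i\<in>UNIV. \<Sum>j\<in>UNIV. \<Sum>l\<in>UNIV. U j x * H i j l x * A l i x)" .
    have "(\<Sum>i\<in>UNIV. \<Sum>j\<in>UNIV. \<Sum>l\<in>UNIV. U j x * H j i l x * A l i x)
      = (\<Sum>i\<in>UNIV. \<Sum>j\<in>UNIV. \<Sum>l\<in>UNIV. U j x * H i j l x * A l i x)"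
      by (intro sum.cong refl) (subst H_commute, rule refl)
    then show ?thesis
      unfolding sum.distrib 1 2 by simp
  qed
  ultimately have 2: "(LINT x|T3. (\<Sum>i\<in>UNIV. \<Sum>j\<in>UNIV. \<Sum>l\<in>UNIV. U j x * H i j l x * A l i x)) = 0"
    by simp
  have "(LINT x|T3. (\<Sum>i\<in>UNIV. \<Sum>j\<in>UNIV. \<Sum>l\<in>UNIV.
      A i j x * A j l x * A l i x + U j x * H i j l x * A l i x + U j x * A j l x * H i l i x)) = 0"
    by (rule integral_sum3_eq_0) (intro bounded_UAH, rule ibp_UAA)
  moreover have "(\<Sum>i\<in>UNIV. \<Sum>j\<in>UNIV. \<Sum>l\<in>UNIV. U j x * A j l x * H i l i x) = 0" for x
  proof -
    have "(\<Sum>i\<in>UNIV. \<Sum>j\<in>UNIV. \<Sum>l\<in>UNIV. U j x * A j l x * H i l i x)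
      = (\<Sum>j\<in>UNIV. \<Sum>l\<in>UNIV. \<Sum>i\<in>UNIV. U j x * A j l x * H l i i x)"
      by (subst sum.swap, subst (2) sum.swap) (simp only: H_commute)
    also have "\<dots> = (\<Sum>j\<in>UNIV. \<Sum>l\<in>UNIV. U j x * A j l x * (\<Sum>i\<in>UNIV. H l i i x))"
      by (simp only: sum_distrib_left)
    finally show ?thesis by (simp add: div_H)
  qed
  ultimately have "(LINT x|T3. (\<Sum>i\<in>UNIV. \<Sum>j\<in>UNIV. \<Sum>l\<in>UNIV. A i j x * A j l x * A l i x)
     + (\<Sum>i\<in>UNIV. \<Sum>j\<in>UNIV. \<Sum>l\<in>UNIV. U j x * H i j l x * A l i x)) = 0"
    by (simp only: sum.distrib add_0_right)
  then show ?thesis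
    using 2 b[THEN bounded_T3_integrable] by simp
qed

end

section \<open>Eigenvalues of symmetric matrices\<close>

text \<open>The sum of the principal two-by-two minors, which is the second elementary symmetric
  function of the eigenvalues.\<close>

definition e2_minor :: "'a::comm_ring_1^3^3 \<Rightarrow> 'a" where
  "e2_minor A = (A$1$1 * A$2$2 - A$1$2 * A$2$1) + (A$1$1 * A$3$3 - A$1$3 * A$3$1) + (A$2$2 * A$3$3 - A$2$3 * A$3$2)"

definition tr3 :: "'a::comm_ring_1^3^3 \<Rightarrow> 'a" where
  "tr3 A = A$1$1 + A$2$2 + A$3$3"

lemma char_poly_3: "det (mat z - A) = z^3 - tr3 A * z^2 + e2_minor A * z - det A" for A :: "'a::comm_ring_1^3^3"
  by (simp add: det_3 mat_def e2_minor_def tr3_def algebra_simps power2_eq_square power3_eq_cube)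

lemma cubic_real_root: "\<exists>r::real. r^3 - a * r^2 + b * r - c = 0"
proof -
  \<comment> \<open>A Cauchy-type root bound: at distance \<open>R\<close> the leading term
    dominates the rest, so the cubic has opposite signs at \<open>R\<close> and
    \<open>- R\<close>.\<close>
  define R where "R = 1 + \<bar>a\<bar> + \<bar>b\<bar> + \<bar>c\<bar>"
  let ?p = "\<lambda>r. r^3 - a * r^2 + b * r - c"
  have R: "R \<ge> 1" by (simp add: R_def)
  have RR: "R \<le> R^2" "1 \<le> R^2" using R by (auto simp: power2_eq_square intro: mult_le_cancel_left1[THEN iffD2] order_trans[of 1 R])
  have "\<bar>a * R^2\<bar> = \<bar>a\<bar> * R^2" by (simp add: abs_mult)
  moreover have "\<bar>b * R\<bar> \<le> \<bar>b\<bar> * R^2" using RR R by (simp add: abs_mult mult_left_mono)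
  moreover have "\<bar>c\<bar> \<le> \<bar>c\<bar> * R^2" using RR by (simp add: mult_le_cancel_left1)
  moreover have "R^3 = R^2 + \<bar>a\<bar> * R^2 + \<bar>b\<bar> * R^2 + \<bar>c\<bar> * R^2"
    by (subst power3_eq_cube, subst (1) R_def) (simp add: power2_eq_square algebra_simps)
  ultimately have "?p R \<ge> 0" "?p (- R) \<le> 0"
    using RR by (simp_all add: abs_le_iff, linarith+)
  moreover have "\<forall>x. - R \<le> x \<and> x \<le> R \<longrightarrow> isCont ?p x" by (intro allI impI continuous_intros)
  ultimately show ?thesis
    using IVT[of ?p "- R" 0 R] R by auto
qed

text \<open>The hypothesis says that \<open>w\<close> is a root of the characteristic polynomial,
  hence has a complex eigenvector x. The classical argument that the quadratic form at x is real is
  carried out in real and imaginary parts and gives Im w |x|^2 = 0.\<close>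

lemma symmetric_eigenvalue_real:
  fixes A :: "real^3^3" and w :: complex
  assumes sym: "\<And>i j. A$i$j = A$j$i"
    and w: "w^3 - complex_of_real (tr3 A) * w^2 + complex_of_real (e2_minor A) * w - complex_of_real (det A) = 0"
  shows "Im w = 0"
proof -
  define B :: "complex^3^3" where "B = (\<chi> i j. complex_of_real (A$i$j))"
  have "tr3 B = complex_of_real (tr3 A)" "e2_minor B = complex_of_real (e2_minor A)" "det B = complex_of_real (det A)"
    by (simp_all add: B_def tr3_def e2_minor_def det_3)
  then have "det (mat w - B) = 0" using w by (simp add: char_poly_3)
  then have "\<not> invertible (mat w - B)" by (simp add: invertible_det_nz)
  then obtain x where x: "x \<noteq> 0" "(mat w - B) *v x = 0"
    by (auto simp: invertible_left_inverse matrix_left_invertible_ker)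
  have row: "B$i$1 * x$1 + B$i$2 * x$2 + B$i$3 * x$3 = w * x$i" for i
    using x(2) exhaust_3[of i] by (auto simp: vec_eq_iff matrix_vector_mult_def sum_3 mat_def forall_3 algebra_simps)
  define p q where "p i = Re (x$i)" and "q i = Im (x$i)" for i
  have re: "A$i$1 * p 1 + A$i$2 * p 2 + A$i$3 * p 3 = Re w * p i - Im w * q i"
    and im: "A$i$1 * q 1 + A$i$2 * q 2 + A$i$3 * q 3 = Re w * q i + Im w * p i" for i
    using row[of i] by (simp_all add: complex_eq_iff B_def p_def q_def)
  have s: "A$2$1 = A$1$2" "A$3$1 = A$1$3" "A$3$2 = A$2$3" using sym by auto
  have "Im w * ((p 1)^2 + (p 2)^2 + (p 3)^2 + (q 1)^2 + (q 2)^2 + (q 3)^2) = 0"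
    using re[of 1] re[of 2] re[of 3] im[of 1] im[of 2] im[of 3] unfolding s by algebra
  moreover have "(p 1)^2 + (p 2)^2 + (p 3)^2 + (q 1)^2 + (q 2)^2 + (q 3)^2 \<noteq> 0"
  proof
    assume "(p 1)^2 + (p 2)^2 + (p 3)^2 + (q 1)^2 + (q 2)^2 + (q 3)^2 = 0"
    then have "(p 1)^2 = 0 \<and> (p 2)^2 = 0 \<and> (p 3)^2 = 0 \<and> (q 1)^2 = 0 \<and> (q 2)^2 = 0 \<and> (q 3)^2 = 0"
      using zero_le_power2[of "p 1"] zero_le_power2[of "p 2"] zero_le_power2[of "p 3"]
        zero_le_power2[of "q 1"] zero_le_power2[of "q 2"] zero_le_power2[of "q 3"] by linarith
    then have "x = 0" by (simp add: vec_eq_iff forall_3 p_def q_def complex_eq_iff)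
    then show False using x by simp
  qed
  ultimately show ?thesis by simp
qed

text \<open>Vieta's formulas; comparing values at 0, 1 and -1 already fixes the three lower
  coefficients of a monic cubic.\<close>

lemma ordered_eigenvalues_iff:
  "ordered_eigenvalues A l1 l2 l3 \<longleftrightarrow> l1 \<le> l2 \<and> l2 \<le> l3 \<and>
     tr3 A = l1 + l2 + l3 \<and> e2_minor A = l1 * l2 + l1 * l3 + l2 * l3 \<and> det A = l1 * l2 * l3"
proof -
  have "(\<forall>z. z^3 - a * z^2 + b * z - c = (z - l1) * (z - l2) * (z - l3)) \<longleftrightarrow>
     a = l1 + l2 + l3 \<and> b = l1 * l2 + l1 * l3 + l2 * l3 \<and> c = l1 * l2 * l3" (is "?L \<longleftrightarrow> ?R") for a b c :: real
  proof
    assume L: ?L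
    from L[rule_format, of 0] have c: "c = l1 * l2 * l3" by simp
    from L[rule_format, of 1] L[rule_format, of "-1"] c
    show ?R by (simp add: algebra_simps)
  next
    assume R: ?R
    then show ?L by (simp add: algebra_simps power2_eq_square power3_eq_cube)
  qed
  then show ?thesis by (simp add: ordered_eigenvalues_def char_poly_3)
qed

text \<open>A real root splits off a quadratic factor. A negative discriminant would make a non-real
  number an eigenvalue of a symmetric matrix, so the remaining roots are real, and the three are
  sorted.\<close>

lemma ordered_eigenvalues_exist:
  fixes A :: "real^3^3"
  assumes sym: "\<And>i j. A$i$j = A$j$i"
  shows "\<exists>l1 l2 l3. ordered_eigenvalues A l1 l2 l3"
proof -
  obtain r where r: "r^3 - tr3 A * r^2 + e2_minor A * r - det A = 0" using cubic_real_root by blast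
  define b where "b = r - tr3 A"
  define c where "c = e2_minor A + r * b"
  have fact: "z^3 - complex_of_real (tr3 A) * z^2 + complex_of_real (e2_minor A) * z - complex_of_real (det A)
     = (z - r) * (z^2 + b * z + c)" for z :: complex
  proof -
    have 1: "det A = r * c" using r by (simp add: c_def b_def algebra_simps power2_eq_square power3_eq_cube)
    have 2: "tr3 A = r - b" "e2_minor A = c - r * b" by (simp_all add: b_def c_def)
    show ?thesis
      unfolding 1 2 by (simp add: algebra_simps power2_eq_square power3_eq_cube)
  qed
  have D: "b^2 - 4 * c \<ge> 0"
  proof (rule ccontr)
    assume "\<not> ?thesis"
    then have neg: "4 * c - b^2 > 0" by simp
    define y where "y = sqrt (4 * c - b^2)"
    have y: "y > 0" "y^2 = 4 * c - b^2" using neg by (auto simp: y_def)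
    let ?w = "Complex (- b / 2) (y / 2)"
    have "?w^2 + b * ?w + c = 0"
      using y(2) by (simp add: complex_eq_iff power2_eq_square field_simps)
    then have "Im ?w = 0"
      by (intro symmetric_eigenvalue_real[OF sym]) (simp add: fact)
    then show False using y by simp
  qed
  define d where "d = sqrt (b^2 - 4 * c)"
  have d: "d \<ge> 0" "d^2 = b^2 - 4 * c" using D by (auto simp: d_def)
  define x y where "x = (- b - d) / 2" and "y = (- b + d) / 2"
  have xy: "x \<le> y" "x + y = - b" "x * y = c"
    using d by (auto simp: x_def y_def power2_eq_square field_simps)
  have det: "det A = r * c" using r by (simp add: c_def b_def algebra_simps power2_eq_square power3_eq_cube)
  have "tr3 A = r + x + y" using b_def xy(2) by linarith
  moreover have "e2_minor A = r * x + r * y + x * y" using c_def xy(2,3) by algebra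
  moreover have "det A = r * x * y" using det xy(3) by (simp add: mult.assoc)
  ultimately have e: "tr3 A = r + x + y" "e2_minor A = r * x + r * y + x * y" "det A = r * x * y" .
  consider "r \<le> x" | "x \<le> r" "r \<le> y" | "y \<le> r" by linarith
  then show ?thesis
  proof cases
    case 1
    then have "ordered_eigenvalues A r x y" using e xy by (simp add: ordered_eigenvalues_iff)
    then show ?thesis by blast
  next
    case 2
    then have "ordered_eigenvalues A x r y" using e xy by (simp add: ordered_eigenvalues_iff mult_ac)
    then show ?thesis by blast
  next
    case 3
    then have "ordered_eigenvalues A x y r" using e xy by (simp add: ordered_eigenvalues_iff mult_ac)
    then show ?thesis by blast
  qed
qed

text \<open>The smallest root of either factorisation is a root of the other, and likewise the
  largest, so the extremes agree and the trace determines the middle one.\<close>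

lemma ordered_eigenvalues_unique:
  assumes l: "ordered_eigenvalues A l1 l2 l3" and m: "ordered_eigenvalues A m1 m2 m3"
  shows "l2 = m2"
proof -
  have eq: "(z - l1) * (z - l2) * (z - l3) = (z - m1) * (z - m2) * (z - m3)" for z
    using l m unfolding ordered_eigenvalues_def by metis
  have o: "l1 \<le> l2" "l2 \<le> l3" "m1 \<le> m2" "m2 \<le> m3"
    using l m by (auto simp: ordered_eigenvalues_def)
  have "m1 \<le> l1" using eq[of l1] o by auto
  moreover have "l1 \<le> m1" using eq[of m1] o by auto
  moreover have "l3 \<le> m3" using eq[of l3] o by auto
  moreover have "m3 \<le> l3" using eq[of m3] o by auto
  moreover have "l1 + l2 + l3 = m1 + m2 + m3"
    using l m by (auto simp: ordered_eigenvalues_iff)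
  ultimately show ?thesis by simp
qed

lemma lambda2_eq: "ordered_eigenvalues A l1 l2 l3 \<Longrightarrow> lambda2 A = l2"
  unfolding lambda2_def by (rule the_equality) (auto dest: ordered_eigenvalues_unique)

lemma norm_sq_symmetric:
  fixes A :: "real^3^3"
  assumes sym: "\<And>i j. A$i$j = A$j$i"
  shows "(norm A)^2 = (tr3 A)^2 - 2 * e2_minor A"
proof -
  have s: "A$2$1 = A$1$2" "A$3$1 = A$1$3" "A$3$2 = A$2$3" using sym by auto
  show ?thesis
    unfolding power2_norm_eq_inner by (simp add: inner_vec_def sum_3 s tr3_def e2_minor_def power2_eq_square algebra_simps)
qed

lemma abs_lambda2_le_norm:
  fixes A :: "real^3^3"
  assumes sym: "\<And>i j. A$i$j = A$j$i"
  shows "\<bar>lambda2 A\<bar> \<le> norm A"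
proof -
  obtain l1 l2 l3 where o: "ordered_eigenvalues A l1 l2 l3"
    using ordered_eigenvalues_exist[OF sym] by blast
  have "(norm A)^2 = l1^2 + l2^2 + l3^2"
    unfolding norm_sq_symmetric[OF sym] using o by (auto simp: ordered_eigenvalues_iff power2_eq_square algebra_simps)
  then have "l2^2 \<le> (norm A)^2" by simp
  then show ?thesis
    unfolding lambda2_eq[OF o] by (metis abs_le_square_iff abs_norm_cancel)
qed

text \<open>If the middle eigenvalue is nonnegative, the product of the outer two is controlled by
  half the sum of their squares. If it is negative, so is the smallest, the trace forces the largest
  to be nonnegative, and the determinant is nonnegative.\<close>

lemma det_le_lambda2:
  fixes A :: "real^3^3"
  assumes sym: "\<And>i j. A$i$j = A$j$i" and tr: "tr3 A = 0"
  shows "- 4 * det A \<le> 2 * (max (lambda2 A) 0 * (norm A)^2)"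
proof -
  obtain l1 l2 l3 where o: "ordered_eigenvalues A l1 l2 l3"
    using ordered_eigenvalues_exist[OF sym] by blast
  have n: "(norm A)^2 = l1^2 + l2^2 + l3^2"
    unfolding norm_sq_symmetric[OF sym] using o by (auto simp: ordered_eigenvalues_iff power2_eq_square algebra_simps)
  have l: "l1 \<le> l2" "l2 \<le> l3" "l1 + l2 + l3 = 0" "det A = l1 * l2 * l3"
    using o tr by (auto simp: ordered_eigenvalues_iff)
  show ?thesis
  proof (cases "l2 \<ge> 0")
    case True
    have "- (2 * (l1 * l3)) \<le> l1^2 + l3^2"
      using zero_le_power2[of "l1 + l3"] by (simp add: power2_eq_square algebra_simps)
    then have "- (2 * (l1 * l3)) \<le> l1^2 + l2^2 + l3^2"
      using zero_le_power2[of l2] by linarith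
    then have "(2 * l2) * (- (2 * (l1 * l3))) \<le> (2 * l2) * (l1^2 + l2^2 + l3^2)"
      using True by (intro mult_left_mono) auto
    then show ?thesis
      unfolding lambda2_eq[OF o] n l(4) using True by (simp add: algebra_simps)
  next
    case False
    then have "l1 * l2 \<ge> 0" "l3 \<ge> 0" using l by (auto intro: mult_nonpos_nonpos)
    then have "l1 * l2 * l3 \<ge> 0" by simp
    then show ?thesis
      unfolding lambda2_eq[OF o] n l(4) using False by simp
  qed
qed

text \<open>
  The set \<open>{a \<le> \<lambda>\<^sub>2}\<close> is the preimage, under the coefficients of the characteristic polynomial, of a
  countable union of compact images of sets of ordered triples.
\<close>

lemma lambda2_measurable:
  fixes F :: "'x \<Rightarrow> real^3^3"
  assumes F: "\<And>i j. (\<lambda>x. F x $ i $ j) \<in> borel_measurable M" and sym: "\<And>x i j. F x $ i $ j = F x $ j $ i"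
  shows "(\<lambda>x. lambda2 (F x)) \<in> borel_measurable M"
  unfolding borel_measurable_iff_ge
proof
  fix a :: real
  note [measurable] = F
  define E where "E x = (tr3 (F x), e2_minor (F x), det (F x))" for x
  define g where "g = (\<lambda>(l1::real, l2::real, l3::real). (l1 + l2 + l3, l1 * l2 + l1 * l3 + l2 * l3, l1 * l2 * l3))"
  \<comment> \<open>Exhaustion by boxes is needed because a continuous image of a closed set need
    not be closed, whereas images of compact sets are.\<close>
  define K where "K n = cbox (- real n, - real n, - real n) (real n, real n, real n)
      \<inter> {p. fst p \<le> fst (snd p) \<and> fst (snd p) \<le> snd (snd p) \<and> a \<le> fst (snd p)}" for n
  have [measurable]: "E \<in> borel_measurable M"
    unfolding E_def tr3_def e2_minor_def det_3 by measurable
  have "compact (K n)" for n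
    unfolding K_def
    by (intro compact_Int_closed compact_cbox closed_Collect_conj closed_Collect_le continuous_intros)
  moreover have "continuous_on UNIV g"
    unfolding g_def case_prod_unfold by (intro continuous_intros)
  ultimately have "compact (g ` K n)" for n
    by (intro compact_continuous_image) (auto intro: continuous_on_subset)
  then have [measurable]: "g ` K n \<in> sets borel" for n
    by (intro borel_closed compact_imp_closed)
  have "a \<le> lambda2 (F x) \<longleftrightarrow> (\<exists>n. E x \<in> g ` K n)" for x
  proof
    assume a: "a \<le> lambda2 (F x)"
    obtain l1 l2 l3 where o: "ordered_eigenvalues (F x) l1 l2 l3"
      using ordered_eigenvalues_exist[OF sym] by blast
    obtain n :: nat where n: "\<bar>l1\<bar> + \<bar>l2\<bar> + \<bar>l3\<bar> \<le> real n" using real_arch_simple by blast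
    have "(l1, l2, l3) \<in> K n"
      using o n a by (auto simp: K_def lambda2_eq[OF o] ordered_eigenvalues_def cbox_Pair_eq)
    moreover have "E x = g (l1, l2, l3)"
      using o by (simp add: E_def g_def ordered_eigenvalues_iff)
    ultimately show "\<exists>n. E x \<in> g ` K n" by blast
  next
    assume "\<exists>n. E x \<in> g ` K n"
    then obtain n l1 l2 l3 where l: "(l1, l2, l3) \<in> K n" "E x = g (l1, l2, l3)" by force
    then have o: "ordered_eigenvalues (F x) l1 l2 l3"
      by (simp add: K_def E_def g_def ordered_eigenvalues_iff)
    show "a \<le> lambda2 (F x)"
      using l by (simp add: lambda2_eq[OF o] K_def)
  qed
  then have "{x \<in> space M. a \<le> lambda2 (F x)} = {x \<in> space M. \<exists>n. E x \<in> g ` K n}" by auto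
  also have "\<dots> \<in> sets M" by measurable
  finally show "{x \<in> space M. a \<le> lambda2 (F x)} \<in> sets M" .
qed

section \<open>Enstrophy balance\<close>

context smooth_M
begin

abbreviation "NL i \<equiv> fourier_mult (\<lambda>k. complex_of_real (lap_symbol k powr 1)) (\<lambda>x. v x $ i)"

lemma neg_lap_nth: "neg_lap v x $ i = NL i x"
  by (simp add: neg_lap_def neg_lap_pow_def)

lemma lap_coef_eq: "(\<lambda>k. complex_of_real (lap_symbol k powr 1) * cf v i k) =
   (\<lambda>k. (-1) * (dsym 1 k * (dsym 1 k * cf v i k) + (dsym 2 k * (dsym 2 k * cf v i k) + dsym 3 k * (dsym 3 k * cf v i k))))"
  by (rule ext) (simp add: lap_symbol_3 dsym_def algebra_simps power2_eq_square)

lemma lap_abs_coef: "abs_coef (\<lambda>k. complex_of_real (lap_symbol k powr 1) * cf v i k)"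
  unfolding lap_coef_eq by (intro abs_coef_cmult abs_coef_add abs_coef_2)

lemma NL_properties: "NL i \<in> L2" "fcoef (NL i) k = complex_of_real (lap_symbol k powr 1) * cf v i k"
proof -
  have "herm (\<lambda>k. complex_of_real (lap_symbol k powr 1) * cf v i k)"
    using herm_0[of i] by (simp add: herm_def lap_symbol_def rvec_minus)
  then show "NL i \<in> L2" "fcoef (NL i) k = complex_of_real (lap_symbol k powr 1) * cf v i k"
    using fourier_mult_properties[of "\<lambda>k. complex_of_real (lap_symbol k powr 1)" "\<lambda>x. v x $ i"] lap_abs_coef[of i]
    by (simp_all add: cf_def)
qed

lemma fser_lap: "Re (fser (\<lambda>k. complex_of_real (lap_symbol k powr 1) * cf v i k) x) = - (\<Sum>l\<in>UNIV. H l l i x)"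
proof -
  have "fser (\<lambda>k. complex_of_real (lap_symbol k powr 1) * cf v i k) x
    = (-1) * (fser (\<lambda>k. dsym 1 k * (dsym 1 k * cf v i k)) x + (fser (\<lambda>k. dsym 2 k * (dsym 2 k * cf v i k)) x
       + fser (\<lambda>k. dsym 3 k * (dsym 3 k * cf v i k)) x))"
    unfolding lap_coef_eq fser_cmult by (simp only: fser_add abs_coef_add abs_coef_2)
  then show ?thesis by (simp add: H_def sum_3)
qed

text \<open>There are finitely many components, so one null set serves for all; outside it the
  chosen representatives coincide with series, and the algebra can be done pointwise.\<close>

lemma AE_fields:
  "AE x in T3. (\<forall>i. v x $ i = U i x) \<and> (\<forall>l i. G l i x = A l i x) \<and> (\<forall>i. neg_lap v x $ i = - (\<Sum>l\<in>UNIV. H l l i x))"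
proof -
  have re: "AE x in T3. f x = Re (fser (fcoef f) x)" if "f \<in> L2" "abs_coef (fcoef f)" for f
    using L2_eq_fser[OF that] by eventually_elim (metis Re_complex_of_real)
  have "AE x in T3. \<forall>i. v x $ i = U i x"
    using re[OF HdotM_L2_nth[OF vM]] abs_coef_0 by (intro eventually_all_finite) (simp add: U_def cf_def)
  moreover have "AE x in T3. \<forall>l i. G l i x = A l i x"
    using re[OF G_L2] abs_coef_1 by (intro eventually_all_finite) (simp add: A_def G_coef[abs_def])
  moreover have "AE x in T3. \<forall>i. neg_lap v x $ i = - (\<Sum>l\<in>UNIV. H l l i x)"
    using re[OF NL_properties(1)] lap_abs_coef
    by (intro eventually_all_finite) (simp only: neg_lap_nth NL_properties(2)[abs_def] fser_lap)
  ultimately show ?thesis by eventually_elim blast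
qed

lemma components_measurable [measurable]:
  "(\<lambda>x. v x $ i) \<in> borel_measurable T3" "G l i \<in> borel_measurable T3" "NL i \<in> borel_measurable T3"
  "(\<lambda>x. strain v x $ l $ i) \<in> borel_measurable T3" "(\<lambda>x. vorticity v x $ i) \<in> borel_measurable T3"
  using HdotM_L2_nth[OF vM, of i] G_L2[of l i] NL_properties(1)[of i] strain_nth_L2[of l i] vorticity_nth_L2[of i]
  by (auto simp: L2_def)

text \<open>With M the matrix of the \<open>A l i x\<close>, \<open>X\<close> is the trace of M M
  M^T and \<open>Y\<close> is the trace of M^3.\<close>

definition X :: "real^3 \<Rightarrow> real" where "X x = (\<Sum>i\<in>UNIV. \<Sum>j\<in>UNIV. \<Sum>l\<in>UNIV. A l j x * A j i x * A l i x)"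
definition Y :: "real^3 \<Rightarrow> real" where "Y x = (\<Sum>i\<in>UNIV. \<Sum>j\<in>UNIV. \<Sum>l\<in>UNIV. A i j x * A j l x * A l i x)"

lemma integrable_XY: "integrable T3 X" "integrable T3 Y"
  unfolding X_def[abs_def] Y_def[abs_def]
  by (intro bounded_T3_integrable bounded_T3_sum finite bounded_UAH)+

lemma integral_Y: "(LINT x|T3. Y x) = 0"
  unfolding Y_def by (rule integral_trace_cube)

lemma integral_AE_eq:
  fixes f g :: "real^3 \<Rightarrow> real"
  assumes "AE x in T3. f x = g x" "f \<in> borel_measurable T3" "integrable T3 g"
  shows "integrable T3 f" "(LINT x|T3. f x) = (LINT x|T3. g x)"
  using assms by (auto intro: integrable_cong_AE_imp integral_cong_AE)

lemma convect_neg_lap: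
  "integrable T3 (\<lambda>x. convect v v x \<bullet> neg_lap v x)" "l2_inner (convect v v) (neg_lap v) = (LINT x|T3. X x)"
proof -
  let ?g = "\<lambda>x. - (\<Sum>i\<in>UNIV. \<Sum>j\<in>UNIV. \<Sum>l\<in>UNIV. U j x * A j i x * H l l i x)"
  have ig: "integrable T3 (\<lambda>x. \<Sum>i\<in>UNIV. \<Sum>j\<in>UNIV. \<Sum>l\<in>UNIV. U j x * A j i x * H l l i x)"
    by (intro bounded_T3_integrable bounded_T3_sum finite bounded_UAH)
  have ae: "AE x in T3. convect v v x \<bullet> neg_lap v x = ?g x"
    using AE_fields
  proof eventually_elim
    case (elim x)
    then have "convect v v x \<bullet> neg_lap v x = (\<Sum>i\<in>UNIV. (\<Sum>j\<in>UNIV. U j x * A j i x) * (- (\<Sum>l\<in>UNIV. H l l i x)))"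
      by (simp add: inner_vec_def convect_def)
    then show ?case by (simp add: sum_product sum_negf mult.assoc)
  qed
  have m: "(\<lambda>x. convect v v x \<bullet> neg_lap v x) \<in> borel_measurable T3"
    unfolding inner_vec_def convect_def neg_lap_nth inner_real_def vec_lambda_beta by measurable
  show "integrable T3 (\<lambda>x. convect v v x \<bullet> neg_lap v x)"
    using integral_AE_eq(1)[OF ae m] ig by simp
  show "l2_inner (convect v v) (neg_lap v) = (LINT x|T3. X x)"
    unfolding l2_inner_def integral_AE_eq(2)[OF ae m Bochner_Integration.integrable_minus[OF ig]]
    using ig integral_AAH by (simp add: X_def)
qed

lemma AE_strain:
  "AE x in T3. strain v x = (\<chi> l i. (A l i x + A i l x) / 2) \<and>
     vorticity v x = vector [A 2 3 x - A 3 2 x, A 3 1 x - A 1 3 x, A 1 2 x - A 2 1 x]"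
  using AE_fields by eventually_elim (simp add: strain_def vorticity_def)

text \<open>The two cubic identities form a linear system for the determinant and the vortex
  stretching, solved here. Since \<open>Y\<close> has integral zero, both integrals become multiples
  of that of \<open>X\<close>.\<close>

lemma AE_strain_cubic:
  "AE x in T3. det (strain v x) = (3 * X x + Y x) / 12 \<and>
     strain v x \<bullet> outer (vorticity v x) (vorticity v x) = Y x - X x"
  using AE_strain
proof eventually_elim
  case (elim x)
  have "A 1 1 x + A 2 2 x + A 3 3 x = 0" using div_A[of x] by (simp add: sum_3)
  from gradient_cubic_identities[of "\<lambda>l i. A l i x", OF this] elim show ?case
    by (simp add: X_def Y_def)
qed

lemma det_strain: "integrable T3 (\<lambda>x. det (strain v x))" "(LINT x|T3. det (strain v x)) = 1/4 * (LINT x|T3. X x)"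
proof -
  have ae: "AE x in T3. det (strain v x) = (3 * X x + Y x) / 12"
    using AE_strain_cubic by eventually_elim simp
  have m: "(\<lambda>x. det (strain v x)) \<in> borel_measurable T3"
    unfolding det_3 by measurable
  have i: "integrable T3 (\<lambda>x. (3 * X x + Y x) / 12)"
    using integrable_XY by simp
  show "integrable T3 (\<lambda>x. det (strain v x))" by (rule integral_AE_eq(1)[OF ae m i])
  show "(LINT x|T3. det (strain v x)) = 1/4 * (LINT x|T3. X x)"
    unfolding integral_AE_eq(2)[OF ae m i] using integrable_XY integral_Y by simp
qed

lemma strain_vorticity:
  "integrable T3 (\<lambda>x. strain v x \<bullet> outer (vorticity v x) (vorticity v x))"
  "(LINT x|T3. strain v x \<bullet> outer (vorticity v x) (vorticity v x)) = - (LINT x|T3. X x)"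
proof -
  have ae: "AE x in T3. strain v x \<bullet> outer (vorticity v x) (vorticity v x) = Y x - X x"
    using AE_strain_cubic by eventually_elim simp
  have m: "(\<lambda>x. strain v x \<bullet> outer (vorticity v x) (vorticity v x)) \<in> borel_measurable T3"
    unfolding inner_vec_def outer_def inner_real_def vec_lambda_beta by measurable
  have i: "integrable T3 (\<lambda>x. Y x - X x)"
    using integrable_XY by simp
  show "integrable T3 (\<lambda>x. strain v x \<bullet> outer (vorticity v x) (vorticity v x))" by (rule integral_AE_eq(1)[OF ae m i])
  show "(LINT x|T3. strain v x \<bullet> outer (vorticity v x) (vorticity v x)) = - (LINT x|T3. X x)"
    unfolding integral_AE_eq(2)[OF ae m i] using integrable_XY integral_Y by simp
qed

lemma strain_sym: "strain v x $ i $ j = strain v x $ j $ i"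
  by (simp add: strain_def add.commute)

lemma lambda2_strain_integrable: "integrable T3 (\<lambda>x. max (lambda2 (strain v x)) 0 * (norm (strain v x))\<^sup>2)"
proof -
  \<comment> \<open>This is |S|^2 written in terms of the series. Since |S| is at most 1 + |S|^2,
    the majorant is a polynomial in bounded functions and no square root occurs.\<close>
  define nb where "nb x = (\<Sum>l\<in>UNIV. \<Sum>i\<in>UNIV. ((1/2) * (A l i x + A i l x)) * ((1/2) * (A l i x + A i l x)))" for x
  have "bounded_T3 nb"
    unfolding nb_def[abs_def] by (intro bounded_T3_sum finite bounded_UAH bounded_T3_const)
  then have i: "integrable T3 (\<lambda>x. (1 + nb x) * nb x)"
    by (intro bounded_T3_integrable bounded_T3_mult bounded_T3_add bounded_T3_const)
  have nm: "(norm (strain v x))\<^sup>2 = (\<Sum>l\<in>UNIV. \<Sum>i\<in>UNIV. strain v x $ l $ i * strain v x $ l $ i)" for x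
    unfolding power2_norm_eq_inner by (simp add: inner_vec_def)
  have [measurable]: "(\<lambda>x. lambda2 (strain v x)) \<in> borel_measurable T3"
    by (rule lambda2_measurable) (auto simp: strain_sym)
  show ?thesis
  proof (rule Bochner_Integration.integrable_bound[OF i])
    show "(\<lambda>x. max (lambda2 (strain v x)) 0 * (norm (strain v x))\<^sup>2) \<in> borel_measurable T3"
      unfolding nm by measurable
    show "AE x in T3. norm (max (lambda2 (strain v x)) 0 * (norm (strain v x))\<^sup>2) \<le> norm ((1 + nb x) * nb x)"
      using AE_strain
    proof eventually_elim
      case (elim x)
      let ?n = "norm (strain v x)"
      have nb: "nb x = ?n\<^sup>2" unfolding nm nb_def by (simp add: conjunct1[OF elim])
      have "max (lambda2 (strain v x)) 0 \<le> ?n"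
        using abs_lambda2_le_norm[of "strain v x", OF strain_sym] by auto
      also have "?n \<le> 1 + ?n\<^sup>2"
        using zero_le_power2[of "?n - 1/2"] by (simp add: power2_eq_square algebra_simps)
      finally have "max (lambda2 (strain v x)) 0 * ?n\<^sup>2 \<le> (1 + ?n\<^sup>2) * ?n\<^sup>2"
        by (rule mult_right_mono) simp
      then show ?case by (simp add: nb)
    qed
  qed
qed

lemma det_strain_le_lambda2:
  "- 4 * (LINT x|T3. det (strain v x)) \<le> 2 * (LINT x|T3. max (lambda2 (strain v x)) 0 * (norm (strain v x))\<^sup>2)"
proof -
  have "(LINT x|T3. - 4 * det (strain v x)) \<le> (LINT x|T3. 2 * (max (lambda2 (strain v x)) 0 * (norm (strain v x))\<^sup>2))"
  proof (rule integral_mono_AE)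
    show "AE x in T3. - 4 * det (strain v x) \<le> 2 * (max (lambda2 (strain v x)) 0 * (norm (strain v x))\<^sup>2)"
      using AE_strain
    proof eventually_elim
      case (elim x)
      have "tr3 (strain v x) = 0" using div_A[of x] elim by (simp add: tr3_def sum_3)
      then show ?case by (rule det_le_lambda2[OF strain_sym])
    qed
  qed (use det_strain(1) lambda2_strain_integrable in auto)
  then show ?thesis by simp
qed

text \<open>The Laplacian of the field is the factor that gets expanded, its series being absolutely
  convergent; integrability suffices for the nonlinearity.\<close>

lemma has_sum_convect_neg_lap:
  "((\<lambda>k. lap_symbol k * (\<Sum>i\<in>UNIV. cf v i k \<bullet> cf (convect v v) i k)) has_sum l2_inner (convect v v) (neg_lap v)) UNIV"
proof -
  let ?N = "\<lambda>i x. convect v v x $ i"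
  have iN: "integrable T3 (?N i)" for i
    unfolding convect_def vec_lambda_beta by (intro Bochner_Integration.integrable_sum HdotM_convect_integrable[OF vM])
  have c: "abs_coef (fcoef (NL i))" for i
    unfolding NL_properties(2)[abs_def] by (rule lap_abs_coef)
  have h: "((\<lambda>k. lap_symbol k * (cf v i k \<bullet> cf (convect v v) i k)) has_sum (LINT x|T3. NL i x * ?N i x)) UNIV" for i
  proof -
    have "((\<lambda>k. Re (fcoef (NL i) k * cnj (fcoef (?N i) k))) has_sum Re (complex_of_real (LINT x|T3. NL i x * ?N i x))) UNIV"
      by (intro has_sum_Re has_sum_inner_L2 NL_properties c iN)
    moreover have "Re (fcoef (NL i) k * cnj (fcoef (?N i) k)) = lap_symbol k * (cf v i k \<bullet> cf (convect v v) i k)" for k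
      unfolding NL_properties(2) by (simp add: cf_def inner_complex_def algebra_simps)
    ultimately show ?thesis by (simp only: Re_complex_of_real)
  qed
  have "((\<lambda>k. \<Sum>i\<in>UNIV. lap_symbol k * (cf v i k \<bullet> cf (convect v v) i k)) has_sum (\<Sum>i\<in>UNIV. LINT x|T3. NL i x * ?N i x)) UNIV"
    by (intro has_sum_sum h) simp
  moreover have "(\<Sum>i\<in>UNIV. LINT x|T3. NL i x * ?N i x) = l2_inner (convect v v) (neg_lap v)"
  proof -
    have i2: "integrable T3 (\<lambda>x. ?N i x * NL i x)" for i
      using L2_mult_integrable[OF NL_properties(1) c iN, of i i] by (simp only: mult.commute)
    show ?thesis
      unfolding l2_inner_def inner_vec_def neg_lap_nth inner_real_def Bochner_Integration.integral_sum[OF i2]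
      by (simp only: mult.commute)
  qed
  ultimately show ?thesis by (simp only: sum_distrib_left)
qed

end

text \<open>The projection onto \<open>vdir k\<close> is self-adjoint and the coefficient of the
  field is already a multiple of \<open>vdir k\<close>, so the constraint is invisible in the energy
  pairing. If \<open>vdir k\<close> vanishes, so do both sides.\<close>

lemma inner_pmc:
  assumes v: "v \<in> HdotM s" and k: "k \<in> Mfreq"
  shows "(\<Sum>i\<in>UNIV. cf v i k \<bullet> pmc w i k) = (\<Sum>i\<in>UNIV. cf v i k \<bullet> cf w i k)"
proof -
  obtain z where z: "\<And>i. cf v i k = z * complex_of_real (vdir k $ i)"
    using HdotM_dir[OF v k] by blast
  let ?s = "\<Sum>j\<in>UNIV. complex_of_real (vdir k $ j) * cf w j k"
  have "(\<Sum>i\<in>UNIV. cf v i k \<bullet> pmc w i k) = (z \<bullet> ?s) * (norm (vdir k))\<^sup>2"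
    unfolding pmc_eq[OF k] z power2_norm_eq_inner
    by (simp add: inner_complex_def inner_vec_def sum_3 algebra_simps)
  also have "\<dots> = z \<bullet> ?s"
    using norm_vdir[of k] by (cases "vdir k = 0") auto
  also have "\<dots> = (\<Sum>i\<in>UNIV. cf v i k \<bullet> cf w i k)"
    unfolding z by (simp add: inner_complex_def sum_3 algebra_simps)
  finally show ?thesis .
qed

section \<open>Differentiation of the enstrophy in time\<close>

context mild_C1
begin

lemma smooth_M_at: "0 < t \<Longrightarrow> ereal t < Tmax \<Longrightarrow> smooth_M (u t)"
proof
  assume t: "0 < t" "ereal t < Tmax"
  then show "u t \<in> HdotM 1" by (intro in_HdotM) (simp add: time_dom_def)
  show "\<exists>C. \<forall>k\<in>Mfreq. \<forall>i. cmod (c i k t) \<le> C * Wt k powr (- s)" for s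
    using decay_all[of s, unfolded decay_def, rule_format, of t t] t by auto
qed

definition energy' :: "int^3 \<Rightarrow> real \<Rightarrow> real" where
  "energy' k t = lap_symbol k * (\<Sum>i\<in>UNIV. 2 * (c i k t \<bullet> (- (\<nu> * lam k) *\<^sub>R c i k t - P i k t)))"

lemma energy_derivative_mode:
  assumes t: "0 < t" "ereal t < Tmax"
  shows "((\<lambda>s. lap_symbol k * fcoef_sq (u s) k) has_real_derivative energy' k t) (at t)"
proof (cases "k \<in> Mfreq")
  case True
  have "((\<lambda>s. c i k s \<bullet> c i k s) has_vector_derivative
      (c i k t \<bullet> (- (\<nu> * lam k) *\<^sub>R c i k t - P i k t) + (- (\<nu> * lam k) *\<^sub>R c i k t - P i k t) \<bullet> c i k t)) (at t)" for i
    by (rule bounded_bilinear.has_vector_derivative[OF bounded_bilinear_inner ode[OF t True] ode[OF t True]])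
  then have "((\<lambda>s. (cmod (c i k s))\<^sup>2) has_real_derivative 2 * (c i k t \<bullet> (- (\<nu> * lam k) *\<^sub>R c i k t - P i k t))) (at t)" for i
    unfolding has_real_derivative_iff_has_vector_derivative power2_norm_eq_inner
    by (simp add: inner_commute)
  then show ?thesis
    unfolding energy'_def fcoef_sq_cf by (intro DERIV_cmult DERIV_sum)
next
  case False
  obtain b where b: "t < b" "ereal b < Tmax" using ereal_less_dense[OF t(2)] by blast
  have "u s \<in> HdotM 1" if "s \<in> {0<..<b}" for s
    using that b time_dom_mono[of s b] t by (intro in_HdotM) (auto simp: time_dom_def)
  then have "fcoef_sq (u s) k = 0" if "s \<in> {0<..<b}" for s
    using HdotM_fcoef_sq_supp False that by blast
  moreover have "energy' k t = 0"
    using False HdotM_supp[OF in_HdotM[of t] False] t by (simp add: energy'_def P_def pmc_def PM_coef_def time_dom_def)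
  ultimately show ?thesis
    using t b by (auto intro: has_field_derivative_transform_within_open[of "\<lambda>_. 0" _ _ "{0<..<b}"])
qed

lemma energy'_bound:
  assumes ab: "0 < a" "a \<le> b" "ereal b < Tmax"
  shows "\<exists>B. B summable_on UNIV \<and> (\<forall>t\<in>{a..b}. \<forall>k. \<bar>energy' k t\<bar> \<le> B k)"
proof -
  \<comment> \<open>Power count: the Laplacian symbol contributes 2, the coefficient -3 - \<alpha>,
    and its time derivative \<alpha> - 3, because the dissipation costs 2 \<alpha> and the nonlinear
    part is smaller. The total -4 is below the -1 that is used for summability.\<close>
  let ?r = "3 + \<alpha>"
  obtain C' where "\<forall>t\<in>{a..b}. \<forall>k\<in>Mfreq. \<forall>i. cmod (c i k t) \<le> C' * Wt k powr (- ?r)"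
    using decay_all[of ?r] ab unfolding decay_def by blast
  then have C': "cmod (c i k t) \<le> C' * Wt k powr (- ?r)" if "t \<in> {a..b}" "k \<in> Mfreq" for t k i
    using that by blast
  define C where "C = \<bar>C'\<bar>"
  have C: "cmod (c i k t) \<le> C * Wt k powr (- ?r)" if "t \<in> {a..b}" "k \<in> Mfreq" for t k i
    by (rule order_trans[OF C'[OF that, of i] mult_right_mono]) (auto simp: C_def)
  define K where "K = 5184 * pi * (2 powr ?r)\<^sup>2 * C\<^sup>2"
  define L where "L = (48 * pi\<^sup>2) powr \<alpha>"
  define M where "M = 48 * pi\<^sup>2 * (3 * (2 * (C * (\<nu> * L * C + K))))"
  have nn: "0 \<le> C" "0 \<le> K" "0 \<le> L" using nu by (auto simp: C_def K_def L_def)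
  have bound: "\<bar>energy' k t\<bar> \<le> M * Wt k powr (- 1)" if t: "t \<in> {a..b}" and k: "k \<in> Mfreq" for t k
  proof -
    note W = Wt_pos[OF k]
    have td: "t \<in> time_dom Tmax"
      using t ab time_dom_mono[of t b] by (auto simp: time_dom_def)
    have P: "cmod (P i k t) \<le> K * Wt k powr (1 - 2 * ?r)" for i
      unfolding K_def using alpha by (intro P_bound[OF td _ k C[OF t]]) auto
    have "lam k \<le> (48 * pi\<^sup>2 * (Wt k)\<^sup>2) powr \<alpha>"
      unfolding lam_def using lap_symbol_le[OF k] alpha by (intro powr_mono2) auto
    also have "\<dots> = L * Wt k powr (2 * \<alpha>)"
      using W by (simp add: L_def powr_mult powr_powr[symmetric])
    finally have lam: "lam k \<le> L * Wt k powr (2 * \<alpha>)" .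
    have d: "cmod (- (\<nu> * lam k) *\<^sub>R c i k t - P i k t) \<le> (\<nu> * L * C + K) * Wt k powr (\<alpha> - 3)" for i
    proof -
      have "cmod (- (\<nu> * lam k) *\<^sub>R c i k t - P i k t) \<le> cmod (- (\<nu> * lam k) *\<^sub>R c i k t) + cmod (P i k t)"
        by (rule norm_triangle_ineq4)
      also have "cmod (- (\<nu> * lam k) *\<^sub>R c i k t) = \<nu> * lam k * cmod (c i k t)"
        using nu lam_pos[OF k] by simp
      also have "\<dots> \<le> (\<nu> * (L * Wt k powr (2 * \<alpha>))) * (C * Wt k powr (- ?r))"
        using nu lam C[OF t k, of i] nn by (intro mult_mono mult_left_mono) auto
      also have "\<dots> = \<nu> * L * C * Wt k powr (\<alpha> - 3)"
        using powr_add[of "Wt k" "2 * \<alpha>" "- ?r"] by (simp add: mult_ac)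
      also have "cmod (P i k t) \<le> K * Wt k powr (\<alpha> - 3)"
        using P[of i] mult_left_mono[OF powr_mono[of "1 - 2 * ?r" "\<alpha> - 3" "Wt k"] nn(2)] W alpha by simp
      finally show ?thesis by (simp add: distrib_right)
    qed
    have "\<bar>2 * (c i k t \<bullet> (- (\<nu> * lam k) *\<^sub>R c i k t - P i k t))\<bar> \<le> 2 * (C * (\<nu> * L * C + K)) * Wt k powr (- 6)" for i
    proof -
      have "\<bar>c i k t \<bullet> (- (\<nu> * lam k) *\<^sub>R c i k t - P i k t)\<bar> \<le> cmod (c i k t) * cmod (- (\<nu> * lam k) *\<^sub>R c i k t - P i k t)"
        by (rule Cauchy_Schwarz_ineq2)
      also have "\<dots> \<le> (C * Wt k powr (- ?r)) * ((\<nu> * L * C + K) * Wt k powr (\<alpha> - 3))"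
        using nn by (intro mult_mono C[OF t k] d) auto
      also have "\<dots> = (C * (\<nu> * L * C + K)) * Wt k powr (- 6)"
        using powr_add[of "Wt k" "- ?r" "\<alpha> - 3"] by (simp add: mult_ac)
      finally show ?thesis by (simp add: abs_mult)
    qed
    then have s: "\<bar>\<Sum>i\<in>UNIV. 2 * (c i k t \<bullet> (- (\<nu> * lam k) *\<^sub>R c i k t - P i k t))\<bar> \<le> (\<Sum>i\<in>(UNIV::3 set). 2 * (C * (\<nu> * L * C + K)) * Wt k powr (- 6))"
      by (intro order_trans[OF sum_abs] sum_mono)
    have "\<bar>energy' k t\<bar> \<le> (48 * pi\<^sup>2 * (Wt k)\<^sup>2) * (\<Sum>i\<in>(UNIV::3 set). 2 * (C * (\<nu> * L * C + K)) * Wt k powr (- 6))"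
      unfolding energy'_def abs_mult using lap_symbol_le[OF k] s by (intro mult_mono) auto
    also have "\<dots> = M * ((Wt k)\<^sup>2 * Wt k powr (- 6))" by (simp add: M_def)
    also have "(Wt k)\<^sup>2 * Wt k powr (- 6) = Wt k powr (- 4)"
      using W powr_add[of "Wt k" 2 "- 6"] by simp
    also have "M * Wt k powr (- 4) \<le> M * Wt k powr (- 1)"
      using W nn nu by (intro mult_left_mono powr_mono) (auto simp: M_def)
    finally show ?thesis .
  qed
  have out: "energy' k t = 0" if "t \<in> {a..b}" "k \<notin> Mfreq" for t k
  proof -
    have "t \<in> time_dom Tmax"
      using that ab time_dom_mono[of t b] by (auto simp: time_dom_def)
    then show ?thesis
      using HdotM_supp[OF in_HdotM that(2)] that by (simp add: energy'_def P_def pmc_def PM_coef_def)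
  qed
  have "(\<lambda>k. M * Wt k powr (- 1)) summable_on Mfreq"
    by (intro summable_on_cmult_right Wt_powr_summable) simp
  then have "(\<lambda>k. if k \<in> Mfreq then M * Wt k powr (- 1) else 0) summable_on UNIV"
    by (rule summable_on_cong_neutral[THEN iffD1, rotated -1]) auto
  moreover have "\<forall>t\<in>{a..b}. \<forall>k. \<bar>energy' k t\<bar> \<le> (if k \<in> Mfreq then M * Wt k powr (- 1) else 0)"
    using bound out by auto
  ultimately show ?thesis by blast
qed

lemma energy_derivative:
  assumes t: "0 < t" "ereal t < Tmax"
  shows "((\<lambda>s. \<Sum>\<^sub>\<infinity>k. lap_symbol k * fcoef_sq (u s) k) has_real_derivative
     - 2 * \<nu> * (\<Sum>\<^sub>\<infinity>k. lap_symbol k powr (\<alpha> + 1) * fcoef_sq (u t) k)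
     - 2 * l2_inner (convect (u t) (u t)) (neg_lap (u t))) (at t)"
proof -
  obtain b where b: "t < b" "ereal b < Tmax" using ereal_less_dense[OF t(2)] by blast
  have Tb: "ereal s < Tmax" if "s \<le> b" for s
    using that b by (meson ereal_less_eq(3) le_less_trans)
  \<comment> \<open>The decay bounds are available only away from time 0; starting at
    \<open>t / 2\<close> leaves a full neighbourhood of \<open>t\<close>.\<close>
  obtain B where B: "B summable_on UNIV" "\<And>s k. s \<in> {t/2..b} \<Longrightarrow> \<bar>energy' k s\<bar> \<le> B k"
    using energy'_bound[of "t/2" b] b t by auto
  have D: "((\<lambda>s. \<Sum>\<^sub>\<infinity>k. lap_symbol k * fcoef_sq (u s) k) has_real_derivative (\<Sum>\<^sub>\<infinity>k. energy' k t)) (at t)"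
  proof (rule has_real_derivative_infsum[of "t/2" t b _ _ B])
    fix s assume s: "s \<in> {t/2..b}"
    then have s': "0 < s" "ereal s < Tmax" using t Tb by auto
    show "((\<lambda>s. lap_symbol k * fcoef_sq (u s) k) has_real_derivative energy' k s) (at s)" for k
      by (rule energy_derivative_mode[OF s'])
    show "\<bar>energy' k s\<bar> \<le> B k" for k by (rule B(2)[OF s])
    show "(\<lambda>k. lap_symbol k * fcoef_sq (u s) k) summable_on UNIV"
      by (rule smooth_M.lap_1_fcoef_sq_summable[OF smooth_M_at[OF s']])
  qed (use t b B in auto)
  interpret S: smooth_M "u t" by (rule smooth_M_at[OF t])
  let ?N = "convect (u t) (u t)"
  have e: "energy' k t = (- 2 * \<nu>) * (lap_symbol k powr (\<alpha> + 1) * fcoef_sq (u t) k)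
      + (- 2) * (lap_symbol k * (\<Sum>i\<in>UNIV. c i k t \<bullet> cf ?N i k))" for k
  proof (cases "k \<in> Mfreq")
    case True
    have "(\<Sum>i\<in>UNIV. 2 * (c i k t \<bullet> (- (\<nu> * lam k) *\<^sub>R c i k t - P i k t))) =
       (- 2 * \<nu>) * (lam k * fcoef_sq (u t) k) + (- 2) * (\<Sum>i\<in>UNIV. c i k t \<bullet> pmc ?N i k)"
      unfolding fcoef_sq_cf P_def power2_norm_eq_inner
      by (simp add: inner_diff_right sum_subtractf sum_distrib_left sum_negf algebra_simps)
    also have "(\<Sum>i\<in>UNIV. c i k t \<bullet> pmc ?N i k) = (\<Sum>i\<in>UNIV. c i k t \<bullet> cf ?N i k)"
      by (rule inner_pmc[OF S.vM True])
    finally have s: "(\<Sum>i\<in>UNIV. 2 * (c i k t \<bullet> (- (\<nu> * lam k) *\<^sub>R c i k t - P i k t))) =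
       (- 2 * \<nu>) * (lam k * fcoef_sq (u t) k) + (- 2) * (\<Sum>i\<in>UNIV. c i k t \<bullet> cf ?N i k)" .
    have l: "lap_symbol k powr (\<alpha> + 1) * fcoef_sq (u t) k = lap_symbol k * (lam k * fcoef_sq (u t) k)"
      unfolding S.lap_powr_Suc[symmetric] lam_def by (rule mult.left_commute)
    have "y * ((- 2 * \<nu>) * p + (- 2) * q) = (- 2 * \<nu>) * (y * p) + (- 2) * (y * q)" for y p q :: real
      by (simp add: algebra_simps)
    then show ?thesis
      unfolding energy'_def s l .
  next
    case False
    then show ?thesis
      using HdotM_supp[OF S.vM False] HdotM_fcoef_sq_supp[OF S.vM False]
      by (simp add: energy'_def)
  qed
  have s1: "((\<lambda>k. lap_symbol k powr (\<alpha> + 1) * fcoef_sq (u t) k) has_sum (\<Sum>\<^sub>\<infinity>k. lap_symbol k powr (\<alpha> + 1) * fcoef_sq (u t) k)) UNIV"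
    using S.lap_fcoef_sq_summable[of "\<alpha> + 1" UNIV] alpha by (intro has_sum_infsum) auto
  have "((\<lambda>k. energy' k t) has_sum (- 2 * \<nu>) * (\<Sum>\<^sub>\<infinity>k. lap_symbol k powr (\<alpha> + 1) * fcoef_sq (u t) k)
      + (- 2) * l2_inner ?N (neg_lap (u t))) UNIV"
    unfolding e by (intro has_sum_add has_sum_cmult_right s1 S.has_sum_convect_neg_lap)
  then have "(\<Sum>\<^sub>\<infinity>k. energy' k t) = - 2 * \<nu> * (\<Sum>\<^sub>\<infinity>k. lap_symbol k powr (\<alpha> + 1) * fcoef_sq (u t) k)
     - 2 * l2_inner ?N (neg_lap (u t))"
    by (simp add: infsumI)
  then show ?thesis using D by simp
qed

text \<open>The three quantities are fixed multiples of one sum, so a single derivative serves them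
  all. Agreement at positive times is enough, since differentiation is local.\<close>

lemma enstrophy_derivative:
  assumes t: "0 < t" "ereal t < Tmax"
    and F: "\<And>s. 0 < s \<Longrightarrow> ereal s < Tmax \<Longrightarrow> F s = r * (\<Sum>\<^sub>\<infinity>k. lap_symbol k * fcoef_sq (u s) k)"
  shows "(F has_real_derivative r * (- 2 * \<nu> * (\<Sum>\<^sub>\<infinity>k. lap_symbol k powr (\<alpha> + 1) * fcoef_sq (u t) k)
     - 2 * l2_inner (convect (u t) (u t)) (neg_lap (u t)))) (at t)"
proof -
  obtain b where b: "t < b" "ereal b < Tmax" using ereal_less_dense[OF t(2)] by blast
  have "ereal s < Tmax" if "s < b" for s
    using that b by (meson ereal_less_eq(3) le_less_trans less_imp_le)
  then have "r * (\<Sum>\<^sub>\<infinity>k. lap_symbol k * fcoef_sq (u s) k) = F s" if "s \<in> {0<..<b}" for s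
    using F that by auto
  then show ?thesis
    using DERIV_cmult[OF energy_derivative[OF t], of r] t b
    by (auto intro: has_field_derivative_transform_within_open[of _ _ _ "{0<..<b}"])
qed

end

text \<open>The regularity and integrability claims give the balance laws their content: a divergent
  integral or \<open>infsum\<close> is 0 by convention, so without them an equation could hold by
  default. The inequality for \<open>deriv\<close> likewise rests on the differentiability asserted
  before it.\<close>

theorem propositionC4:
  fixes \<nu> \<alpha> :: real and Tmax :: ereal and u :: "real \<Rightarrow> real^3 \<Rightarrow> real^3"
  assumes "\<nu> > 0" and "\<alpha> > 0"
    and "u \<in> C1_HdotM1 Tmax"
    and "mild_solution \<nu> \<alpha> Tmax u"
  shows "\<forall>t. 0 < t \<and> ereal t < Tmax \<longrightarrow>
    (u t \<in> Hdot 2 \<and> grad (u t) \<in> Hdot \<alpha> \<and> vorticity (u t) \<in> Hdot \<alpha> \<and> strain (u t) \<in> Hdot \<alpha> \<and>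
     integrable T3 (\<lambda>x. convect (u t) (u t) x \<bullet> neg_lap (u t) x) \<and>
     integrable T3 (\<lambda>x. strain (u t) x \<bullet> outer (vorticity (u t) x) (vorticity (u t) x)) \<and>
     integrable T3 (\<lambda>x. det (strain (u t) x)) \<and>
     integrable T3 (\<lambda>x. max (lambda2 (strain (u t) x)) 0 * (norm (strain (u t) x))\<^sup>2)) \<and>
    ((\<lambda>s. 1/2 * (l2_norm (grad (u s)))\<^sup>2) has_real_derivative
       - \<nu> * (Hdot_norm \<alpha> (grad (u t)))\<^sup>2
       - l2_inner (convect (u t) (u t)) (neg_lap (u t))) (at t) \<and>
    ((\<lambda>s. 1/2 * (l2_norm (vorticity (u s)))\<^sup>2) has_real_derivative
       - \<nu> * (Hdot_norm \<alpha> (vorticity (u t)))\<^sup>2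
       + l2_inner (strain (u t)) (\<lambda>x. outer (vorticity (u t) x) (vorticity (u t) x))) (at t) \<and>
    ((\<lambda>s. (l2_norm (strain (u s)))\<^sup>2) has_real_derivative
       - 2 * \<nu> * (Hdot_norm \<alpha> (strain (u t)))\<^sup>2
       - 4 * (LINT x|T3. det (strain (u t) x))) (at t) \<and>
    deriv (\<lambda>s. (l2_norm (strain (u s)))\<^sup>2) t \<le>
       - 2 * \<nu> * (Hdot_norm \<alpha> (strain (u t)))\<^sup>2
       + 2 * (LINT x|T3. max (lambda2 (strain (u t) x)) 0 * (norm (strain (u t) x))\<^sup>2)"
proof (intro allI impI)
  fix t assume "0 < t \<and> ereal t < Tmax"
  then have t: "0 < t" "ereal t < Tmax" by auto
  interpret mild_C1 \<nu> \<alpha> Tmax u by (rule mild_C1.intro[OF assms])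
  interpret S: smooth_M "u t" by (rule smooth_M_at[OF t])
  have a: "0 \<le> \<alpha>" using assms(2) by simp
  let ?E = "\<Sum>\<^sub>\<infinity>k. lap_symbol k powr (\<alpha> + 1) * fcoef_sq (u t) k"
  let ?I = "l2_inner (convect (u t) (u t)) (neg_lap (u t))"
  note norms = S.Hdot_norm_derivatives[OF a]
  have h: "1/2 * (- 2 * \<nu> * ?E - 2 * ?I) = - \<nu> * ?E - ?I"
    by (simp add: field_simps)
  have 1: "((\<lambda>s. 1/2 * (l2_norm (grad (u s)))\<^sup>2) has_real_derivative - \<nu> * (Hdot_norm \<alpha> (grad (u t)))\<^sup>2 - ?I) (at t)"
    using enstrophy_derivative[OF t, of "\<lambda>s. 1/2 * (l2_norm (grad (u s)))\<^sup>2" "1/2", unfolded h]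
      smooth_M.l2_norm_derivatives(1)[OF smooth_M_at]
    by (simp add: norms(1))
  have 2: "((\<lambda>s. 1/2 * (l2_norm (vorticity (u s)))\<^sup>2) has_real_derivative - \<nu> * (Hdot_norm \<alpha> (vorticity (u t)))\<^sup>2
       + l2_inner (strain (u t)) (\<lambda>x. outer (vorticity (u t) x) (vorticity (u t) x))) (at t)"
    using enstrophy_derivative[OF t, of "\<lambda>s. 1/2 * (l2_norm (vorticity (u s)))\<^sup>2" "1/2", unfolded h]
      smooth_M.l2_norm_derivatives(2)[OF smooth_M_at]
    by (simp add: norms(2) S.convect_neg_lap(2) l2_inner_def[of "strain (u t)"] S.strain_vorticity(2))
  \<comment> \<open>The squared strain norm is half the enstrophy sum, so the same factor
    \<open>1/2\<close> applies although this norm carries no prefactor; its dissipation norm is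
    halved too, which restores the 2 in front of \<nu>.\<close>
  have 3: "((\<lambda>s. (l2_norm (strain (u s)))\<^sup>2) has_real_derivative - 2 * \<nu> * (Hdot_norm \<alpha> (strain (u t)))\<^sup>2
       - 4 * (LINT x|T3. det (strain (u t) x))) (at t)"
    using enstrophy_derivative[OF t, of "\<lambda>s. (l2_norm (strain (u s)))\<^sup>2" "1/2", unfolded h]
      smooth_M.l2_norm_derivatives(3)[OF smooth_M_at]
    by (simp add: norms(3) S.convect_neg_lap(2) S.det_strain(2))
  have 4: "deriv (\<lambda>s. (l2_norm (strain (u s)))\<^sup>2) t \<le> - 2 * \<nu> * (Hdot_norm \<alpha> (strain (u t)))\<^sup>2
       + 2 * (LINT x|T3. max (lambda2 (strain (u t) x)) 0 * (norm (strain (u t) x))\<^sup>2)"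
    using S.det_strain_le_lambda2 DERIV_imp_deriv[OF 3] by linarith
  show "(u t \<in> Hdot 2 \<and> grad (u t) \<in> Hdot \<alpha> \<and> vorticity (u t) \<in> Hdot \<alpha> \<and> strain (u t) \<in> Hdot \<alpha> \<and>
     integrable T3 (\<lambda>x. convect (u t) (u t) x \<bullet> neg_lap (u t) x) \<and>
     integrable T3 (\<lambda>x. strain (u t) x \<bullet> outer (vorticity (u t) x) (vorticity (u t) x)) \<and>
     integrable T3 (\<lambda>x. det (strain (u t) x)) \<and>
     integrable T3 (\<lambda>x. max (lambda2 (strain (u t) x)) 0 * (norm (strain (u t) x))\<^sup>2)) \<and>
    ((\<lambda>s. 1/2 * (l2_norm (grad (u s)))\<^sup>2) has_real_derivative
       - \<nu> * (Hdot_norm \<alpha> (grad (u t)))\<^sup>2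
       - l2_inner (convect (u t) (u t)) (neg_lap (u t))) (at t) \<and>
    ((\<lambda>s. 1/2 * (l2_norm (vorticity (u s)))\<^sup>2) has_real_derivative
       - \<nu> * (Hdot_norm \<alpha> (vorticity (u t)))\<^sup>2
       + l2_inner (strain (u t)) (\<lambda>x. outer (vorticity (u t) x) (vorticity (u t) x))) (at t) \<and>
    ((\<lambda>s. (l2_norm (strain (u s)))\<^sup>2) has_real_derivative
       - 2 * \<nu> * (Hdot_norm \<alpha> (strain (u t)))\<^sup>2
       - 4 * (LINT x|T3. det (strain (u t) x))) (at t) \<and>
    deriv (\<lambda>s. (l2_norm (strain (u s)))\<^sup>2) t \<le>
       - 2 * \<nu> * (Hdot_norm \<alpha> (strain (u t)))\<^sup>2
       + 2 * (LINT x|T3. max (lambda2 (strain (u t) x)) 0 * (norm (strain (u t) x))\<^sup>2)"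
    using S.in_Hdot[of 2] S.derivatives_in_Hdot[OF a] S.convect_neg_lap(1) S.strain_vorticity(1) S.det_strain(1)
      S.lambda2_strain_integrable 1 2 3 4
    by (intro conjI) simp_all
qed

end
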